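(* Let $k$ be an infinite field, $k_1/k$ a separable cubic extension with normal closure $k_2$, $\sigma\in\mathrm{Gal}(k_2/k)$ an element acting as the 3-cycle $(123)$ on the three embeddings $1,\sigma,\sigma^2$ of $k_1$ into $k_2$. Let $V$ be the $8$-dimensional $k$-space of tensors $x=\sum_{i,j,l\in\{1,2\}}x_{ijl}e_{ijl}\in k_2^2\otimes k_2^2\otimes k_2^2$ satisfying $x_{111},x_{222}\in k$, $x_{122},x_{211}\in k_1$, $x_{212}=x_{122}^\sigma$, $x_{221}=x_{122}^{\sigma^2}$, $x_{121}=x_{211}^\sigma$, $x_{112}=x_{211}^{\sigma^2}$, with $G=\mathrm{GL}(1)_k\times\mathrm{GL}(2)_{k_1}$ acting by $(t,g)\cdot(x_1\otimes x_2\otimes x_3)=t\,gx_1\otimes g^\sigma x_2\otimes g^{\sigma^2}x_3$. Let $w=e_{111}+e_{222}$, and let $\alpha_V:G_k\backslash V_k^{\mathrm{ss}}\to\mathrm{H}^1(k,\mathfrak S_2)$ (the set of isomorphism classes of étale quadratic algebras/quadratic splitting fields over $k$) be the map induced by the split exact sequence $1\to G_w^0\to G_w\to\mathfrak S_2\to1$ and the bijection $G_k\backslash V_k^{\mathrm{ss}}\cong\mathrm{H}^1(k,G_w)$. (1) There is a bijection $$\mathfrak{S}_2 \backslash (k^\times / N_{k_1/k}(k_1^\times))^2 / \{(t, t) \mid t \in k^\times\} \cong \alpha_V^{-1}(k),$$ where the action of $\mathfrak{S}_2$ is given by permutations. Moreover $\beta = (\beta_1, \beta_2) \in (k^\times)^2$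 corresponds to the orbit of $\beta_1 e_{111} + \beta_2 e_{222}$. (2) Let $k(\alpha)/k$ be a separable quadratic extension generated by the roots $\alpha_1,\alpha_2$ of $f(v)=v_1^2+a_1v_1v_2+a_2v_2^2\in k[v]$, let $\nu$ be the non-trivial element of $\mathrm{Gal}(k(\alpha)/k)$ (extended to $k_2(\alpha)$ so as to be trivial on $k_1$), and let $g_\alpha=\left(1,\begin{pmatrix}1&1\\-\alpha_1&-\alpha_2\end{pmatrix}\right)$. Then there is a bijection $$\mathfrak{S}_2 \backslash \big(k(\alpha)^\times / k^\times N_{k_1(\alpha)/k(\alpha)}(k_1(\alpha)^\times)\big) \cong \alpha_V^{-1}(k(\alpha)),$$ where the action of the non-trivial element $\nu \in \mathfrak{S}_2 \cong \mathrm{Gal}(k(\alpha)/k)$ is given by the usual Galois group action. Moreover, $\beta \in k(\alpha)^\times$ corresponds to the orbit of $g_\alpha(\beta e_{111} + \beta^\nu e_{222})$.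
   Context: Here $k_1(\alpha)=k_1\otimes k(\alpha)$, and the Galois group acts trivially on $\mathfrak S_2$. *)

theory Defs
  imports
    "HOL-Analysis.Determinants"
    "HOL-Analysis.Cartesian_Space"
    "HOL-Computational_Algebra.Polynomial"
    "HOL-Library.FuncSet"
    "HOL-Algebra.Coset"
    "HOL-Algebra.Sym_Groups"
begin

text \<open>All fields are subfields of one ambient field \<open>'a\<close>, which will be assumed to be a
  separable closure of the base field \<open>k\<close>.\<close>

subsection \<open>Field extensions\<close>

definition is_subfield :: "'a::field set \<Rightarrow> bool" where
  "is_subfield F \<longleftrightarrow> 0 \<in> F \<and> 1 \<in> F \<and>
     (\<forall>x\<in>F. \<forall>y\<in>F. x + y \<in> F \<and> x * y \<in> F) \<and> (\<forall>x\<in>F. - x \<in> F \<and> inverse x \<in> F)"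

definition field_gen :: "'a::field set \<Rightarrow> 'a set" where
  "field_gen S = \<Inter> {F. is_subfield F \<and> S \<subseteq> F}"

definition polys_over :: "'a::field set \<Rightarrow> 'a poly set" where
  "polys_over F = {p. \<forall>i. poly.coeff p i \<in> F}"

definition irreducible_over :: "'a::field set \<Rightarrow> 'a poly \<Rightarrow> bool" where
  "irreducible_over F p \<longleftrightarrow> p \<in> polys_over F \<and> degree p > 0 \<and>
     (\<forall>q\<in>polys_over F. \<forall>r\<in>polys_over F. p = q * r \<longrightarrow> degree q = 0 \<or> degree r = 0)"

definition separable_over :: "'a::field set \<Rightarrow> 'a \<Rightarrow> bool" where
  "separable_over F x \<longleftrightarrow>
     (\<exists>p. irreducible_over F p \<and> poly p x = 0 \<and> coprime p (pderiv p))"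

definition separable_ext :: "'a::field set \<Rightarrow> 'a set \<Rightarrow> bool" where
  "separable_ext F L \<longleftrightarrow> F \<subseteq> L \<and> (\<forall>x\<in>L. separable_over F x)"

definition UNIV_separable_closure :: "'a::field set \<Rightarrow> bool" where
  "UNIV_separable_closure F \<longleftrightarrow> separable_ext F UNIV \<and>
     (\<forall>p :: 'a poly. degree p > 0 \<and> coprime p (pderiv p) \<longrightarrow> (\<exists>x. poly p x = 0))"

definition ext_degree :: "'a::field set \<Rightarrow> 'a set \<Rightarrow> nat \<Rightarrow> bool" where
  "ext_degree F L n \<longleftrightarrow> F \<subseteq> L \<and> (\<exists>b :: nat \<Rightarrow> 'a. (\<forall>i<n. b i \<in> L) \<and>
     (\<forall>x\<in>L. \<exists>!c. c \<in> {..<n} \<rightarrow>\<^sub>E F \<and> x = (\<Sum>i<n. c i * b i)))"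

definition normal_ext :: "'a::field set \<Rightarrow> 'a set \<Rightarrow> bool" where
  "normal_ext F L \<longleftrightarrow> is_subfield L \<and> F \<subseteq> L \<and>
     (\<forall>x\<in>L. \<exists>p. irreducible_over F p \<and> poly p x = 0) \<and>
     (\<forall>p. irreducible_over F p \<and> (\<exists>x\<in>L. poly p x = 0) \<longrightarrow>
        (\<exists>c rs. set rs \<subseteq> L \<and> p = smult c (\<Prod>r\<leftarrow>rs. [:- r, 1:])))"

definition is_normal_closure :: "'a::field set \<Rightarrow> 'a set \<Rightarrow> 'a set \<Rightarrow> bool" where
  "is_normal_closure F L M \<longleftrightarrow> normal_ext F M \<and> L \<subseteq> M \<and>
     (\<forall>M'. normal_ext F M' \<and> L \<subseteq> M' \<longrightarrow> M \<subseteq> M')"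

definition field_hom_on :: "'a::field set \<Rightarrow> 'a set \<Rightarrow> ('a \<Rightarrow> 'a) \<Rightarrow> bool" where
  "field_hom_on F L f \<longleftrightarrow> (\<forall>x\<in>F. f x = x) \<and>
     (\<forall>x\<in>L. \<forall>y\<in>L. f (x + y) = f x + f y \<and> f (x * y) = f x * f y)"

text \<open>Values outside \<open>L\<close> are irrelevant for members of \<open>Gal F L\<close>; it is used as a set of
  functions up to equality only for \<open>L = UNIV\<close>.\<close>

definition Gal :: "'a::field set \<Rightarrow> 'a set \<Rightarrow> ('a \<Rightarrow> 'a) set" where
  "Gal F L = {f. bij_betw f L L \<and> field_hom_on F L f}"

definition embeddings :: "'a::field set \<Rightarrow> 'a set \<Rightarrow> 'a set \<Rightarrow> ('a \<Rightarrow> 'a) set" where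
  "embeddings F L M = {f \<in> L \<rightarrow>\<^sub>E M. field_hom_on F L f}"

text \<open>The norm of a finite separable extension \<open>L/F\<close>, as the product of the conjugates.\<close>

definition field_norm :: "'a::field set \<Rightarrow> 'a set \<Rightarrow> 'a \<Rightarrow> 'a" where
  "field_norm F L x = (\<Prod>f\<in>embeddings F L UNIV. f x)"

definition mult_units :: "'a::field set \<Rightarrow> 'a monoid" where
  "mult_units F = \<lparr>carrier = F - {0}, mult = (*), one = 1\<rparr>"

subsection \<open>First non-abelian Galois cohomology\<close>

definition abs_Gal :: "'a::field set \<Rightarrow> ('a \<Rightarrow> 'a) set" where
  "abs_Gal k = Gal k UNIV"

text \<open>Continuous 1-cocycles of \<open>Gal(k\<^sup>s\<^sup>e\<^sup>p/k)\<close> with its Krull topology, for an action \<open>act\<close>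
  on a discrete group \<open>H\<close>: the sets of automorphisms agreeing with \<open>\<tau>\<close> on a finite set
  form a base of neighbourhoods of \<open>\<tau>\<close>.\<close>

definition Z1 :: "'a::field set \<Rightarrow> 'h monoid \<Rightarrow> (('a \<Rightarrow> 'a) \<Rightarrow> 'h \<Rightarrow> 'h) \<Rightarrow> (('a \<Rightarrow> 'a) \<Rightarrow> 'h) set" where
  "Z1 k H act = {c \<in> abs_Gal k \<rightarrow>\<^sub>E carrier H.
     (\<forall>s\<in>abs_Gal k. \<forall>t\<in>abs_Gal k. c (s \<circ> t) = c s \<otimes>\<^bsub>H\<^esub> act s (c t)) \<and>
     (\<forall>s\<in>abs_Gal k. \<exists>S. finite S \<and> (\<forall>t\<in>abs_Gal k. (\<forall>x\<in>S. t x = s x) \<longrightarrow> c t = c s))}"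

definition H1_class ::
    "'a::field set \<Rightarrow> 'h monoid \<Rightarrow> (('a \<Rightarrow> 'a) \<Rightarrow> 'h \<Rightarrow> 'h) \<Rightarrow> (('a \<Rightarrow> 'a) \<Rightarrow> 'h) \<Rightarrow> (('a \<Rightarrow> 'a) \<Rightarrow> 'h) set" where
  "H1_class k H act c = {c' \<in> Z1 k H act.
     \<exists>h\<in>carrier H. \<forall>s\<in>abs_Gal k. c' s = inv\<^bsub>H\<^esub> h \<otimes>\<^bsub>H\<^esub> c s \<otimes>\<^bsub>H\<^esub> act s h}"

definition H1 :: "'a::field set \<Rightarrow> 'h monoid \<Rightarrow> (('a \<Rightarrow> 'a) \<Rightarrow> 'h \<Rightarrow> 'h) \<Rightarrow> (('a \<Rightarrow> 'a) \<Rightarrow> 'h) set set" where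
  "H1 k H act = H1_class k H act ` Z1 k H act"

text \<open>The map on cohomology induced by an equivariant homomorphism \<open>p\<close> into \<open>H\<close>.\<close>

definition H1_map ::
    "'a::field set \<Rightarrow> 'h monoid \<Rightarrow> (('a \<Rightarrow> 'a) \<Rightarrow> 'h \<Rightarrow> 'h) \<Rightarrow> ('g \<Rightarrow> 'h)
     \<Rightarrow> (('a \<Rightarrow> 'a) \<Rightarrow> 'g) set \<Rightarrow> (('a \<Rightarrow> 'a) \<Rightarrow> 'h) set" where
  "H1_map k H act p C = (\<Union>c\<in>C. H1_class k H act (\<lambda>s\<in>abs_Gal k. p (c s)))"

text \<open>\<open>H1 k (sym_group 2) triv_act\<close> classifies etale quadratic \<open>k\<close>-algebras.  The class of
  the split algebra is \<open>quad_class k k\<close>; that of a separable quadratic extension \<open>F/k\<close>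
  is \<open>quad_class k F\<close>.\<close>

definition triv_act :: "('a \<Rightarrow> 'a) \<Rightarrow> 'h \<Rightarrow> 'h" where
  "triv_act s h = h"

definition quad_class :: "'a::field set \<Rightarrow> 'a set \<Rightarrow> (('a \<Rightarrow> 'a) \<Rightarrow> (nat \<Rightarrow> nat)) set" where
  "quad_class k F = H1_class k (sym_group 2) triv_act
     (\<lambda>s\<in>abs_Gal k. if \<forall>x\<in>F. s x = x then id else Transposition.transpose 1 2)"

subsection \<open>The prehomogeneous vector space\<close>

text \<open>The tensor \<open>\<Sum> x\<^sub>i\<^sub>j\<^sub>l e\<^sub>i\<^sub>j\<^sub>l\<close> is \<open>x\<close> with \<open>x $ i $ j $ l = x\<^sub>i\<^sub>j\<^sub>l\<close>.\<close>

type_synonym 'a tensor = "'a^2^2^2"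

definition e_basis :: "2 \<Rightarrow> 2 \<Rightarrow> 2 \<Rightarrow> 'a::field tensor" where
  "e_basis i j l = axis i (axis j (axis l 1))"

definition tscale :: "'a::field \<Rightarrow> 'a tensor \<Rightarrow> 'a tensor" where
  "tscale c x = (\<chi> i j l. c * x $ i $ j $ l)"

definition w_pt :: "'a::field tensor" where
  "w_pt = e_basis 1 1 1 + e_basis 2 2 2"

definition Vsp :: "'a::field set \<Rightarrow> 'a set \<Rightarrow> 'a set \<Rightarrow> ('a \<Rightarrow> 'a) \<Rightarrow> 'a tensor set" where
  "Vsp k k1 k2 \<sigma> = {x. (\<forall>i j l. x $ i $ j $ l \<in> k2) \<and>
     x $ 1 $ 1 $ 1 \<in> k \<and> x $ 2 $ 2 $ 2 \<in> k \<and>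
     x $ 1 $ 2 $ 2 \<in> k1 \<and> x $ 2 $ 1 $ 1 \<in> k1 \<and>
     x $ 2 $ 1 $ 2 = \<sigma> (x $ 1 $ 2 $ 2) \<and> x $ 2 $ 2 $ 1 = \<sigma> (\<sigma> (x $ 1 $ 2 $ 2)) \<and>
     x $ 1 $ 2 $ 1 = \<sigma> (x $ 2 $ 1 $ 1) \<and> x $ 1 $ 1 $ 2 = \<sigma> (\<sigma> (x $ 2 $ 1 $ 1))}"

text \<open>The basic relative invariant of degree 4 (Cayley's hyperdeterminant): the discriminant
  of the binary quadratic form \<open>det (v\<^sub>1 A + v\<^sub>2 B)\<close>, where \<open>A = x $ 1\<close> and \<open>B = x $ 2\<close>.\<close>

definition rel_inv :: "'a::field tensor \<Rightarrow> 'a" where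
  "rel_inv x = (let A = x $ 1; B = x $ 2;
       b = A $ 1 $ 1 * B $ 2 $ 2 + B $ 1 $ 1 * A $ 2 $ 2
           - A $ 1 $ 2 * B $ 2 $ 1 - B $ 1 $ 2 * A $ 2 $ 1
     in b\<^sup>2 - 4 * det A * det B)"

definition Vss :: "'a::field set \<Rightarrow> 'a set \<Rightarrow> 'a set \<Rightarrow> ('a \<Rightarrow> 'a) \<Rightarrow> 'a tensor set" where
  "Vss k k1 k2 \<sigma> = {x \<in> Vsp k k1 k2 \<sigma>. rel_inv x \<noteq> 0}"

text \<open>Points of \<open>G\<close> over \<open>k\<^sup>s\<^sup>e\<^sup>p\<close>: since \<open>k\<^sub>1 \<otimes> k\<^sup>s\<^sup>e\<^sup>p \<cong> (k\<^sup>s\<^sup>e\<^sup>p)\<^sup>3\<close> via the embeddings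
  \<open>1, \<sigma>, \<sigma>\<^sup>2\<close>, these are \<open>(t, (g\<^sub>1, g\<^sub>2, g\<^sub>3))\<close> with \<open>g\<^sub>i\<close> in \<open>GL\<^sub>2(k\<^sup>s\<^sup>e\<^sup>p)\<close>.\<close>

type_synonym 'a Gpt = "'a \<times> (('a^2^2)^3)"

definition emb :: "('a \<Rightarrow> 'a) \<Rightarrow> 3 \<Rightarrow> 'a \<Rightarrow> 'a" where
  "emb \<sigma> i = (if i = 1 then id else if i = 2 then \<sigma> else \<sigma> \<circ> \<sigma>)"

definition Gsep :: "'a::field Gpt monoid" where
  "Gsep = \<lparr>carrier = {(t, g). t \<noteq> 0 \<and> (\<forall>i. det (g $ i) \<noteq> 0)},
     mult = (\<lambda>(t, g) (t', g'). (t * t', \<chi> i. g $ i ** g' $ i)), one = (1, \<chi> i. mat 1)\<rparr>"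

definition Gact :: "'a::field Gpt \<Rightarrow> 'a tensor \<Rightarrow> 'a tensor" where
  "Gact = (\<lambda>(t, g) x. \<chi> i j l. t * (\<Sum>i'\<in>UNIV. \<Sum>j'\<in>UNIV. \<Sum>l'\<in>UNIV.
     g $ 1 $ i $ i' * g $ 2 $ j $ j' * g $ 3 $ l $ l' * x $ i' $ j' $ l'))"

definition Gk :: "'a::field set \<Rightarrow> 'a set \<Rightarrow> ('a \<Rightarrow> 'a) \<Rightarrow> 'a Gpt set" where
  "Gk k k1 \<sigma> = {(t, \<chi> i. map_matrix (emb \<sigma> i) g) | t g.
     t \<in> k - {0} \<and> (\<forall>i j. g $ i $ j \<in> k1) \<and> det g \<noteq> 0}"

definition orbit :: "'a::field set \<Rightarrow> 'a set \<Rightarrow> ('a \<Rightarrow> 'a) \<Rightarrow> 'a tensor \<Rightarrow> 'a tensor set" where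
  "orbit k k1 \<sigma> x = (\<lambda>g. Gact g x) ` Gk k k1 \<sigma>"

definition orbits :: "'a::field set \<Rightarrow> 'a set \<Rightarrow> 'a set \<Rightarrow> ('a \<Rightarrow> 'a) \<Rightarrow> 'a tensor set set" where
  "orbits k k1 k2 \<sigma> = orbit k k1 \<sigma> ` Vss k k1 k2 \<sigma>"

text \<open>The Galois action on \<open>G(k\<^sup>s\<^sup>e\<^sup>p)\<close>, i.e. on the second factor of \<open>k\<^sub>1 \<otimes> k\<^sup>s\<^sup>e\<^sup>p\<close>: the
  component at an embedding \<open>\<iota>\<close> is moved to the one at \<open>s \<circ> \<iota>\<close>.\<close>

definition gal_G :: "'a::field set \<Rightarrow> ('a \<Rightarrow> 'a) \<Rightarrow> ('a \<Rightarrow> 'a) \<Rightarrow> 'a Gpt \<Rightarrow> 'a Gpt" where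
  "gal_G k1 \<sigma> s = (\<lambda>(t, g). (s t,
     \<chi> j. map_matrix s (g $ (THE i. \<forall>x\<in>k1. s (emb \<sigma> i x) = emb \<sigma> j x))))"

definition Gw :: "'a::field Gpt monoid" where
  "Gw = Gsep\<lparr>carrier := {g \<in> carrier Gsep. Gact g w_pt = w_pt}\<rparr>"

text \<open>The identity component of the stabilizer is its diagonal torus; the other component
  consists of antidiagonal matrices and is mapped to the transposition.\<close>

definition Gw0 :: "'a::field Gpt set" where
  "Gw0 = {(t, g) \<in> carrier Gw. \<forall>i. g $ i $ 1 $ 2 = 0 \<and> g $ i $ 2 $ 1 = 0}"

definition Gw_to_S2 :: "'a::field Gpt \<Rightarrow> nat \<Rightarrow> nat" where
  "Gw_to_S2 g = (if g \<in> Gw0 then id else Transposition.transpose 1 2)"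

text \<open>The bijection from \<open>G\<^sub>k\<close>-orbits in \<open>V\<^sub>k\<^sup>s\<^sup>s\<close> to \<open>H\<^sup>1(k, G\<^sub>w)\<close>: if \<open>x = g w\<close> with \<open>g\<close> in
  \<open>G(k\<^sup>s\<^sup>e\<^sup>p)\<close>, the orbit of \<open>x\<close> goes to the class of \<open>s \<mapsto> g\<^sup>-\<^sup>1 s(g)\<close>.  Letting \<open>x\<close> run
  through the orbit and \<open>g\<close> through all choices yields exactly this class.\<close>

definition orbit_H1 :: "'a::field set \<Rightarrow> 'a set \<Rightarrow> ('a \<Rightarrow> 'a) \<Rightarrow> 'a tensor set \<Rightarrow> (('a \<Rightarrow> 'a) \<Rightarrow> 'a Gpt) set" where
  "orbit_H1 k k1 \<sigma> X =
     {(\<lambda>s\<in>abs_Gal k. inv\<^bsub>Gsep\<^esub> g \<otimes>\<^bsub>Gsep\<^esub> gal_G k1 \<sigma> s g) | g. g \<in> carrier Gsep \<and> Gact g w_pt \<in> X}"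

definition alpha_V :: "'a::field set \<Rightarrow> 'a set \<Rightarrow> ('a \<Rightarrow> 'a) \<Rightarrow> 'a tensor set \<Rightarrow> (('a \<Rightarrow> 'a) \<Rightarrow> (nat \<Rightarrow> nat)) set" where
  "alpha_V k k1 \<sigma> X = H1_map k (sym_group 2) triv_act Gw_to_S2 (orbit_H1 k k1 \<sigma> X)"

text \<open>The fibre of \<open>\<alpha>\<^sub>V\<close> over the quadratic splitting field \<open>F\<close>.\<close>

definition alpha_V_fibre ::
    "'a::field set \<Rightarrow> 'a set \<Rightarrow> 'a set \<Rightarrow> ('a \<Rightarrow> 'a) \<Rightarrow> 'a set \<Rightarrow> 'a tensor set set" where
  "alpha_V_fibre k k1 k2 \<sigma> F = {X \<in> orbits k k1 k2 \<sigma>. alpha_V k k1 \<sigma> X = quad_class k F}"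

subsection \<open>The parametrizing sets\<close>

definition norm_group :: "'a::field set \<Rightarrow> 'a set \<Rightarrow> 'a set" where
  "norm_group F L = field_norm F L ` (L - {0})"

text \<open>The quotient \<open>((k\<^sup>\<times>/N) \<times> (k\<^sup>\<times>/N)) / {(t,t)}\<close>, with \<open>N\<close> the norms from \<open>k\<^sub>1\<close>.\<close>

definition norm_pairs :: "'a::field set \<Rightarrow> 'a set \<Rightarrow> ('a set \<times> 'a set) monoid" where
  "norm_pairs k k1 = (mult_units k Mod norm_group k k1) \<times>\<times> (mult_units k Mod norm_group k k1)"

definition diag_pairs :: "'a::field set \<Rightarrow> 'a set \<Rightarrow> ('a set \<times> 'a set) set" where
  "diag_pairs k k1 = (\<lambda>t. (norm_group k k1 #>\<^bsub>mult_units k\<^esub> t, norm_group k k1 #>\<^bsub>mult_units k\<^esub> t)) ` (k - {0})"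

definition split_quot :: "'a::field set \<Rightarrow> 'a set \<Rightarrow> ('a set \<times> 'a set) set monoid" where
  "split_quot k k1 = norm_pairs k k1 Mod diag_pairs k k1"

definition split_coset :: "'a::field set \<Rightarrow> 'a set \<Rightarrow> 'a \<Rightarrow> 'a \<Rightarrow> ('a set \<times> 'a set) set" where
  "split_coset k k1 \<beta>1 \<beta>2 = diag_pairs k k1 #>\<^bsub>norm_pairs k k1\<^esub>
     (norm_group k k1 #>\<^bsub>mult_units k\<^esub> \<beta>1, norm_group k k1 #>\<^bsub>mult_units k\<^esub> \<beta>2)"

text \<open>For \<open>F/k\<close> quadratic and \<open>L/F\<close> cubic: the subgroup \<open>k\<^sup>\<times> N\<^bsub>L/F\<^esub>(L\<^sup>\<times>)\<close> of \<open>F\<^sup>\<times>\<close>.\<close>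

definition base_norm_group :: "'a::field set \<Rightarrow> 'a set \<Rightarrow> 'a set \<Rightarrow> 'a set" where
  "base_norm_group k F L = (k - {0}) <#>\<^bsub>mult_units F\<^esub> norm_group F L"

definition field_quot :: "'a::field set \<Rightarrow> 'a set \<Rightarrow> 'a set \<Rightarrow> 'a set monoid" where
  "field_quot k F L = mult_units F Mod base_norm_group k F L"

definition field_coset :: "'a::field set \<Rightarrow> 'a set \<Rightarrow> 'a set \<Rightarrow> 'a \<Rightarrow> 'a set" where
  "field_coset k F L \<beta> = base_norm_group k F L #>\<^bsub>mult_units F\<^esub> \<beta>"

text \<open>Orbits of \<open>S\<^sub>2\<close> on \<open>X\<close>, where the non-trivial element acts as the involution \<open>\<iota>\<close>.\<close>

definition S2_orbit :: "('b \<Rightarrow> 'b) \<Rightarrow> 'b \<Rightarrow> 'b set" where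
  "S2_orbit \<iota> x = {x, \<iota> x}"

definition S2_orbits :: "('b \<Rightarrow> 'b) \<Rightarrow> 'b set \<Rightarrow> 'b set set" where
  "S2_orbits \<iota> X = S2_orbit \<iota> ` X"

text \<open>\<open>g\<^sub>\<alpha>\<close> has entries in \<open>k(\<alpha>)\<close>, the second factor of \<open>k\<^sub>1 \<otimes> k(\<alpha>)\<close>, so its three components
  in \<open>G(k\<^sup>s\<^sup>e\<^sup>p)\<close> coincide.\<close>

definition g_alpha :: "'a::field \<Rightarrow> 'a \<Rightarrow> 'a Gpt" where
  "g_alpha \<alpha>1 \<alpha>2 = (1, \<chi> i. vector [vector [1, 1], vector [- \<alpha>1, - \<alpha>2]])"

end

theory Submission
  imports Defs
begin

text \<open>
  A point \<open>x = g w\<close> is the sum of the rank one tensors \<open>g e\<^sub>1\<^sub>1\<^sub>1\<close> and \<open>g e\<^sub>2\<^sub>2\<^sub>2\<close>, and the shape of the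
  stabilizer \<open>G\<^sub>w\<close> says that such a decomposition is unique up to order.  Hence the absolute Galois
  group, acting on tensors so that \<open>V\<^sub>k\<close> consists of invariants, permutes the two summands of a point of
  \<open>V\<^sub>k\<close>, and \<open>\<alpha>\<^sub>V\<close> is this permutation character.  If \<open>x\<close> lies over \<open>F\<close>, both summands are
  invariant under the Galois group of \<open>F\<close>; descent then gives them the form
  \<open>\<beta> u \<otimes> u\<^sup>\<sigma> \<otimes> u\<^sup>\<sigma>\<^sup>\<sigma>\<close> with \<open>\<beta> \<in> F\<close> and \<open>u\<close> over \<open>k\<^sub>1F\<close>, which moves \<open>x\<close> to the given
  representative by an element of \<open>G\<^sub>k\<close>.  Rescaling \<open>u\<close> by \<open>y\<close> changes \<open>\<beta>\<close> by the norm of \<open>y\<close>, and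
  the \<open>GL(1)\<close> factor scales both summands by the same element of \<open>k\<close>: this is the equivalence
  relation on \<open>\<beta>\<close>.
\<close>

subsection \<open>Subfields\<close>

text \<open>Rationality is tested by invariance alone, which takes two facts about the ambient
  field: a homomorphism on an intermediate field extends to an automorphism, and every element fixed
  by all automorphisms over an intermediate field lies in it. The three factors of a tensor belong
  to the three embeddings of \<open>k1\<close>, so an automorphism permutes the factors while it
  acts on the coordinates. What stands in the way of treating \<open>k\<close> and
  \<open>k(\<alpha>)\<close> together is that descent over \<open>F\<close> needs an automorphism
  which is \<sigma> on \<open>k1\<close> and trivial on \<open>F\<close>; once such an
  \<open>s0\<close> is given, descent and norm computations are the same for both fields, with the
  compositum \<open>K1\<close> in the role of \<open>k1 \<otimes> F\<close>. The cases part at one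
  point. In the split case the two summands descend independently, which leaves two parameters; in
  the quadratic case an automorphism moving \<open>\<alpha>1\<close> exchanges them, so the second
  summand is the conjugate of the first and one parameter remains.\<close>

lemma subfieldD:
  assumes "is_subfield F"
  shows subfield_0: "0 \<in> F" and subfield_1: "1 \<in> F"
    and subfield_add: "x \<in> F \<Longrightarrow> y \<in> F \<Longrightarrow> x + y \<in> F"
    and subfield_mult: "x \<in> F \<Longrightarrow> y \<in> F \<Longrightarrow> x * y \<in> F"
    and subfield_uminus: "x \<in> F \<Longrightarrow> - x \<in> F"
    and subfield_inverse: "x \<in> F \<Longrightarrow> inverse x \<in> F"
    and subfield_diff: "x \<in> F \<Longrightarrow> y \<in> F \<Longrightarrow> x - y \<in> F"
    and subfield_divide: "x \<in> F \<Longrightarrow> y \<in> F \<Longrightarrow> x / y \<in> F"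
proof -
  show d: "0 \<in> F" "1 \<in> F" "x \<in> F \<Longrightarrow> y \<in> F \<Longrightarrow> x + y \<in> F"
    "x \<in> F \<Longrightarrow> y \<in> F \<Longrightarrow> x * y \<in> F" "x \<in> F \<Longrightarrow> - x \<in> F"
    "x \<in> F \<Longrightarrow> inverse x \<in> F" for x y
    using assms by (auto simp: is_subfield_def)
  show "x - y \<in> F" if "x \<in> F" "y \<in> F"
    using d(3)[OF that(1) d(5)[OF that(2)]] by simp
  show "x / y \<in> F" if "x \<in> F" "y \<in> F"
    using d(4)[OF that(1) d(6)[OF that(2)]] by (simp add: divide_inverse)
qed

lemma subfield_sum:
  assumes "is_subfield F" "\<And>i. i \<in> A \<Longrightarrow> f i \<in> F"
  shows "sum f A \<in> F"
  using assms(2) by (induction A rule: infinite_finite_induct)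
    (auto intro: subfield_0[OF assms(1)] subfield_add[OF assms(1)])

lemma is_subfield_field_gen: "is_subfield (field_gen S)"
  unfolding field_gen_def is_subfield_def by auto

lemma field_gen_superset: "S \<subseteq> field_gen S"
  by (auto simp: field_gen_def)

lemma field_gen_least: "is_subfield F \<Longrightarrow> S \<subseteq> F \<Longrightarrow> field_gen S \<subseteq> F"
  by (auto simp: field_gen_def)

subsection \<open>Polynomials over a subfield\<close>

lemma polys_over_mono: "F \<subseteq> L \<Longrightarrow> p \<in> polys_over F \<Longrightarrow> p \<in> polys_over L"
  by (auto simp: polys_over_def)

lemma polys_over_pCons_iff: "pCons c p \<in> polys_over F \<longleftrightarrow> c \<in> F \<and> p \<in> polys_over F"
  unfolding polys_over_def
  by (auto simp: coeff_pCons split: nat.splits dest: spec[of _ 0] spec[of _ "Suc _"])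

lemma
  assumes "is_subfield F"
  shows polys_over_0: "0 \<in> polys_over F"
    and polys_over_add: "p \<in> polys_over F \<Longrightarrow> q \<in> polys_over F \<Longrightarrow> p + q \<in> polys_over F"
    and polys_over_diff: "p \<in> polys_over F \<Longrightarrow> q \<in> polys_over F \<Longrightarrow> p - q \<in> polys_over F"
    and polys_over_mult: "p \<in> polys_over F \<Longrightarrow> q \<in> polys_over F \<Longrightarrow> p * q \<in> polys_over F"
    and polys_over_monom: "c \<in> F \<Longrightarrow> monom c n \<in> polys_over F"
    and polys_over_smult: "c \<in> F \<Longrightarrow> p \<in> polys_over F \<Longrightarrow> smult c p \<in> polys_over F"
  using subfieldD[OF assms]
  by (auto simp: polys_over_def coeff_mult coeff_pCons split: nat.splits intro!: subfield_sum[OF assms])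

text \<open>Long division divides only by the leading coefficient of \<open>q\<close>, so quotient
  and remainder keep coefficients in \<open>F\<close>. It makes a polynomial of least degree
  vanishing at a point a divisor of all the others.\<close>

lemma polys_over_division:
  assumes F: "is_subfield F" and p: "p \<in> polys_over F" and q: "q \<in> polys_over F" "q \<noteq> 0"
  shows "\<exists>d\<in>polys_over F. \<exists>r\<in>polys_over F. p = q * d + r \<and> (r = 0 \<or> degree r < degree q)"
  using p
proof (induction "degree p" arbitrary: p rule: less_induct)
  case less
  show ?case
  proof (cases "p = 0 \<or> degree p < degree q")
    case True
    then show ?thesis using polys_over_0[OF F] less.prems
      by (intro bexI[of _ 0] bexI[of _ p]) auto
  next
    case False
    define m where "m = monom (lead_coeff p / lead_coeff q) (degree p - degree q)"
    have m: "m \<in> polys_over F"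
      unfolding m_def using less.prems q
      by (intro polys_over_monom[OF F] subfield_divide[OF F]) (auto simp: polys_over_def)
    define p' where "p' = p - q * m"
    have p'F: "p' \<in> polys_over F"
      unfolding p'_def by (intro polys_over_diff[OF F] polys_over_mult[OF F] less.prems q m)
    have m0: "m \<noteq> 0" using False q by (simp add: m_def)
    have degm: "degree m = degree p - degree q"
      using False q by (simp add: m_def degree_monom_eq)
    have degqm: "degree (q * m) = degree p"
      using False m0 q by (simp add: degree_mult_eq degm)
    have "lead_coeff (q * m) = lead_coeff p"
      using q False degm by (simp only: lead_coeff_mult) (simp add: m_def)
    then have c: "poly.coeff p' (degree p) = 0" using degqm by (simp add: p'_def)
    have "degree p' \<le> degree p" unfolding p'_def
      by (rule order.trans[OF degree_diff_le_max]) (simp add: degqm)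
    then have "p' = 0 \<or> degree p' < degree p"
      using c by (metis leading_coeff_0_iff nat_less_le)
    then show ?thesis
    proof
      assume "p' = 0"
      then show ?thesis using m polys_over_0[OF F]
        by (intro bexI[of _ m] bexI[of _ 0]) (auto simp: p'_def)
    next
      assume "degree p' < degree p"
      from less.hyps[OF this p'F] obtain d r where
        d: "d \<in> polys_over F" "r \<in> polys_over F" "p' = q * d + r" "r = 0 \<or> degree r < degree q" by blast
      then show ?thesis using m polys_over_add[OF F]
        by (intro bexI[of _ "m + d"] bexI[of _ r]) (auto simp: p'_def algebra_simps)
    qed
  qed
qed

text \<open>A common divisor of \<open>q\<close> and its derivative divides \<open>p = q * b\<close>
  and, by the product rule, the derivative of \<open>p\<close>. Separability over \<open>k\<close>
  thus passes to minimal polynomials over larger fields.\<close>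

lemma coprime_pderiv_dvd:
  fixes p q :: "'a::field poly"
  assumes "coprime p (pderiv p)" "q dvd p"
  shows "coprime q (pderiv q)"
proof (rule coprimeI)
  fix c assume c: "c dvd q" "c dvd pderiv q"
  obtain b where b: "p = q * b" using assms(2) by blast
  have "c dvd pderiv p" unfolding b pderiv_mult using c by (auto intro: dvd_add dvd_mult dvd_mult2)
  moreover have "c dvd p" using c(1) assms(2) by (rule dvd_trans)
  ultimately show "is_unit c" using assms(1) by (simp add: coprime_def)
qed

lemma not_square_dvd_separable:
  fixes p :: "'a::field poly"
  assumes "coprime p (pderiv p)"
  shows "\<not> [:- x, 1:] * [:- x, 1:] dvd p"
proof
  assume "[:- x, 1:] * [:- x, 1:] dvd p"
  from coprime_pderiv_dvd[OF assms this] have "is_unit [:- x, 1:]"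
    by (rule coprime_common_divisor) (auto simp: pderiv_mult simp del: mult_pCons_left mult_pCons_right intro: dvd_add)
  then show False by (simp add: is_unit_pCons_iff)
qed

subsection \<open>Graphs of partial homomorphisms\<close>

text \<open>Homomorphisms from subfields are handled as subrings of \<open>'a \<times> 'a\<close>, so that Zorn's lemma applies
  to plain inclusion.  Closure under inverses is automatic, everything being algebraic over \<open>k\<close>.\<close>

definition hom_graph :: "'a::field set \<Rightarrow> ('a \<times> 'a) set \<Rightarrow> bool" where
  "hom_graph k R \<longleftrightarrow> (\<forall>a\<in>k. (a, a) \<in> R) \<and>
     (\<forall>x y x' y'. (x, y) \<in> R \<longrightarrow> (x', y') \<in> R \<longrightarrow> (x + x', y + y') \<in> R \<and> (x * x', y * y') \<in> R) \<and>
     (\<forall>y. (0, y) \<in> R \<longrightarrow> y = 0)"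

text \<open>\<open>q\<close> arises from \<open>p\<close> by applying the homomorphism with graph
  \<open>R\<close> to the coefficients.\<close>

definition poly_rel :: "('a::field \<times> 'a) set \<Rightarrow> 'a poly \<Rightarrow> 'a poly \<Rightarrow> bool" where
  "poly_rel R p q \<longleftrightarrow> (\<forall>i. (poly.coeff p i, poly.coeff q i) \<in> R)"

lemma poly_rel_pCons: "poly_rel R (pCons a p) (pCons b q) \<longleftrightarrow> (a, b) \<in> R \<and> poly_rel R p q"
  unfolding poly_rel_def
  by (auto simp: coeff_pCons split: nat.splits dest: spec[of _ 0] spec[of _ "Suc _"])

locale algebraic_ambient =
  fixes k :: "'a::field set"
  assumes k: "is_subfield k" and alg: "\<exists>p. irreducible_over k p \<and> poly p x = 0"
begin

text \<open>Write an irreducible polynomial of \<open>z\<close> as \<open>c + X p'\<close>. If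
  \<open>c\<close> were zero, irreducibility would make \<open>p'\<close> constant and leave 0 as
  the only root; hence \<open>inverse z = - p'(z) / c\<close>.\<close>

lemma inverse_eq_poly:
  fixes z :: 'a
  assumes "z \<noteq> 0"
  obtains q where "q \<in> polys_over k" "inverse z = poly q z"
proof -
  obtain p where p: "irreducible_over k p" "poly p z = 0" using alg by blast
  obtain c p' where p': "p = pCons c p'" by (cases p)
  have mem: "c \<in> k" "p' \<in> polys_over k"
    using p(1) by (auto simp: irreducible_over_def p' polys_over_pCons_iff)
  have "c \<noteq> 0"
  proof
    assume "c = 0"
    then have eq: "p = [:0, 1:] * p'" by (simp add: p')
    have "[:0, 1:] \<in> polys_over k"
      using subfieldD[OF k] by (simp add: polys_over_pCons_iff polys_over_0[OF k])
    then have "degree p' = 0" using p(1) mem eq unfolding irreducible_over_def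
      by (metis degree_pCons_eq degree_pCons_0 one_neq_zero pCons_eq_0_iff zero_neq_one nat.distinct(1))
    then obtain d where "p' = [:d:]" by (metis degree_eq_zeroE)
    then show False using p \<open>c = 0\<close> assms by (auto simp: p' irreducible_over_def)
  qed
  then have "inverse z = poly (smult (- inverse c) p') z"
    using p(2) assms by (simp add: p' field_simps add_eq_0_iff)
  then show thesis using mem subfieldD[OF k]
    by (intro that[of "smult (- inverse c) p'"] polys_over_smult[OF k]) auto
qed

context
  fixes R assumes R: "hom_graph k R"
begin

lemma
  shows hom_graph_base: "a \<in> k \<Longrightarrow> (a, a) \<in> R"
    and hom_graph_add: "(x, y) \<in> R \<Longrightarrow> (x', y') \<in> R \<Longrightarrow> (x + x', y + y') \<in> R"
    and hom_graph_mult: "(x, y) \<in> R \<Longrightarrow> (x', y') \<in> R \<Longrightarrow> (x * x', y * y') \<in> R"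
    and hom_graph_0: "(0, y) \<in> R \<Longrightarrow> y = 0"
  using R by (auto simp: hom_graph_def)

lemma hom_graph_zero: "(0, 0) \<in> R"
  by (rule hom_graph_base[OF subfield_0[OF k]])

lemma hom_graph_diff:
  assumes "(x, y) \<in> R" "(x', y') \<in> R"
  shows "(x - x', y - y') \<in> R"
  using hom_graph_add[OF assms(1) hom_graph_mult[OF hom_graph_base[of "-1"] assms(2)]]
    subfieldD[OF k] by simp

lemma hom_graph_sum:
  assumes "\<And>i. i \<in> A \<Longrightarrow> (f i, g i) \<in> R"
  shows "(sum f A, sum g A) \<in> R"
  using assms by (induction A rule: infinite_finite_induct)
    (auto intro: hom_graph_zero hom_graph_add)

lemma hom_graph_unique: "(x, y) \<in> R \<Longrightarrow> (x, y') \<in> R \<Longrightarrow> y = y'"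
  using hom_graph_diff[of x y x y'] hom_graph_0 by fastforce

lemma hom_graph_poly:
  assumes "(x, y) \<in> R" "poly_rel R p q"
  shows "(poly p x, poly q y) \<in> R"
  using assms(2)
proof (induction p arbitrary: q)
  case 0
  then have "poly.coeff q i = 0" for i using hom_graph_0 by (auto simp: poly_rel_def)
  then have "q = 0" by (simp add: poly_eq_iff)
  then show ?case using hom_graph_zero by simp
next
  case (pCons a p)
  obtain b q' where q: "q = pCons b q'" by (cases q)
  then show ?case using pCons assms(1)
    by (auto simp: poly_rel_pCons intro!: hom_graph_add hom_graph_mult)
qed

lemma poly_rel_refl: "p \<in> polys_over k \<Longrightarrow> poly_rel R p p"
  by (auto simp: polys_over_def poly_rel_def intro: hom_graph_base)

lemma is_subfield_Domain: "is_subfield (Domain R)"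
proof -
  have inv: "inverse x \<in> Domain R" if "(x, y) \<in> R" for x y
  proof (cases "x = 0")
    case True
    then show ?thesis using hom_graph_zero by auto
  next
    case False
    then obtain q where "q \<in> polys_over k" "inverse x = poly q x" by (rule inverse_eq_poly)
    then show ?thesis using hom_graph_poly[OF that poly_rel_refl] by (metis DomainI)
  qed
  have "- x \<in> Domain R" if "(x, y) \<in> R" for x y
    using hom_graph_diff[OF hom_graph_zero that] by auto
  moreover have "1 \<in> Domain R" using hom_graph_base[OF subfield_1[OF k]] by auto
  moreover have "x + x' \<in> Domain R" "x * x' \<in> Domain R" if "x \<in> Domain R" "x' \<in> Domain R" for x x'
    using that hom_graph_add hom_graph_mult by blast+
  ultimately show ?thesis
    using inv hom_graph_zero unfolding is_subfield_def by (meson DomainE DomainI)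
qed

text \<open>For nonzero \<open>x\<close>, a pair \<open>(x, 0)\<close> multiplied by a pair over
  \<open>inverse x\<close> gives \<open>(1, 0)\<close>, while \<open>(1, 1)\<close> is in
  \<open>R\<close> as well.\<close>

lemma hom_graph_eq_0_iff:
  assumes "(x, y) \<in> R" shows "x = 0 \<longleftrightarrow> y = 0"
proof
  assume "y = 0"
  show "x = 0"
  proof (rule ccontr)
    assume x: "x \<noteq> 0"
    obtain z where "(inverse x, z) \<in> R"
      using subfield_inverse[OF is_subfield_Domain] assms by (metis DomainE DomainI)
    from hom_graph_mult[OF assms this] have "(1, 0) \<in> R" using x \<open>y = 0\<close> by simp
    with hom_graph_unique[OF hom_graph_base[OF subfield_1[OF k]]] show False by fastforce
  qed
qed (use assms hom_graph_0 in auto)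

lemma poly_rel_add: "poly_rel R p q \<Longrightarrow> poly_rel R p' q' \<Longrightarrow> poly_rel R (p + p') (q + q')"
  by (auto simp: poly_rel_def intro: hom_graph_add)

lemma poly_rel_mult: "poly_rel R p q \<Longrightarrow> poly_rel R p' q' \<Longrightarrow> poly_rel R (p * p') (q * q')"
  by (auto simp: poly_rel_def coeff_mult intro!: hom_graph_sum hom_graph_mult)

lemma poly_rel_unique: "poly_rel R p q \<Longrightarrow> poly_rel R p q' \<Longrightarrow> q = q'"
  by (auto simp: poly_rel_def poly_eq_iff intro: hom_graph_unique)

lemma poly_rel_ex:
  assumes "p \<in> polys_over (Domain R)" obtains q where "poly_rel R p q"
proof -
  have "\<exists>q. poly_rel R p q" using assms
  proof (induction p)
    case 0 then show ?case by (intro exI[of _ 0]) (auto simp: poly_rel_def hom_graph_zero)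
  next
    case (pCons a p)
    then obtain b q where "(a, b) \<in> R" "poly_rel R p q" by (auto simp: polys_over_pCons_iff)
    then show ?case by (intro exI[of _ "pCons b q"]) (simp add: poly_rel_pCons)
  qed
  then show thesis using that by blast
qed

lemma poly_rel_degree: "poly_rel R p q \<Longrightarrow> degree p = degree q"
proof -
  assume "poly_rel R p q"
  then have "poly.coeff p i = 0 \<longleftrightarrow> poly.coeff q i = 0" for i
    using hom_graph_eq_0_iff by (auto simp: poly_rel_def)
  then show ?thesis by (simp add: degree_def)
qed

text \<open>The candidate extension of \<open>R\<close> to polynomial expressions in
  \<open>x\<close> that sends \<open>x\<close> to \<open>y\<close>. As a relation it exists for
  every \<open>y\<close>; that it is single-valued depends on the choice of
  \<open>y\<close>.\<close>

definition adjoin_graph :: "'a \<Rightarrow> 'a \<Rightarrow> ('a \<times> 'a) set" where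
  "adjoin_graph x y = {(poly p x, poly q y) | p q. poly_rel R p q}"

text \<open>\<open>q\<close> is a minimal polynomial of \<open>x\<close> over
  \<open>Domain R\<close>, described by divisibility and not normalised to be monic.\<close>

definition min_rel :: "'a \<Rightarrow> 'a poly \<Rightarrow> bool" where
  "min_rel x q \<longleftrightarrow> q \<in> polys_over (Domain R) \<and> q \<noteq> 0 \<and> poly q x = 0 \<and>
     (\<forall>r\<in>polys_over (Domain R). poly r x = 0 \<longrightarrow> (\<exists>d\<in>polys_over (Domain R). r = q * d))"

lemma k_subset_Domain: "k \<subseteq> Domain R"
  using hom_graph_base by auto

lemma min_rel_ex: "\<exists>q. min_rel x q"
proof -
  let ?L = "Domain R"
  obtain p where p: "irreducible_over k p" "poly p x = 0" using alg by blast
  let ?P = "\<lambda>q. q \<in> polys_over ?L \<and> q \<noteq> 0 \<and> poly q x = 0"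
  have "?P p" using p polys_over_mono[OF k_subset_Domain] by (auto simp: irreducible_over_def)
  then obtain q where q: "?P q" and least: "\<And>r. ?P r \<Longrightarrow> degree q \<le> degree r"
    using ex_has_least_nat[of ?P p degree] by blast
  have "\<exists>d\<in>polys_over ?L. r = q * d" if r: "r \<in> polys_over ?L" "poly r x = 0" for r
  proof -
    obtain d s where ds: "d \<in> polys_over ?L" "s \<in> polys_over ?L" "r = q * d + s"
      "s = 0 \<or> degree s < degree q"
      using polys_over_division[OF is_subfield_Domain r(1), of q] q by blast
    have "poly s x = 0" using ds(3) r q by simp
    then have "s = 0" using least[of s] ds by force
    then show ?thesis using ds by auto
  qed
  then show ?thesis using q by (auto simp: min_rel_def)
qed

text \<open>If \<open>r\<close> vanishes at \<open>x\<close>, then \<open>q\<close> divides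
  \<open>r\<close> over the domain, so the transported \<open>q'\<close> divides the transported
  \<open>r'\<close>, which then vanishes at \<open>y\<close>. This makes the assignment
  \<open>poly r x \<mapsto> poly r' y\<close> well defined.\<close>

lemma hom_graph_adjoin:
  assumes q: "min_rel x q" and q': "poly_rel R q q'" and y: "poly q' y = 0"
  shows "hom_graph k (adjoin_graph x y)" "R \<subseteq> adjoin_graph x y" "(x, y) \<in> adjoin_graph x y"
proof -
  have const: "poly_rel R [:a:] [:b:]" if "(a, b) \<in> R" for a b
    using that hom_graph_zero by (auto simp: poly_rel_def coeff_pCons split: nat.splits)
  show sub: "R \<subseteq> adjoin_graph x y"
    unfolding adjoin_graph_def using const by force
  have "poly_rel R [:0, 1:] [:0, 1:]"
    using subfieldD[OF k] by (intro poly_rel_refl) (simp add: polys_over_pCons_iff polys_over_0[OF k])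
  then show "(x, y) \<in> adjoin_graph x y"
    unfolding adjoin_graph_def by force
  have zero: "z = 0" if z: "(0, z) \<in> adjoin_graph x y" for z
  proof -
    obtain r r' where r: "poly_rel R r r'" "poly r x = 0" "poly r' y = z"
      using z unfolding adjoin_graph_def mem_Collect_eq prod.inject by metis
    have "r \<in> polys_over (Domain R)" using r(1) by (auto simp: poly_rel_def polys_over_def)
    then obtain d where d: "d \<in> polys_over (Domain R)" "r = q * d"
      using q r(2) by (auto simp: min_rel_def)
    obtain d' where "poly_rel R d d'" using d(1) by (rule poly_rel_ex)
    then have "r' = q' * d'" using poly_rel_unique[OF r(1)] poly_rel_mult[OF q'] d(2) by blast
    then show ?thesis using y r(3) by simp
  qed
  have "(u + u', v + v') \<in> adjoin_graph x y \<and> (u * u', v * v') \<in> adjoin_graph x y"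
    if uv: "(u, v) \<in> adjoin_graph x y" "(u', v') \<in> adjoin_graph x y" for u v u' v'
  proof -
    obtain p q p' q' where pq: "poly_rel R p q" "poly_rel R p' q'"
      "u = poly p x" "v = poly q y" "u' = poly p' x" "v' = poly q' y"
      using uv by (auto simp: adjoin_graph_def)
    show ?thesis
      unfolding adjoin_graph_def pq(3-6) poly_add[symmetric] poly_mult[symmetric]
      using poly_rel_add[OF pq(1,2)] poly_rel_mult[OF pq(1,2)] by blast
  qed
  then show "hom_graph k (adjoin_graph x y)"
    unfolding hom_graph_def using zero sub hom_graph_base by blast
qed

end

end

section \<open>Extension of homomorphisms to automorphisms, and fixed fields\<close>

locale separable_ambient =
  fixes k :: "'a::field set"
  assumes k: "is_subfield k" and closure: "UNIV_separable_closure k"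
begin

lemma separable:
  obtains p where "irreducible_over k p" "poly p x = 0" "coprime p (pderiv p)"
  using closure unfolding UNIV_separable_closure_def separable_ext_def separable_over_def by blast

sublocale algebraic_ambient k
  using k by unfold_locales (auto intro: separable)

text \<open>A polynomial over \<open>k\<close> is its own image under \<open>R\<close>, so the
  factorization \<open>p = q * d\<close> is transported to \<open>p = q' * d'\<close>. Dividing a
  separable polynomial is what will provide \<open>q'\<close> with a root.\<close>

lemma min_rel_dvd:
  assumes R: "hom_graph k R" and q: "min_rel R x q" "poly_rel R q q'"
  obtains p where "coprime p (pderiv p)" "q dvd p" "q' dvd p"
proof -
  obtain p where p: "irreducible_over k p" "poly p x = 0" "coprime p (pderiv p)"
    by (rule separable)
  have pk: "p \<in> polys_over k" using p by (simp add: irreducible_over_def)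
  then obtain d where d: "d \<in> polys_over (Domain R)" "p = q * d"
    using q(1) p(2) polys_over_mono[OF k_subset_Domain[OF R]] unfolding min_rel_def[OF R] by blast
  obtain d' where "poly_rel R d d'" using poly_rel_ex[OF R d(1)] .
  then have "p = q' * d'"
    using poly_rel_unique[OF R poly_rel_refl[OF R pk]] poly_rel_mult[OF R q(2)] d(2) by blast
  then have "q dvd p" "q' dvd p" using d(2) dvd_triv_left by metis+
  then show thesis using that p by blast
qed

lemma hom_graph_extend:
  assumes R: "hom_graph k R"
  obtains R' where "hom_graph k R'" "R \<subseteq> R'" "x \<in> Domain R'"
proof -
  obtain q where q: "min_rel R x q" using min_rel_ex[OF R] by blast
  obtain q' where q': "poly_rel R q q'"
    using q poly_rel_ex[OF R] unfolding min_rel_def[OF R] by blast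
  obtain p where p: "coprime p (pderiv p)" "q dvd p" "q' dvd p"
    using min_rel_dvd[OF R q q'] .
  have "degree q > 0"
    using q unfolding min_rel_def[OF R]
    by (cases q rule: pCons_cases) (auto split: if_splits intro: gr0I)
  then have "degree q' > 0" using poly_rel_degree[OF R q'] by simp
  then obtain y where "poly q' y = 0"
    using closure coprime_pderiv_dvd[OF p(1,3)] unfolding UNIV_separable_closure_def by blast
  from hom_graph_adjoin[OF R q q' this] that show thesis by blast
qed

lemma hom_graph_total:
  assumes R0: "hom_graph k R0"
  obtains R where "hom_graph k R" "R0 \<subseteq> R" "Domain R = UNIV"
proof -
  let ?A = "{R. hom_graph k R \<and> R0 \<subseteq> R}"
  have "\<exists>M\<in>?A. \<forall>X\<in>?A. M \<subseteq> X \<longrightarrow> X = M"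
  proof (rule subset_Zorn_nonempty)
    show "?A \<noteq> {}" using R0 by auto
    fix C assume C: "C \<noteq> {}" "subset.chain ?A C"
    have good: "hom_graph k R" "R0 \<subseteq> R" if "R \<in> C" for R
      using C that by (auto simp: subset_chain_def)
    have "(x + x', y + y') \<in> \<Union>C \<and> (x * x', y * y') \<in> \<Union>C"
      if xy: "(x, y) \<in> \<Union>C" "(x', y') \<in> \<Union>C" for x y x' y'
    proof -
      obtain S S' where S: "(x, y) \<in> S" "S \<in> C" "(x', y') \<in> S'" "S' \<in> C" using xy by blast
      have "S \<subseteq> S' \<or> S' \<subseteq> S" using C S by (auto simp: subset_chain_def)
      then obtain T where T: "T \<in> C" "(x, y) \<in> T" "(x', y') \<in> T" using S by blast
      show ?thesis using hom_graph_add[OF good(1)[OF T(1)] T(2,3)]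
        hom_graph_mult[OF good(1)[OF T(1)] T(2,3)] T(1) by blast
    qed
    moreover have "(a, a) \<in> \<Union>C" if "a \<in> k" for a
      using C(1) hom_graph_base[OF good(1)] that by blast
    moreover have "y = 0" if "(0, y) \<in> \<Union>C" for y
      using that hom_graph_0[OF good(1)] by blast
    ultimately have "hom_graph k (\<Union>C)" unfolding hom_graph_def by blast
    then show "\<Union>C \<in> ?A" using C(1) good(2) by blast
  qed
  then obtain R where R: "hom_graph k R" "R0 \<subseteq> R"
    and max: "\<And>X. hom_graph k X \<Longrightarrow> R \<subseteq> X \<Longrightarrow> X = R" unfolding mem_Collect_eq Bex_def Ball_def
    using R0 by (metis order_trans)
  have "x \<in> Domain R" for x
    using hom_graph_extend[OF R(1), of x] max by metis
  then show thesis using that R by blast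
qed

lemma hom_graph_automorphism:
  assumes R0: "hom_graph k R0"
  shows "\<exists>s\<in>abs_Gal k. \<forall>x y. (x, y) \<in> R0 \<longrightarrow> s x = y"
proof -
  obtain R where R: "hom_graph k R" "R0 \<subseteq> R" "Domain R = UNIV"
    using hom_graph_total[OF R0] .
  define s where "s x = (THE y. (x, y) \<in> R)" for x
  have s: "s x = y" if "(x, y) \<in> R" for x y
    unfolding s_def using that hom_graph_unique[OF R(1)] by blast
  have sR: "(x, s x) \<in> R" for x using R(3) s by (metis DomainE UNIV_I)
  have base: "s a = a" if "a \<in> k" for a using s hom_graph_base[OF R(1) that] .
  have hom: "s (x + y) = s x + s y" "s (x * y) = s x * s y" for x y
    using s hom_graph_add[OF R(1) sR sR] hom_graph_mult[OF R(1) sR sR] by blast+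
  have inj: "inj s"
  proof (rule injI)
    fix x y assume "s x = s y"
    then have "(x - y, 0) \<in> R" using hom_graph_diff[OF R(1) sR sR, of x y] by simp
    then show "x = y" using hom_graph_eq_0_iff[OF R(1)] by fastforce
  qed
  \<comment> \<open>An injective map that preserves the finite root set of a polynomial over
    \<open>k\<close> permutes it, and \<open>y\<close> is such a root.\<close>
  have "y \<in> range s" for y
  proof -
    obtain p where p: "irreducible_over k p" "poly p y = 0" "coprime p (pderiv p)"
      by (rule separable)
    let ?Z = "{z. poly p z = 0}"
    have "p \<noteq> 0" using p by (auto simp: irreducible_over_def)
    then have fin: "finite ?Z" by (rule poly_roots_finite)
    have "poly p (s z) = s (poly p z)" for z
      using s[OF hom_graph_poly[OF R(1) sR poly_rel_refl[OF R(1)]]] p(1)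
      by (simp add: irreducible_over_def)
    then have "s ` ?Z \<subseteq> ?Z" using base[OF subfield_0[OF k]] by auto
    then have "s ` ?Z = ?Z" by (rule endo_inj_surj[OF fin]) (use inj in \<open>auto intro: inj_on_subset\<close>)
    then show ?thesis using p(2) by blast
  qed
  then have "bij s" using inj by (auto simp: bij_def)
  then have "s \<in> abs_Gal k"
    using base hom by (simp add: abs_Gal_def Gal_def field_hom_on_def)
  then show ?thesis using s R(2) by blast
qed

lemma hom_graph_of_field_hom:
  assumes "is_subfield L" "k \<subseteq> L" "field_hom_on k L f"
  shows "hom_graph k {(x, f x) | x. x \<in> L}"
proof -
  have f: "f a = a" if "a \<in> k" for a using assms(3) that by (simp add: field_hom_on_def)
  have hom: "f (x + y) = f x + f y" "f (x * y) = f x * f y" if "x \<in> L" "y \<in> L" for x y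
    using assms(3) that by (simp_all add: field_hom_on_def)
  show ?thesis unfolding hom_graph_def
    using f hom assms(2) subfield_0[OF k] subfield_add[OF assms(1)] subfield_mult[OF assms(1)]
    by auto
qed

lemma field_hom_extends:
  assumes "is_subfield L" "k \<subseteq> L" "field_hom_on k L f"
  obtains s where "s \<in> abs_Gal k" "\<And>x. x \<in> L \<Longrightarrow> s x = f x"
proof -
  obtain s where "s \<in> abs_Gal k" "\<forall>x y. (x, y) \<in> {(x, f x) | x. x \<in> L} \<longrightarrow> s x = y"
    using hom_graph_automorphism[OF hom_graph_of_field_hom[OF assms]] by blast
  then show thesis using that[of s] by simp
qed

text \<open>A point \<open>x\<close> outside \<open>L\<close> has a minimal polynomial over
  \<open>L\<close> of degree at least two; separability gives a second root \<open>y\<close>, and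
  the homomorphism over \<open>L\<close> sending \<open>x\<close> to \<open>y\<close> extends to an
  automorphism that moves \<open>x\<close>.\<close>

lemma fixed_field:
  assumes L: "is_subfield L" "k \<subseteq> L"
    and fixed: "\<And>s. s \<in> abs_Gal k \<Longrightarrow> (\<And>a. a \<in> L \<Longrightarrow> s a = a) \<Longrightarrow> s x = x"
  shows "x \<in> L"
proof (rule ccontr)
  assume x: "x \<notin> L"
  let ?R = "{(x, x) | x. x \<in> L}"
  have R: "hom_graph k ?R"
    using hom_graph_of_field_hom[OF L, of "\<lambda>x. x"] by (simp add: field_hom_on_def)
  have dom: "Domain ?R = L" by auto
  obtain q where q: "min_rel ?R x q" using min_rel_ex[OF R] by blast
  have qL: "q \<in> polys_over L" "q \<noteq> 0" "poly q x = 0"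
    using q dom unfolding min_rel_def[OF R] by auto
  have qq: "poly_rel ?R q q" using qL(1) by (auto simp: poly_rel_def polys_over_def)
  obtain p where p: "coprime p (pderiv p)" "q dvd p"
    using min_rel_dvd[OF R q qq] .
  obtain q1 where q1: "q = [:- x, 1:] * q1" using qL(3) poly_eq_0_iff_dvd by blast
  \<comment> \<open>With \<open>q1\<close> constant, \<open>q\<close> would be linear and
    \<open>x\<close> a quotient of elements of \<open>L\<close>.\<close>
  have "degree q1 > 0"
  proof (rule ccontr)
    assume "\<not> degree q1 > 0"
    then obtain c where "q1 = [:c:]" by (metis degree_eq_zeroE gr0I)
    then have "q = [:- (x * c), c:]" using q1 by simp
    then have c: "- (x * c) \<in> L" "c \<in> L" "c \<noteq> 0"
      using qL by (auto simp: polys_over_pCons_iff)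
    have "x = - (- (x * c)) / c" using c by simp
    then show False using x c subfieldD[OF L(1)] by metis
  qed
  moreover have "q1 dvd p" using q1 p(2) by (metis dvd_trans dvd_triv_right)
  ultimately obtain y where y: "poly q1 y = 0"
    using closure coprime_pderiv_dvd[OF p(1)] unfolding UNIV_separable_closure_def by blast
  have "y \<noteq> x"
  proof
    assume "y = x"
    then have "[:- x, 1:] dvd q1" using y poly_eq_0_iff_dvd by blast
    then have "[:- x, 1:] * [:- x, 1:] dvd q" unfolding q1 by (rule mult_dvd_mono[OF dvd_refl])
    then show False using not_square_dvd_separable[OF p(1)] p(2) dvd_trans by blast
  qed
  have "poly q y = 0" using y q1 by simp
  note adj = hom_graph_adjoin[OF R q qq this]
  obtain s where s: "s \<in> abs_Gal k" "\<forall>u v. (u, v) \<in> adjoin_graph ?R x y \<longrightarrow> s u = v"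
    using hom_graph_automorphism[OF adj(1)] by blast
  have "s a = a" if "a \<in> L" for a using s(2) adj(2) that by blast
  then have "s x = x" using fixed s(1) by blast
  moreover have "s x = y" using s(2) adj(3) by blast
  ultimately show False using \<open>y \<noteq> x\<close> by simp
qed

end

subsection \<open>Rank one tensors\<close>

text \<open>The pure tensor on \<open>V 1\<close>, \<open>V 2\<close>, \<open>V 3\<close>. Its
  coefficient is kept apart because it becomes the parameter \<beta>, while the factors matter only
  up to scalars.\<close>

definition pt :: "'a::field \<Rightarrow> (3 \<Rightarrow> 'a^2) \<Rightarrow> 'a tensor" where
  "pt t V = (\<chi> i j l. t * (V 1 $ i * V 2 $ j * V 3 $ l))"

text \<open>With an index bundled into a function on the three factors, permuting the factors is
  composition, and products over the factors can be reindexed.\<close>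

definition tensor_at :: "'a tensor \<Rightarrow> (3 \<Rightarrow> 2) \<Rightarrow> 'a" where
  "tensor_at x I = x $ I 1 $ I 2 $ I 3"

definition idx :: "2 \<Rightarrow> 2 \<Rightarrow> 2 \<Rightarrow> 3 \<Rightarrow> 2" where
  "idx i j l m = (if m = 1 then i else if m = 2 then j else l)"

lemma idx_simps [simp]: "idx i j l 1 = i" "idx i j l 2 = j" "idx i j l 3 = l"
  by (simp_all add: idx_def)

lemma nth_tensor: "x $ i $ j $ l = tensor_at x (idx i j l)"
  by (simp add: tensor_at_def)

lemma tensor_eqI: "(\<And>I. tensor_at x I = tensor_at y I) \<Longrightarrow> x = y"
  by (simp add: vec_eq_iff nth_tensor)

lemma tensor_at_pt: "tensor_at (pt t V) I = t * (\<Prod>m\<in>UNIV. V m $ I m)"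
  unfolding UNIV_3 by (simp add: tensor_at_def pt_def mult.assoc)

lemma tensor_at_add: "tensor_at (x + y) I = tensor_at x I + tensor_at y I"
  by (simp add: tensor_at_def)

lemma pt_cong: "t = t' \<Longrightarrow> (\<And>i. V i = V' i) \<Longrightarrow> pt t V = pt t' V'"
  by (simp add: pt_def)

lemma tscale_pt: "tscale c (pt t V) = pt (c * t) V"
  by (simp add: pt_def tscale_def vec_eq_iff)

lemma pt_smult: "pt t (\<lambda>i. c i *s V i) = pt (t * (c 1 * c 2 * c 3)) V"
  by (simp add: pt_def vec_eq_iff algebra_simps)

lemma e_basis_pt: "e_basis i i i = pt 1 (\<lambda>_. axis i 1)"
  by (simp add: e_basis_def pt_def vec_eq_iff axis_def)

lemma nonzero_vec: "(v::'a::field^2) \<noteq> 0 \<Longrightarrow> \<exists>i. v $ i \<noteq> 0"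
  by (auto simp: vec_eq_iff)

lemma pt_eq_iff_coeff:
  assumes "\<And>i. V i \<noteq> 0"
  shows "pt t V = pt t' V \<longleftrightarrow> t = t'"
proof
  assume eq: "pt t V = pt t' V"
  obtain J where J: "\<And>i. V i $ J i \<noteq> 0" using nonzero_vec[OF assms] by metis
  have "t * (\<Prod>m\<in>UNIV. V m $ J m) = t' * (\<Prod>m\<in>UNIV. V m $ J m)"
    using arg_cong[OF eq, of "\<lambda>x. tensor_at x J"] by (simp only: tensor_at_pt)
  then show "t = t'" using J by simp
qed simp

text \<open>Keep the indices of the other factors at nonvanishing coordinates of \<open>V\<close>
  and let the index of factor \<open>i\<close> run: this compares \<open>V i\<close> with
  \<open>V' i\<close> coordinate by coordinate.\<close>

lemma pt_eq_parallel:
  assumes eq: "pt t V = pt t' V'" and "t \<noteq> 0" and V: "\<And>i. V i \<noteq> 0"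
  shows "\<exists>c. c \<noteq> 0 \<and> V' i = c *s V i"
proof -
  obtain J where J: "\<And>i. V i $ J i \<noteq> 0" using nonzero_vec[OF V] by metis
  define C C' where "C = t * (\<Prod>m\<in>UNIV - {i}. V m $ J m)"
    and "C' = t' * (\<Prod>m\<in>UNIV - {i}. V' m $ J m)"
  have *: "V i $ a * C = V' i $ a * C'" for a
  proof -
    have "t * (\<Prod>m\<in>UNIV. V m $ (J(i := a)) m) = t' * (\<Prod>m\<in>UNIV. V' m $ (J(i := a)) m)"
      using arg_cong[OF eq, of "\<lambda>x. tensor_at x (J(i := a))"] by (simp only: tensor_at_pt)
    moreover have "(\<Prod>m\<in>UNIV. W m $ (J(i := a)) m) = W i $ a * (\<Prod>m\<in>UNIV - {i}. W m $ J m)" for W :: "3 \<Rightarrow> 'a^2"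
      by (subst prod.remove[of _ i]) (auto intro!: prod.cong)
    ultimately show ?thesis by (simp add: C_def C'_def mult.left_commute)
  qed
  have C: "C \<noteq> 0" using J \<open>t \<noteq> 0\<close> by (simp add: C_def)
  have C': "C' \<noteq> 0" using *[of "J i"] J[of i] C by auto
  have "V' i = (C / C') *s V i"
    using * C' by (auto simp: vec_eq_iff field_simps)
  then show ?thesis using C C' by (metis divide_eq_0_iff)
qed

text \<open>Sums of pure tensors exhaust the space, so identities between additive maps such as
  \<open>Gact h\<close> and \<open>tw s\<close> need checking on \<open>pt\<close> only.\<close>

lemma tensor_induct:
  assumes "\<And>c V. P (pt c V)" "\<And>x y. P x \<Longrightarrow> P y \<Longrightarrow> P (x + y)"
  shows "P x"
proof -
  let ?e = "\<lambda>i j l. pt (x $ i $ j $ l) (\<lambda>m. axis (idx i j l m) 1)"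
  have "x = (?e 1 1 1 + ?e 1 1 2) + (?e 1 2 1 + ?e 1 2 2) + ((?e 2 1 1 + ?e 2 1 2) + (?e 2 2 1 + ?e 2 2 2))"
    by (simp add: vec_eq_iff forall_2 pt_def axis_def)
  then show ?thesis using assms by metis
qed

subsection \<open>The group and its action\<close>

lemma Gact_pt: "Gact (t, g) (pt c V) = pt (t * c) (\<lambda>i. g $ i *v V i)"
  by (simp add: Gact_def pt_def vec_eq_iff matrix_vector_mult_def sum_2 algebra_simps)

lemma Gact_add: "Gact h (x + y) = Gact h x + Gact h y"
  by (simp add: Gact_def vec_eq_iff sum.distrib algebra_simps split: prod.splits)

lemma Gsep_carrier: "(t, g) \<in> carrier Gsep \<longleftrightarrow> t \<noteq> 0 \<and> (\<forall>i. det (g $ i) \<noteq> 0)"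
  by (simp add: Gsep_def)

lemma Gsep_mult: "(t, g) \<otimes>\<^bsub>Gsep\<^esub> (t', g') = (t * t', \<chi> i. g $ i ** g' $ i)"
  by (simp add: Gsep_def)

lemma Gsep_one: "\<one>\<^bsub>Gsep\<^esub> = (1, \<chi> i. mat 1)"
  by (simp add: Gsep_def)

lemma group_Gsep: "group Gsep"
proof (rule groupI)
  show "\<one>\<^bsub>Gsep\<^esub> \<in> carrier Gsep" by (simp add: Gsep_def)
  fix x y z :: "'a Gpt" assume x: "x \<in> carrier Gsep" and y: "y \<in> carrier Gsep"
  show "x \<otimes>\<^bsub>Gsep\<^esub> y \<in> carrier Gsep"
    using x y by (cases x; cases y) (simp add: Gsep_mult Gsep_carrier det_mul)
  show "x \<otimes>\<^bsub>Gsep\<^esub> y \<otimes>\<^bsub>Gsep\<^esub> z = x \<otimes>\<^bsub>Gsep\<^esub> (y \<otimes>\<^bsub>Gsep\<^esub> z)"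
    by (cases x; cases y; cases z) (simp add: Gsep_mult matrix_mul_assoc mult.assoc)
  show "\<one>\<^bsub>Gsep\<^esub> \<otimes>\<^bsub>Gsep\<^esub> x = x"
    by (cases x) (simp add: Gsep_mult Gsep_one vec_lambda_eta)
  obtain t g where tg: "x = (t, g)" by (cases x)
  have "\<forall>i. \<exists>h. h ** g $ i = mat 1"
    using x tg by (metis Gsep_carrier invertible_det_nz invertible_def)
  then obtain h where h: "\<And>i. h i ** g $ i = mat 1" by metis
  have "det (h i) \<noteq> 0" for i using h[of i] by (metis det_I det_mul mult_zero_left zero_neq_one)
  then show "\<exists>y\<in>carrier Gsep. y \<otimes>\<^bsub>Gsep\<^esub> x = \<one>\<^bsub>Gsep\<^esub>"
    using x h by (intro bexI[of _ "(inverse t, \<chi> i. h i)"]) (auto simp: tg Gsep_mult Gsep_one Gsep_carrier)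
qed

interpretation Gsep: group Gsep by (rule group_Gsep)

lemma Gact_mult: "Gact (g \<otimes>\<^bsub>Gsep\<^esub> h) x = Gact g (Gact h x)"
proof (induction x rule: tensor_induct)
  case (1 c V)
  then show ?case
    by (cases g; cases h) (simp add: Gact_pt Gsep_mult mult.assoc matrix_vector_mul_assoc)
qed (simp add: Gact_add)

lemma Gact_one: "Gact \<one>\<^bsub>Gsep\<^esub> x = x"
  by (induction x rule: tensor_induct) (simp_all add: Gact_add Gact_pt Gsep_one)

lemma Gact_inv_eq_iff:
  assumes "g \<in> carrier Gsep"
  shows "Gact (inv\<^bsub>Gsep\<^esub> g) x = y \<longleftrightarrow> x = Gact g y"
  using assms by (metis Gact_mult Gact_one Gsep.l_inv Gsep.r_inv)

definition cols :: "'a^2 \<Rightarrow> 'a^2 \<Rightarrow> 'a^2^2" where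
  "cols v w = (\<chi> i j. if j = 1 then v $ i else w $ i)"

lemma cols_mult_axis: "cols v w *v axis 1 1 = v" "cols v w *v axis 2 1 = (w :: 'a::field^2)"
  by (simp_all add: cols_def matrix_vector_mult_def vec_eq_iff sum_2 axis_def)

lemma cols_column: "(g :: 'a::field^2^2) = cols (column 1 g) (column 2 g)"
  by (simp add: cols_def vec_eq_iff column_def forall_2)

lemma matrix_mult_cols: "(g :: 'a::field^2^2) ** cols v w = cols (g *v v) (g *v w)"
  by (simp add: cols_def matrix_matrix_mult_def matrix_vector_mult_def vec_eq_iff forall_2)

lemma det_cols: "det (cols v w) = v $ 1 * w $ 2 - w $ 1 * v $ 2"
  by (simp add: det_2 cols_def)

lemma det_cols_nonzero:
  assumes "det (cols v w) \<noteq> (0::'a::field)"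
  shows "v \<noteq> 0" "w \<noteq> 0"
  using assms by (auto simp: det_cols)

lemma mult_axis: "(g :: 'a::field^2^2) *v axis i 1 = column i g"
  using exhaust_2[of i] by (auto simp: matrix_vector_mult_def vec_eq_iff sum_2 axis_def column_def)

lemma Gact_e_basis:
  "Gact (t, g) (e_basis i i i) = pt t (\<lambda>m. column i (g $ m))"
  by (simp add: e_basis_pt Gact_pt mult_axis)

lemma Gact_w_pt: "Gact h w_pt = Gact h (e_basis 1 1 1) + Gact h (e_basis 2 2 2)"
  by (simp add: w_pt_def Gact_add)

lemma e_basis_neq: "e_basis 1 1 1 \<noteq> (e_basis 2 2 2 :: 'a::field tensor)"
  by (simp add: e_basis_def vec_eq_iff forall_2 axis_def)

text \<open>The contraction of \<open>e\<^sub>1\<^sub>1\<^sub>1 + e\<^sub>2\<^sub>2\<^sub>2\<close> against either coordinate of any factor is a singular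
  matrix, which forces one entry in every row of the three matrices to vanish.\<close>

lemma Gw_cases:
  assumes z: "z \<in> carrier (Gw :: 'a::field Gpt monoid)"
  shows "z \<in> Gw0 \<and> Gact z (e_basis 1 1 1) = e_basis 1 1 1 \<and> Gact z (e_basis 2 2 2) = e_basis 2 2 2 \<or>
         z \<notin> Gw0 \<and> Gact z (e_basis 1 1 1) = e_basis 2 2 2 \<and> Gact z (e_basis 2 2 2) = e_basis 1 1 1"
proof -
  obtain t g where tg: "z = (t, g)" by (cases z)
  have t: "t \<noteq> 0" and d: "\<And>i. det (g $ i) \<noteq> 0" and w: "Gact z w_pt = w_pt"
    using z by (auto simp: Gw_def tg Gsep_carrier)
  have E: "t * (g $ 1 $ i $ 1 * g $ 2 $ j $ 1 * g $ 3 $ l $ 1) + t * (g $ 1 $ i $ 2 * g $ 2 $ j $ 2 * g $ 3 $ l $ 2)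
      = (if i = j \<and> j = l then 1 else 0)" for i j l
  proof -
    have "Gact z w_pt $ i $ j $ l = t * (g $ 1 $ i $ 1 * g $ 2 $ j $ 1 * g $ 3 $ l $ 1) + t * (g $ 1 $ i $ 2 * g $ 2 $ j $ 2 * g $ 3 $ l $ 2)"
      by (simp add: Gact_w_pt tg Gact_e_basis pt_def column_def)
    moreover have "w_pt $ i $ j $ l = (if i = j \<and> j = l then 1 else 0 :: 'a)"
      using exhaust_2[of i] exhaust_2[of j] exhaust_2[of l]
      by (auto simp: w_pt_def e_basis_def axis_def)
    ultimately show ?thesis using w by simp
  qed
  have row: "g $ m $ i $ 1 * g $ m $ i $ 2 = 0" for m i
  proof -
    have "t\<^sup>2 * (g $ m $ i $ 1 * g $ m $ i $ 2) * (det (g $ m') * det (g $ m'')) = 0"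
      if "(m, m', m'') \<in> {(1, 2, 3), (2, 1, 3), (3, 1, 2)}" for m' m''
    proof -
      let ?x = "\<lambda>j l. t * (g $ m $ i $ 1 * g $ m' $ j $ 1 * g $ m'' $ l $ 1) + t * (g $ m $ i $ 2 * g $ m' $ j $ 2 * g $ m'' $ l $ 2)"
      have x: "?x j l = (if i = j \<and> j = l then 1 else 0)" for j l
        using that E[of i j l] E[of j i l] E[of j l i] by (auto simp: mult_ac)
      have "t\<^sup>2 * (g $ m $ i $ 1 * g $ m $ i $ 2) * (det (g $ m') * det (g $ m'')) = ?x 1 1 * ?x 2 2 - ?x 1 2 * ?x 2 1"
        by (simp add: det_2 power2_eq_square algebra_simps)
      also have "\<dots> = 0" unfolding x by auto
      finally show ?thesis .
    qed
    then have "\<exists>m' m''. t\<^sup>2 * (g $ m $ i $ 1 * g $ m $ i $ 2) * (det (g $ m') * det (g $ m'')) = 0"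
      using exhaust_3[of m] by blast
    then show ?thesis using t d by auto
  qed
  have diag: "g $ m $ 1 $ 2 = 0 \<and> g $ m $ 2 $ 1 = 0 \<or> g $ m $ 1 $ 1 = 0 \<and> g $ m $ 2 $ 2 = 0" for m
    using row[of m 1] row[of m 2] d[of m] by (auto simp: det_2)
  show ?thesis
  \<comment> \<open>Each matrix is diagonal or antidiagonal by \<open>diag\<close>. The coordinate
    \<open>111\<close> of the invariance equation equals 1, which forces all three to be of the same
    kind; one entry of the first matrix decides which.\<close>
  proof (cases "g $ 1 $ 1 $ 2 = 0")
    case True
    then have "t * (g $ 1 $ 1 $ 1 * g $ 2 $ 1 $ 1 * g $ 3 $ 1 $ 1) = 1" using E[of 1 1 1] by simp
    then have "g $ m $ 1 $ 1 \<noteq> 0" for m using exhaust_3[of m] by auto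
    then have D: "g $ m $ 1 $ 2 = 0 \<and> g $ m $ 2 $ 1 = 0" for m using diag by blast
    then have "z \<in> Gw0" using z by (auto simp: Gw0_def tg)
    moreover have "Gact z (e_basis 1 1 1) = e_basis 1 1 1" "Gact z (e_basis 2 2 2) = e_basis 2 2 2"
      using D E[of 1 1 1] E[of 2 2 2]
      unfolding tg Gact_e_basis
      by (simp_all add: vec_eq_iff forall_2 pt_def column_def e_basis_def axis_def)
    ultimately show ?thesis by blast
  next
    case False
    then have "g $ 1 $ 1 $ 1 = 0" using row[of 1 1] by simp
    then have "t * (g $ 1 $ 1 $ 2 * g $ 2 $ 1 $ 2 * g $ 3 $ 1 $ 2) = 1" using E[of 1 1 1] by simp
    then have "g $ m $ 1 $ 2 \<noteq> 0" for m using exhaust_3[of m] by auto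
    then have D: "g $ m $ 1 $ 1 = 0 \<and> g $ m $ 2 $ 2 = 0" for m using diag by blast
    have "z \<notin> Gw0" using False by (auto simp: Gw0_def tg)
    moreover have "Gact z (e_basis 1 1 1) = e_basis 2 2 2" "Gact z (e_basis 2 2 2) = e_basis 1 1 1"
      using D E[of 1 1 1] E[of 2 2 2]
      unfolding tg Gact_e_basis
      by (simp_all add: vec_eq_iff forall_2 pt_def column_def e_basis_def axis_def)
    ultimately show ?thesis by blast
  qed
qed

lemma Gw_quotient:
  assumes "g \<in> carrier Gsep" "h \<in> carrier Gsep" "Gact g w_pt = Gact h w_pt"
  shows "inv\<^bsub>Gsep\<^esub> g \<otimes>\<^bsub>Gsep\<^esub> h \<in> carrier Gw"
  using assms Gact_inv_eq_iff[OF assms(1)] by (simp add: Gw_def Gact_mult)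

text \<open>The quotient of \<open>g\<close> and \<open>h\<close> stabilizes \<open>w\<close>, so it
  fixes or exchanges \<open>e_111\<close> and \<open>e_222\<close>.\<close>

lemma Gact_w_unique:
  assumes gh: "g \<in> carrier Gsep" "h \<in> carrier Gsep" "Gact g w_pt = Gact h w_pt"
  shows "Gact h (e_basis 1 1 1) = Gact g (e_basis 1 1 1) \<and> Gact h (e_basis 2 2 2) = Gact g (e_basis 2 2 2) \<or>
         Gact h (e_basis 1 1 1) = Gact g (e_basis 2 2 2) \<and> Gact h (e_basis 2 2 2) = Gact g (e_basis 1 1 1)"
  using Gw_cases[OF Gw_quotient[OF gh]] Gact_inv_eq_iff[OF gh(1)] unfolding Gact_mult by blast

text \<open>A group element that takes \<open>e_111\<close> and \<open>e_222\<close> to two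
  prescribed pure tensors. The scalar of the group acts on both summands alike, so the separate
  coefficients \<open>a\<close> and \<open>b\<close> go into the columns of the first
  matrix.\<close>

definition pair_elt :: "'a::field \<Rightarrow> 'a \<Rightarrow> (3 \<Rightarrow> 'a^2) \<Rightarrow> (3 \<Rightarrow> 'a^2) \<Rightarrow> 'a Gpt" where
  "pair_elt a b V W = (1, \<chi> i. if i = 1 then cols (a *s V 1) (b *s W 1) else cols (V i) (W i))"

lemma pair_elt:
  assumes "a \<noteq> 0" "b \<noteq> 0" "\<And>i. det (cols (V i) (W i)) \<noteq> 0"
  shows "pair_elt a b V W \<in> carrier Gsep"
    "Gact (pair_elt a b V W) (e_basis 1 1 1) = pt a V" "Gact (pair_elt a b V W) (e_basis 2 2 2) = pt b W"
    "Gact (pair_elt a b V W) w_pt = pt a V + pt b W"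
proof -
  have "det (cols (a *s V 1) (b *s W 1)) = a * b * det (cols (V 1) (W 1))"
    by (simp add: det_cols algebra_simps)
  then show "pair_elt a b V W \<in> carrier Gsep"
    using assms by (simp add: pair_elt_def Gsep_carrier)
  show *: "Gact (pair_elt a b V W) (e_basis 1 1 1) = pt a V" "Gact (pair_elt a b V W) (e_basis 2 2 2) = pt b W"
    by (simp_all add: pair_elt_def Gact_e_basis vec_eq_iff pt_def cols_def column_def)
  show "Gact (pair_elt a b V W) w_pt = pt a V + pt b W"
    by (simp add: Gact_w_pt *)
qed

lemma pt_sum_unique:
  assumes "a \<noteq> 0" "b \<noteq> 0" "\<And>i. det (cols (V i) (W i)) \<noteq> 0"
    and "a' \<noteq> 0" "b' \<noteq> 0" "\<And>i. det (cols (V' i) (W' i)) \<noteq> 0"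
    and eq: "pt a V + pt b W = pt a' V' + pt b' W'"
  shows "pt a' V' = pt a V \<and> pt b' W' = pt b W \<or> pt a' V' = pt b W \<and> pt b' W' = pt a V"
  using Gact_w_unique[OF pair_elt(1)[OF assms(1-3)] pair_elt(1)[OF assms(4-6)]] eq
  by (simp add: pair_elt assms(1-6))

subsection \<open>Absolute Galois group\<close>

definition vmap :: "('a \<Rightarrow> 'a) \<Rightarrow> 'a^2 \<Rightarrow> 'a^2" where
  "vmap f v = (\<chi> i. f (v $ i))"

lemma vmap_nth [simp]: "vmap f v $ i = f (v $ i)"
  by (simp add: vmap_def)

context separable_ambient
begin

context
  fixes s assumes s: "s \<in> abs_Gal k"
begin

lemma gal_base: "a \<in> k \<Longrightarrow> s a = a"
  and gal_add: "s (x + y) = s x + s y"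
  and gal_mult: "s (x * y) = s x * s y"
  and gal_inj_iff: "s x = s y \<longleftrightarrow> x = y"
proof -
  have *: "bij s" "field_hom_on k UNIV s" using s by (simp_all add: abs_Gal_def Gal_def)
  show "a \<in> k \<Longrightarrow> s a = a" "s (x + y) = s x + s y" "s (x * y) = s x * s y"
    using *(2) unfolding field_hom_on_def by blast+
  show "s x = s y \<longleftrightarrow> x = y" using *(1) by (simp add: bij_def inj_eq)
qed

lemma gal_0 [simp]: "s 0 = 0" and gal_1 [simp]: "s 1 = 1"
  using gal_base subfieldD[OF k] by blast+

lemma gal_eq_0_iff: "s x = 0 \<longleftrightarrow> x = 0"
  using gal_inj_iff[of x 0] by simp

lemma gal_uminus: "s (- x) = - s x"
  using gal_add[of x "- x"] by (simp add: eq_neg_iff_add_eq_0 add.commute)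

lemma gal_diff: "s (x - y) = s x - s y"
  using gal_add[of x "- y"] by (simp add: gal_uminus)

lemma gal_inverse: "s (inverse x) = inverse (s x)"
  using gal_mult[of x "inverse x"] by (cases "x = 0") (auto simp: inverse_unique)

lemma gal_divide: "s (x / y) = s x / s y"
  by (simp add: divide_inverse gal_mult gal_inverse)

lemma gal_prod: "s (prod f A) = (\<Prod>i\<in>A. s (f i))"
  by (induction A rule: infinite_finite_induct) (simp_all add: gal_mult)

lemma gal_poly: "p \<in> polys_over k \<Longrightarrow> s (poly p x) = poly p (s x)"
  by (induction p) (simp_all add: polys_over_pCons_iff gal_add gal_mult gal_base)

lemma vmap_smult: "vmap s (c *s v) = s c *s vmap s v"
  by (simp add: vec_eq_iff gal_mult)

lemma vmap_eq_0_iff: "vmap s v = 0 \<longleftrightarrow> v = 0"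
  by (simp add: vec_eq_iff gal_eq_0_iff)

lemma vmap_mult: "vmap s (A *v v) = map_matrix s A *v vmap s v"
  by (simp add: vec_eq_iff matrix_vector_mult_def sum_2 gal_add gal_mult)

lemma gal_det: "det (map_matrix s A) = s (det (A :: 'a^2^2))"
  by (simp add: det_2 gal_diff gal_mult)

end

lemma gal_comp: "s \<in> abs_Gal k \<Longrightarrow> t \<in> abs_Gal k \<Longrightarrow> s \<circ> t \<in> abs_Gal k"
  unfolding abs_Gal_def Gal_def by (simp add: field_hom_on_def bij_comp)

lemma gal_id: "id \<in> abs_Gal k"
  by (simp add: abs_Gal_def Gal_def field_hom_on_def)

lemma emb_gal: "s \<in> abs_Gal k \<Longrightarrow> emb s i \<in> abs_Gal k"
  by (simp add: emb_def gal_id gal_comp)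

lemma is_subfield_agree:
  assumes "s \<in> abs_Gal k" "t \<in> abs_Gal k"
  shows "is_subfield {x. s x = t x}"
  using assms by (auto simp: is_subfield_def gal_add gal_mult gal_uminus gal_inverse)

lemma agree_field_gen:
  assumes "s \<in> abs_Gal k" "t \<in> abs_Gal k" "\<And>x. x \<in> S \<Longrightarrow> s x = t x" "x \<in> field_gen S"
  shows "s x = t x"
  using field_gen_least[OF is_subfield_agree[OF assms(1,2)], of S] assms(3,4) by auto

end

lemma field_hom_on_restrict:
  assumes "is_subfield L" "F \<subseteq> L"
  shows "field_hom_on F L (restrict f L) \<longleftrightarrow> field_hom_on F L f"
proof -
  have "restrict f L x = f x" if "x \<in> F" for x using assms(2) that by auto
  moreover have "restrict f L (x + y) = f (x + y)" "restrict f L (x * y) = f (x * y)"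
    "restrict f L x = f x" if "x \<in> L" "y \<in> L" for x y
    using that subfieldD[OF assms(1)] by auto
  ultimately show ?thesis unfolding field_hom_on_def by simp
qed

lemma emb_simps [simp]: "emb f 1 = id" "emb f 2 = f" "emb f 3 = f \<circ> f"
  by (simp_all add: emb_def)

subsection \<open>The twisted Galois action on tensors\<close>

locale cubic_setting = separable_ambient k for k :: "'a::field set" +
  fixes k1 k2 :: "'a set" and \<sigma> :: "'a \<Rightarrow> 'a"
  assumes k1: "is_subfield k1" and k_k1: "k \<subseteq> k1"
    and k2: "is_normal_closure k k1 k2"
    and \<sigma>: "\<sigma> \<in> Gal k k2"
    and embs: "embeddings k k1 k2 = {restrict id k1, restrict \<sigma> k1, restrict (\<sigma> \<circ> \<sigma>) k1}"
    and embs_distinct: "card (embeddings k k1 k2) = 3"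
    and three_cycle: "\<forall>x\<in>k1. \<sigma> (\<sigma> (\<sigma> x)) = x"
begin

lemma k1_k2: "k1 \<subseteq> k2" and k2_subfield: "is_subfield k2"
  using k2 by (auto simp: is_normal_closure_def normal_ext_def)

lemma restrict_emb: "restrict (emb \<sigma> i) k1 \<in> embeddings k k1 k2"
  unfolding embs using exhaust_3[of i] by auto

lemma emb_hom: "field_hom_on k k1 (emb \<sigma> i)"
  using restrict_emb[of i] by (simp add: embeddings_def field_hom_on_restrict[OF k1 k_k1])

lemma emb_base: "a \<in> k \<Longrightarrow> emb \<sigma> i a = a"
  using emb_hom by (simp add: field_hom_on_def)

text \<open>The hypothesis lists only the embeddings into \<open>k2\<close>. An extension of
  \<open>f\<close> to an automorphism maps \<open>x\<close> to a root of its irreducible polynomial,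
  and by normality all these roots lie in \<open>k2\<close>.\<close>

lemma embedding_cases:
  assumes f: "field_hom_on k k1 f"
  shows "\<exists>i. \<forall>x\<in>k1. f x = emb \<sigma> i x"
proof -
  obtain s where s: "s \<in> abs_Gal k" "\<And>x. x \<in> k1 \<Longrightarrow> s x = f x"
    using field_hom_extends[OF k1 k_k1 f] by blast
  have "f x \<in> k2" if x: "x \<in> k1" for x
  proof -
    obtain p where p: "irreducible_over k p" "poly p x = 0" by (rule separable)
    have pk: "p \<in> polys_over k" "p \<noteq> 0" using p(1) by (auto simp: irreducible_over_def)
    obtain c rs where rs: "set rs \<subseteq> k2" "p = smult c (\<Prod>r\<leftarrow>rs. [:- r, 1:])"
      using k2 p k1_k2 x unfolding is_normal_closure_def normal_ext_def by blast
    have "poly p (s x) = 0" using gal_poly[OF s(1) pk(1), of x] p(2) s(1) by simp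
    moreover have "poly (\<Prod>r\<leftarrow>rs. [:- r, 1:]) y = 0 \<longleftrightarrow> y \<in> set rs" for y
      by (induction rs) auto
    ultimately have "s x \<in> set rs" using rs(2) pk(2) by auto
    then show ?thesis using rs(1) s(2)[OF x] by auto
  qed
  then have "restrict f k1 \<in> embeddings k k1 k2"
    using f by (auto simp: embeddings_def field_hom_on_restrict[OF k1 k_k1])
  then have "\<exists>i. restrict f k1 = restrict (emb \<sigma> i) k1"
    unfolding embs by (metis emb_simps insertE singletonD)
  then show ?thesis by (metis restrict_apply')
qed

lemma emb_inj:
  assumes "\<And>x. x \<in> k1 \<Longrightarrow> emb \<sigma> i x = emb \<sigma> j x"
  shows "i = j"
proof -
  have "card ((\<lambda>i. restrict (emb \<sigma> i) k1) ` UNIV) = 3"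
    using embs_distinct unfolding embs UNIV_3 by simp
  then have "inj (\<lambda>i. restrict (emb \<sigma> i) k1)"
    by (intro eq_card_imp_inj_on) simp_all
  moreover have "restrict (emb \<sigma> i) k1 = restrict (emb \<sigma> j) k1"
    using assms by (auto simp: restrict_def)
  ultimately show ?thesis by (auto dest: injD)
qed

text \<open>The inverse of the permutation that \<open>s\<close> induces on the three embeddings by
  composition, which is the index occurring in \<open>gal_G\<close>.\<close>

definition prm :: "('a \<Rightarrow> 'a) \<Rightarrow> 3 \<Rightarrow> 3" where
  "prm s j = (THE i. \<forall>x\<in>k1. s (emb \<sigma> i x) = emb \<sigma> j x)"

lemma prm_eqI:
  assumes "s \<in> abs_Gal k" "\<And>x. x \<in> k1 \<Longrightarrow> s (emb \<sigma> i x) = emb \<sigma> j x"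
  shows "prm s j = i"
  unfolding prm_def
proof (rule the_equality)
  fix i' assume *: "\<forall>x\<in>k1. s (emb \<sigma> i' x) = emb \<sigma> j x"
  show "i' = i"
    by (rule emb_inj) (use * assms(2) gal_inj_iff[OF assms(1)] in metis)
qed (use assms in blast)

context
  fixes s assumes s: "s \<in> abs_Gal k"
begin

lemma prm: "x \<in> k1 \<Longrightarrow> s (emb \<sigma> (prm s j) x) = emb \<sigma> j x"
proof -
  have "\<exists>j. \<forall>x\<in>k1. s (emb \<sigma> i x) = emb \<sigma> j x" for i
    using embedding_cases[of "s \<circ> emb \<sigma> i"] emb_hom[of i] gal_base[OF s] gal_add[OF s] gal_mult[OF s]
    by (simp add: field_hom_on_def)
  then obtain m where m: "\<And>i x. x \<in> k1 \<Longrightarrow> s (emb \<sigma> i x) = emb \<sigma> (m i) x" by metis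
  \<comment> \<open>Here \<open>m\<close> is the permutation of the embeddings induced by
    \<open>s\<close>; injectivity on three elements gives the preimage of \<open>j\<close>.\<close>
  have "inj m"
  proof (rule injI)
    fix i i' assume "m i = m i'"
    then have "s (emb \<sigma> i x) = s (emb \<sigma> i' x)" if "x \<in> k1" for x using m that by metis
    then show "i = i'" using gal_inj_iff[OF s] by (intro emb_inj) blast
  qed
  then have "surj m" by (simp add: finite_UNIV_inj_surj)
  then obtain i where "m i = j" by (metis surjD)
  then have i: "s (emb \<sigma> i x) = emb \<sigma> j x" if "x \<in> k1" for x using m that by blast
  show "x \<in> k1 \<Longrightarrow> s (emb \<sigma> (prm s j) x) = emb \<sigma> j x"
    using prm_eqI[OF s i] i by simp
qed

lemma bij_prm: "bij (prm s)"
proof -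
  have "inj (prm s)"
    by (rule injI, rule emb_inj) (metis prm)
  then show ?thesis by (simp add: bij_def finite_UNIV_inj_surj)
qed

end

text \<open>The semilinear action compatible with \<open>gal_G\<close>. On a pure tensor the new
  factor \<open>j\<close> is \<open>s\<close> applied to the old factor \<open>prm s j\<close>; on
  coordinate indices this is composition with the inverse of \<open>prm s\<close>.\<close>

definition tw :: "('a \<Rightarrow> 'a) \<Rightarrow> 'a tensor \<Rightarrow> 'a tensor" where
  "tw s x = (\<chi> i j l. s (tensor_at x (idx i j l \<circ> inv_into UNIV (prm s))))"

lemma idx_eta: "idx (I 1) (I 2) (I 3) = I"
  by (rule ext) (metis exhaust_3 idx_simps)

lemma tensor_at_tw: "tensor_at (tw s x) I = s (tensor_at x (I \<circ> inv_into UNIV (prm s)))"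
proof -
  have "tensor_at (tw s x) I = tw s x $ I 1 $ I 2 $ I 3" by (simp only: tensor_at_def)
  then show ?thesis by (simp add: tw_def idx_eta)
qed

context
  fixes s assumes s: "s \<in> abs_Gal k"
begin

lemma tw_add: "tw s (x + y) = tw s x + tw s y"
  by (rule tensor_eqI) (simp add: tensor_at_tw tensor_at_add gal_add[OF s])

lemma tw_pt: "tw s (pt t V) = pt (s t) (\<lambda>j. vmap s (V (prm s j)))"
proof (rule tensor_eqI)
  fix I :: "3 \<Rightarrow> 2"
  have inv: "inv_into UNIV (prm s) (prm s j) = j" for j
    using bij_prm[OF s] by (simp add: bij_def inv_f_f)
  have "(\<Prod>m\<in>UNIV. s (V m $ I (inv_into UNIV (prm s) m))) = (\<Prod>j\<in>UNIV. s (V (prm s j) $ I j))"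
    using prod.reindex_bij_betw[OF bij_prm[OF s], of "\<lambda>m. s (V m $ I (inv_into UNIV (prm s) m))"]
    by (simp add: inv)
  then show "tensor_at (tw s (pt t V)) I = tensor_at (pt (s t) (\<lambda>j. vmap s (V (prm s j)))) I"
    by (simp add: tensor_at_tw tensor_at_pt gal_mult[OF s] gal_prod[OF s])
qed

lemma gal_G_eq: "gal_G k1 \<sigma> s (t, g) = (s t, \<chi> j. map_matrix s (g $ prm s j))"
  by (simp add: gal_G_def prm_def)

lemma tw_Gact: "tw s (Gact h x) = Gact (gal_G k1 \<sigma> s h) (tw s x)"
proof (induction x rule: tensor_induct)
  case (1 c V)
  show ?case
    by (cases h) (simp add: Gact_pt tw_pt gal_G_eq gal_mult[OF s] vmap_mult[OF s])
qed (simp add: Gact_add tw_add)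

lemma tw_e_basis: "tw s (e_basis i i i) = e_basis i i i"
proof -
  have "vmap s (axis i 1) = axis i 1" by (simp add: vec_eq_iff axis_def s)
  then show ?thesis by (simp add: e_basis_pt tw_pt s)
qed

lemma gal_G_carrier: "g \<in> carrier Gsep \<Longrightarrow> gal_G k1 \<sigma> s g \<in> carrier Gsep"
  by (cases g) (simp add: gal_G_eq Gsep_carrier gal_det[OF s] gal_eq_0_iff[OF s])

lemma gal_G_Gk: "h \<in> Gk k k1 \<sigma> \<Longrightarrow> gal_G k1 \<sigma> s h = h"
  by (auto simp: Gk_def gal_G_eq vec_eq_iff gal_base[OF s] prm[OF s])

text \<open>An index in \<open>{1,2}^3\<close> is constant or has a single odd entry, at some place
  \<open>m\<close>. The conditions defining \<open>V\<close> put there the conjugate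
  \<open>emb \<sigma> m\<close> of one element of \<open>k1\<close>, and \<open>prm s\<close> moves
  the places as required by the action of \<open>s\<close> on the embeddings.\<close>

lemma tw_Vsp:
  assumes x: "x \<in> Vsp k k1 k2 \<sigma>"
  shows "tw s x = x"
proof (rule tensor_eqI)
  fix I :: "3 \<Rightarrow> 2"
  have bij: "bij (prm s)" by (rule bij_prm[OF s])
  let ?P = "inv_into UNIV (prm s)"
  define one where "one a b m = (\<lambda>i::3. if i = m then a else b :: 2)" for a b m
  have P: "one a b m \<circ> ?P = one a b (prm s m)" for a b m
    using bij by (auto simp: one_def fun_eq_iff bij_def surj_f_inv_f inv_f_f)
  have const: "tensor_at x (\<lambda>_. a) \<in> k" for a
    using x exhaust_2[of a] by (auto simp: Vsp_def tensor_at_def)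
  have at1: "tensor_at x (one 1 2 m) = emb \<sigma> m (x $ 1 $ 2 $ 2)" "x $ 1 $ 2 $ 2 \<in> k1" for m
    using x exhaust_3[of m] by (auto simp: Vsp_def tensor_at_def one_def)
  have at2: "tensor_at x (one 2 1 m) = emb \<sigma> m (x $ 2 $ 1 $ 1)" "x $ 2 $ 1 $ 1 \<in> k1" for m
    using x exhaust_3[of m] by (auto simp: Vsp_def tensor_at_def one_def)
  have "(\<exists>a. I = (\<lambda>_. a)) \<or> (\<exists>m. I = one 1 2 m) \<or> (\<exists>m. I = one 2 1 m)"
  proof -
    have "I = (\<lambda>_. 1) \<or> I = (\<lambda>_. 2) \<or> I = one 1 2 1 \<or> I = one 1 2 2 \<or> I = one 1 2 3 \<or> I = one 2 1 1 \<or> I = one 2 1 2 \<or> I = one 2 1 3"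
      using exhaust_2[of "I 1"] exhaust_2[of "I 2"] exhaust_2[of "I 3"]
      by (auto simp: one_def fun_eq_iff forall_3)
    then show ?thesis by blast
  qed
  then show "tensor_at (tw s x) I = tensor_at x I"
    using const gal_base[OF s]
    by (auto simp: tensor_at_tw P at1 at2 prm[OF s] comp_def[of "\<lambda>_. _"])
qed

lemma tw_orbit:
  assumes "x \<in> Vsp k k1 k2 \<sigma>" "y \<in> orbit k k1 \<sigma> x"
  shows "tw s y = y"
  using assms by (auto simp: orbit_def tw_Gact gal_G_Gk tw_Vsp)

text \<open>The cocycle value \<open>g^(-1) s(g)\<close> stabilizes \<open>w\<close>, and it lies in
  the identity component exactly when it fixes \<open>e_111\<close>, that is, when
  \<open>s(g) e_111 = g e_111\<close>. Since \<open>e_111\<close> is invariant, the left side is the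
  twisted conjugate of the right.\<close>

lemma Gw_to_S2_cocycle:
  assumes g: "g \<in> carrier Gsep" and inv: "tw s (Gact g w_pt) = Gact g w_pt"
  shows "Gw_to_S2 (inv\<^bsub>Gsep\<^esub> g \<otimes>\<^bsub>Gsep\<^esub> gal_G k1 \<sigma> s g) =
      (if tw s (Gact g (e_basis 1 1 1)) = Gact g (e_basis 1 1 1) then id else Transposition.transpose 1 2)"
    and "tw s (Gact g (e_basis 1 1 1)) = Gact g (e_basis 1 1 1) \<or> tw s (Gact g (e_basis 1 1 1)) = Gact g (e_basis 2 2 2)"
proof -
  have sg: "gal_G k1 \<sigma> s g \<in> carrier Gsep" by (rule gal_G_carrier[OF g])
  have eq: "Gact (gal_G k1 \<sigma> s g) (e_basis i i i) = tw s (Gact g (e_basis i i i))" for i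
    by (simp add: tw_Gact tw_e_basis)
  have "Gact g w_pt = Gact (gal_G k1 \<sigma> s g) w_pt"
    using inv by (simp add: tw_Gact tw_add tw_e_basis w_pt_def)
  from Gw_cases[OF Gw_quotient[OF g sg this]]
  show "Gw_to_S2 (inv\<^bsub>Gsep\<^esub> g \<otimes>\<^bsub>Gsep\<^esub> gal_G k1 \<sigma> s g) =
      (if tw s (Gact g (e_basis 1 1 1)) = Gact g (e_basis 1 1 1) then id else Transposition.transpose 1 2)"
    "tw s (Gact g (e_basis 1 1 1)) = Gact g (e_basis 1 1 1) \<or> tw s (Gact g (e_basis 1 1 1)) = Gact g (e_basis 2 2 2)"
    unfolding Gact_mult eq Gact_inv_eq_iff[OF g] Gw_to_S2_def
    using Gact_inv_eq_iff[OF g] e_basis_neq by (metis, metis)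
qed

end

end

subsection \<open>The fibres of \<open>\<alpha>\<^sub>V\<close>\<close>

definition quad_cocycle :: "'a::field set \<Rightarrow> 'a set \<Rightarrow> ('a \<Rightarrow> 'a) \<Rightarrow> nat \<Rightarrow> nat" where
  "quad_cocycle k F = (\<lambda>s\<in>abs_Gal k. if \<forall>x\<in>F. s x = x then id else Transposition.transpose 1 2)"

lemma quad_class_eq: "quad_class k F = H1_class k (sym_group 2) triv_act (quad_cocycle k F)"
  by (simp add: quad_class_def quad_cocycle_def)

lemma sym_group_2_cases:
  assumes "p \<in> carrier (sym_group 2)"
  shows "p = id \<or> p = Transposition.transpose 1 2"
proof -
  have "{1..2} = {1, 2::nat}" by auto
  then show ?thesis using assms by (simp add: sym_group_carrier permutes_doubleton_iff)
qed

lemma id_in_sym_group: "id \<in> carrier (sym_group n)"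
  by (simp add: sym_group_carrier permutes_id)

lemma transpose_in_sym_group: "Transposition.transpose 1 2 \<in> carrier (sym_group 2)"
  by (simp add: sym_group_carrier permutes_swap_id)

text \<open>Conjugation is trivial in \<open>S\<^sub>2\<close>.\<close>

lemma H1_class_sym_group_2:
  assumes c': "c' \<in> H1_class k (sym_group 2) triv_act c"
    and c: "\<And>s. s \<in> abs_Gal k \<Longrightarrow> c s \<in> carrier (sym_group 2)" and s: "s \<in> abs_Gal k"
  shows "c' s = c s"
proof -
  obtain h where h: "h \<in> carrier (sym_group 2)"
    "c' s = inv\<^bsub>sym_group 2\<^esub> h \<otimes>\<^bsub>sym_group 2\<^esub> c s \<otimes>\<^bsub>sym_group 2\<^esub> h"
    using c' s by (auto simp: H1_class_def triv_act_def)
  then have "c' s = inv_into UNIV h \<circ> c s \<circ> h" by (simp add: sym_group_mult)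
  then show ?thesis
    using sym_group_2_cases[OF h(1)] sym_group_2_cases[OF c[OF s]] by (auto simp: inv_id)
qed

lemma quad_cocycle_mem_class:
  assumes "quad_cocycle k F \<in> Z1 k (sym_group 2) triv_act"
  shows "quad_cocycle k F \<in> quad_class k F"
  using assms id_in_sym_group[of 2]
  by (auto simp: quad_class_eq H1_class_def triv_act_def sym_group_mult inv_id intro!: bexI[of _ id])

context cubic_setting
begin

lemma S2_cocycle_eq:
  assumes x: "x \<in> Vsp k k1 k2 \<sigma>" and g: "g \<in> carrier Gsep" "Gact g w_pt \<in> orbit k k1 \<sigma> x"
  shows "(\<lambda>s\<in>abs_Gal k. Gw_to_S2 ((\<lambda>s\<in>abs_Gal k. inv\<^bsub>Gsep\<^esub> g \<otimes>\<^bsub>Gsep\<^esub> gal_G k1 \<sigma> s g) s)) =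
    (\<lambda>s\<in>abs_Gal k. if tw s (Gact g (e_basis 1 1 1)) = Gact g (e_basis 1 1 1) then id
       else Transposition.transpose 1 2)"
  using Gw_to_S2_cocycle(1)[OF _ g(1)] tw_orbit[OF _ x g(2)] by (auto simp: restrict_def)

lemma transpose_12_neq_id: "Transposition.transpose 1 (2::nat) \<noteq> id"
  by (simp add: fun_eq_iff) (metis Suc_1 n_not_Suc_n One_nat_def transpose_apply_first)

text \<open>\<open>H1_map\<close> is a union over all \<open>g\<close> that move \<open>w\<close>
  into the orbit. If they all yield the same cocycle, the union is a single class; \<open>g0\<close>
  ensures that it is not empty.\<close>

lemma alpha_V_eqI:
  assumes x: "x \<in> Vsp k k1 k2 \<sigma>" and "g0 \<in> carrier Gsep" "Gact g0 w_pt \<in> orbit k k1 \<sigma> x"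
    and all: "\<And>g s. g \<in> carrier Gsep \<Longrightarrow> Gact g w_pt \<in> orbit k k1 \<sigma> x \<Longrightarrow> s \<in> abs_Gal k \<Longrightarrow>
       tw s (Gact g (e_basis 1 1 1)) = Gact g (e_basis 1 1 1) \<longleftrightarrow> (\<forall>a\<in>F. s a = a)"
  shows "alpha_V k k1 \<sigma> (orbit k k1 \<sigma> x) = quad_class k F"
proof -
  have "(\<lambda>s\<in>abs_Gal k. Gw_to_S2 (c s)) = quad_cocycle k F" if "c \<in> orbit_H1 k k1 \<sigma> (orbit k k1 \<sigma> x)" for c
  proof -
    obtain g where g: "g \<in> carrier Gsep" "Gact g w_pt \<in> orbit k k1 \<sigma> x"
      "c = (\<lambda>s\<in>abs_Gal k. inv\<^bsub>Gsep\<^esub> g \<otimes>\<^bsub>Gsep\<^esub> gal_G k1 \<sigma> s g)"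
      using \<open>c \<in> _\<close> by (auto simp: orbit_H1_def)
    show ?thesis unfolding g(3) S2_cocycle_eq[OF x g(1,2)] quad_cocycle_def
      using all[OF g(1,2)] by (auto simp: restrict_def)
  qed
  moreover have "orbit_H1 k k1 \<sigma> (orbit k k1 \<sigma> x) \<noteq> {}"
    using assms(2,3) unfolding orbit_H1_def by blast
  ultimately show ?thesis by (auto simp: alpha_V_def H1_map_def quad_class_eq)
qed

text \<open>Since the class on the right is nonempty, \<open>x\<close> is a translate of \<open>w\<close>: neither this nor the
  vanishing of \<open>H\<^sup>1(k, G)\<close> has to be proved separately.\<close>

lemma alpha_V_eqD:
  assumes x: "x \<in> Vsp k k1 k2 \<sigma>" and Z: "quad_cocycle k F \<in> Z1 k (sym_group 2) triv_act"
    and eq: "alpha_V k k1 \<sigma> (orbit k k1 \<sigma> x) = quad_class k F"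
  obtains g where "g \<in> carrier Gsep" "Gact g w_pt \<in> orbit k k1 \<sigma> x"
    "\<And>s. s \<in> abs_Gal k \<Longrightarrow> tw s (Gact g (e_basis 1 1 1)) = Gact g (e_basis 1 1 1) \<longleftrightarrow> (\<forall>a\<in>F. s a = a)"
proof -
  obtain g where g: "g \<in> carrier Gsep" "Gact g w_pt \<in> orbit k k1 \<sigma> x" and
    H: "quad_cocycle k F \<in> H1_class k (sym_group 2) triv_act
      (\<lambda>s\<in>abs_Gal k. Gw_to_S2 ((\<lambda>s\<in>abs_Gal k. inv\<^bsub>Gsep\<^esub> g \<otimes>\<^bsub>Gsep\<^esub> gal_G k1 \<sigma> s g) s))"
    using quad_cocycle_mem_class[OF Z] unfolding eq[symmetric] alpha_V_def H1_map_def orbit_H1_def by blast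
  have "tw s (Gact g (e_basis 1 1 1)) = Gact g (e_basis 1 1 1) \<longleftrightarrow> (\<forall>a\<in>F. s a = a)" if s: "s \<in> abs_Gal k" for s
  proof -
    have "quad_cocycle k F s = (if tw s (Gact g (e_basis 1 1 1)) = Gact g (e_basis 1 1 1) then id
       else Transposition.transpose 1 2)"
      using H1_class_sym_group_2[OF H[unfolded S2_cocycle_eq[OF x g]] _ s] s
        id_in_sym_group transpose_in_sym_group by auto
    then show ?thesis using s transpose_12_neq_id by (auto simp: quad_cocycle_def split: if_splits)
  qed
  then show thesis using that g by blast
qed

end

subsection \<open>Rank one tensors over an intermediate field\<close>

text \<open>The condition on \<open>s0 (s0 x)\<close> is separate because \<open>s0 x\<close> may
  leave \<open>k1\<close>, where \<open>s0\<close> is no longer known to agree with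
  \<sigma>.\<close>

locale cubic_over = cubic_setting k k1 k2 \<sigma> for k k1 k2 :: "'a::field set" and \<sigma> +
  fixes F :: "'a set" and s0 :: "'a \<Rightarrow> 'a"
  assumes F: "is_subfield F" and k_F: "k \<subseteq> F"
    and s0: "s0 \<in> abs_Gal k" and s0_F: "\<And>a. a \<in> F \<Longrightarrow> s0 a = a"
    and s0_k1: "\<And>x. x \<in> k1 \<Longrightarrow> s0 x = \<sigma> x" "\<And>x. x \<in> k1 \<Longrightarrow> s0 (s0 x) = \<sigma> (\<sigma> x)"
begin

definition K1 :: "'a set" where "K1 = field_gen (k1 \<union> F)"

text \<open>The conjugates of a vector over \<open>K1\<close> with respect to \<open>F\<close>. They
  are taken with \<open>s0\<close> since \<sigma> carries no information outside
  \<open>k2\<close>.\<close>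

definition nt :: "'a^2 \<Rightarrow> 3 \<Rightarrow> 'a^2" where "nt u i = vmap (emb s0 i) u"

lemma K1: "is_subfield K1" and k1_K1: "k1 \<subseteq> K1" and F_K1: "F \<subseteq> K1"
  using field_gen_superset[of "k1 \<union> F"] by (auto simp: K1_def is_subfield_field_gen)

lemma k_K1: "k \<subseteq> K1" using k_F F_K1 by blast

lemma emb_s0: "emb s0 i \<in> abs_Gal k"
  by (rule emb_gal[OF s0])

lemma emb_s0_k1: "x \<in> k1 \<Longrightarrow> emb s0 i x = emb \<sigma> i x"
  using exhaust_3[of i] s0_k1 by auto

lemma emb_s0_F: "a \<in> F \<Longrightarrow> emb s0 i a = a"
  using exhaust_3[of i] s0_F by auto

text \<open>On the conjugates of elements of \<open>K1\<close>, \<open>s\<close> acts as a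
  permutation combined with an automorphism \<open>t\<close> that is trivial on \<open>k1\<close>
  and equals \<open>s\<close> on \<open>F\<close>. The two composites agree on the generators
  \<open>k1 \<union> F\<close>.\<close>

lemma emb_s0_prm:
  assumes s: "s \<in> abs_Gal k" and t: "t \<in> abs_Gal k" "\<And>x. x \<in> k1 \<Longrightarrow> t x = x"
    "\<And>a. a \<in> F \<Longrightarrow> s a = t a" "\<And>a. a \<in> F \<Longrightarrow> t a \<in> F" and y: "y \<in> K1"
  shows "s (emb s0 (prm s j) y) = emb s0 j (t y)"
proof -
  have "(s \<circ> emb s0 (prm s j)) y = (emb s0 j \<circ> t) y"
  proof (rule agree_field_gen[OF gal_comp[OF s emb_s0] gal_comp[OF emb_s0 t(1)] _ y[unfolded K1_def]])
    fix x assume "x \<in> k1 \<union> F"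
    then show "(s \<circ> emb s0 (prm s j)) x = (emb s0 j \<circ> t) x"
      using t(2-4) by (auto simp: emb_s0_k1 emb_s0_F prm[OF s])
  qed
  then show ?thesis by simp
qed

lemma emb_s0_prm_fixed:
  assumes "s \<in> abs_Gal k" "\<And>a. a \<in> F \<Longrightarrow> s a = a" "y \<in> K1"
  shows "s (emb s0 (prm s j) y) = emb s0 j y"
  using emb_s0_prm[OF assms(1) gal_id, of y] assms(2,3) by simp

text \<open>An embedding of \<open>K1\<close> over \<open>F\<close> is determined on
  \<open>k1\<close>, where it is one of the three known ones. So the norm of \<open>K1/F\<close> is
  a product of three conjugates.\<close>

lemma embeddings_K1: "embeddings F K1 UNIV = (\<lambda>i. restrict (emb s0 i) K1) ` UNIV"
proof safe
  fix f assume "f \<in> embeddings F K1 UNIV"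
  then have f: "f \<in> extensional K1" "field_hom_on F K1 f" by (auto simp: embeddings_def PiE_def)
  have fk1: "field_hom_on k k1 f" and fK1: "field_hom_on k K1 f"
    using f(2) k_F k1_K1 unfolding field_hom_on_def by blast+
  obtain i where i: "\<forall>x\<in>k1. f x = emb \<sigma> i x" using embedding_cases[OF fk1] by blast
  obtain s where s: "s \<in> abs_Gal k" "\<And>x. x \<in> K1 \<Longrightarrow> s x = f x"
    using field_hom_extends[OF K1 k_K1 fK1] by blast
  have "s x = emb s0 i x" if "x \<in> K1" for x
  proof (rule agree_field_gen[OF s(1) emb_s0 _ that[unfolded K1_def]])
    fix y assume y: "y \<in> k1 \<union> F"
    have "f y = y" if "y \<in> F" using f(2) that by (simp add: field_hom_on_def)
    then show "s y = emb s0 i y" using y i s(2)[of y] k1_K1 F_K1 by (auto simp: emb_s0_k1 emb_s0_F)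
  qed
  then have "f = restrict (emb s0 i) K1"
    using s(2) f(1) by (auto simp: fun_eq_iff extensional_def)
  then show "f \<in> range (\<lambda>i. restrict (emb s0 i) K1)" by blast
next
  fix i
  have "field_hom_on F K1 (emb s0 i)"
    using emb_s0_F gal_add[OF emb_s0] gal_mult[OF emb_s0] by (simp add: field_hom_on_def)
  then show "restrict (emb s0 i) K1 \<in> embeddings F K1 UNIV"
    by (simp add: embeddings_def field_hom_on_restrict[OF K1 F_K1])
qed

lemma field_norm_eq:
  assumes "y \<in> K1"
  shows "field_norm F K1 y = (\<Prod>i\<in>UNIV. emb s0 i y)"
proof -
  have "inj (\<lambda>i. restrict (emb s0 i) K1)"
  proof (rule injI)
    fix i j assume eq: "restrict (emb s0 i) K1 = restrict (emb s0 j) K1"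
    show "i = j"
    proof (rule emb_inj)
      fix x assume "x \<in> k1"
      then show "emb \<sigma> i x = emb \<sigma> j x"
        using fun_cong[OF eq, of x] k1_K1 by (auto simp: emb_s0_k1)
    qed
  qed
  then show ?thesis using assms by (simp add: field_norm_def embeddings_K1 prod.reindex)
qed

text \<open>Automorphisms over \<open>F\<close> permute the three conjugates of
  \<open>y\<close>.\<close>

lemma field_norm_mem_F:
  assumes "y \<in> K1" shows "field_norm F K1 y \<in> F"
proof (rule fixed_field[OF F k_F])
  fix s assume s: "s \<in> abs_Gal k" "\<And>a. a \<in> F \<Longrightarrow> s a = a"
  have "s (field_norm F K1 y) = (\<Prod>i\<in>UNIV. s (emb s0 i y))"
    by (simp add: field_norm_eq[OF assms] gal_prod[OF s(1)])
  also have "\<dots> = (\<Prod>j\<in>UNIV. s (emb s0 (prm s j) y))"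
    using prod.reindex_bij_betw[OF bij_prm[OF s(1)], of "\<lambda>i. s (emb s0 i y)"] by simp
  also have "\<dots> = field_norm F K1 y"
    by (simp add: emb_s0_prm_fixed[OF s assms] field_norm_eq[OF assms])
  finally show "s (field_norm F K1 y) = field_norm F K1 y" .
qed

lemma field_norm_mult:
  assumes "y \<in> K1" "z \<in> K1"
  shows "field_norm F K1 (y * z) = field_norm F K1 y * field_norm F K1 z"
  using assms by (simp add: field_norm_eq subfield_mult[OF K1] gal_mult[OF emb_s0] prod.distrib)

lemma field_norm_1: "field_norm F K1 1 = 1"
  by (simp add: field_norm_eq subfield_1[OF K1] gal_1[OF emb_s0])

lemma field_norm_eq_0_iff: "y \<in> K1 \<Longrightarrow> field_norm F K1 y = 0 \<longleftrightarrow> y = 0"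
  by (simp add: field_norm_eq gal_eq_0_iff[OF emb_s0])

lemma field_norm_inverse:
  assumes "y \<in> K1" "y \<noteq> 0"
  shows "field_norm F K1 (inverse y) = inverse (field_norm F K1 y)"
  using field_norm_mult[of y "inverse y"] assms subfield_inverse[OF K1] field_norm_1
  by (simp add: inverse_unique)

lemma pt_nt_smult:
  assumes "y \<in> K1"
  shows "pt t (nt (y *s u)) = pt (t * field_norm F K1 y) (nt u)"
proof -
  have "pt t (nt (y *s u)) = pt t (\<lambda>i. emb s0 i y *s nt u i)"
    by (rule pt_cong) (simp_all only: nt_def vmap_smult[OF emb_s0])
  also have "\<dots> = pt (t * field_norm F K1 y) (nt u)"
    unfolding pt_smult field_norm_eq[OF assms] UNIV_3 by (simp add: mult.assoc)
  finally show ?thesis .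
qed

lemma nt_eq_0_iff: "nt u i = 0 \<longleftrightarrow> u = 0"
  by (simp add: nt_def vmap_eq_0_iff[OF emb_s0])

lemma nt_1: "nt u 1 = u"
  by (simp add: nt_def vec_eq_iff)

lemma nt_F: "(\<And>i. v $ i \<in> F) \<Longrightarrow> nt v = (\<lambda>_. v)"
  by (simp add: nt_def vec_eq_iff fun_eq_iff emb_s0_F)

lemma det_nt: "det (cols (nt u i) (nt v i)) = emb s0 i (det (cols u v))"
  by (simp add: det_cols nt_def gal_diff[OF emb_s0] gal_mult[OF emb_s0])

lemma tw_pt_nt:
  assumes s: "s \<in> abs_Gal k" and t: "t \<in> abs_Gal k" "\<And>x. x \<in> k1 \<Longrightarrow> t x = x"
    "\<And>a. a \<in> F \<Longrightarrow> s a = t a" "\<And>a. a \<in> F \<Longrightarrow> t a \<in> F" and u: "\<And>i. u $ i \<in> K1"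
  shows "tw s (pt b (nt u)) = pt (s b) (nt (vmap t u))"
proof -
  have "vmap s (nt u (prm s j)) = nt (vmap t u) j" for j
    by (simp add: vec_eq_iff nt_def emb_s0_prm[OF s t u])
  then show ?thesis by (simp add: tw_pt[OF s])
qed

lemma tw_pt_nt_fixed:
  assumes "s \<in> abs_Gal k" "\<And>a. a \<in> F \<Longrightarrow> s a = a" "\<And>i. u $ i \<in> K1"
  shows "tw s (pt b (nt u)) = pt (s b) (nt u)"
proof -
  have "vmap id u = u" by (simp add: vec_eq_iff)
  then show ?thesis using tw_pt_nt[OF assms(1) gal_id _ _ _ assms(3), of b] assms(2) by simp
qed

text \<open>Invariance of the tensor controls its factors only up to scalars. Normalising one
  coordinate of \<open>V 1\<close> to 1 turns an invariant line into an invariant vector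
  \<open>u\<close>; \<open>s0\<close> then determines the lines of the other two factors, and all
  scalars are collected in \<open>b\<close>.\<close>

lemma invariant_pt:
  assumes t: "t \<noteq> 0" and V: "\<And>i. V i \<noteq> 0"
    and inv: "\<And>s. s \<in> abs_Gal k \<Longrightarrow> (\<And>a. a \<in> F \<Longrightarrow> s a = a) \<Longrightarrow> tw s (pt t V) = pt t V"
  obtains b u c where "b \<in> F" "b \<noteq> 0" "\<And>i. u $ i \<in> K1" "c \<noteq> 0" "V 1 = c *s u" "pt t V = pt b (nt u)"
proof -
  have par: "\<exists>c. c \<noteq> 0 \<and> vmap s (V (prm s i)) = c *s V i"
    if "s \<in> abs_Gal k" "\<And>a. a \<in> F \<Longrightarrow> s a = a" for s i
  proof -
    have "pt t V = pt (s t) (\<lambda>j. vmap s (V (prm s j)))" using inv[OF that] tw_pt[OF that(1)] by simp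
    from pt_eq_parallel[OF this t V] show ?thesis .
  qed
  obtain a where a: "V 1 $ a \<noteq> 0" using nonzero_vec[OF V] by blast
  define u where "u = inverse (V 1 $ a) *s V 1"
  have Vu: "V 1 = (V 1 $ a) *s u" using a by (simp add: u_def vec_eq_iff)
  have uK: "u $ i \<in> K1" for i
  proof (rule fixed_field[OF K1 k_K1])
    fix s assume s: "s \<in> abs_Gal k" "\<And>x. x \<in> K1 \<Longrightarrow> s x = x"
    \<comment> \<open>An automorphism that is trivial on \<open>k1\<close> keeps the first factor in
      place, so it preserves the line of \<open>V 1\<close>.\<close>
    have "prm s 1 = 1" using s k1_K1 by (intro prm_eqI) auto
    then obtain c where c: "c \<noteq> 0" "vmap s (V 1) = c *s V 1"
      using par[OF s(1), of 1] s(2) F_K1 by auto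
    have "s (V 1 $ j) = c * V 1 $ j" for j using arg_cong[OF c(2), of "\<lambda>v. v $ j"] by simp
    then show "s (u $ i) = u $ i"
      using c(1) by (simp add: u_def gal_mult[OF s(1)] gal_inverse[OF s(1)])
  qed
  \<comment> \<open>\<open>s0\<close> carries the line of the first factor to that of the second,
    and the second to the third.\<close>
  have "prm s0 2 = 1" "prm s0 3 = 2"
    using s0_k1 by (auto intro!: prm_eqI[OF s0])
  then obtain c2 c3 where c2: "c2 \<noteq> 0" "vmap s0 (V 1) = c2 *s V 2" and c3: "c3 \<noteq> 0" "vmap s0 (V 2) = c3 *s V 3"
    using par[OF s0 s0_F, of 2] par[OF s0 s0_F, of 3] by auto
  define d2 where "d2 = s0 (V 1 $ a) / c2"
  have V2: "V 2 = d2 *s nt u 2"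
  proof -
    have "c2 *s V 2 = s0 (V 1 $ a) *s vmap s0 u"
      using Vu c2(2) vmap_smult[OF s0] by metis
    then have "c2 * V 2 $ j = s0 (V 1 $ a) * s0 (u $ j)" for j
      by (metis vector_smult_component vmap_nth)
    then show ?thesis using c2(1) by (simp add: vec_eq_iff d2_def nt_def field_simps)
  qed
  have V3: "V 3 = (s0 d2 / c3) *s nt u 3"
  proof -
    have "c3 *s V 3 = s0 d2 *s vmap s0 (nt u 2)"
      using V2 c3(2) vmap_smult[OF s0] by metis
    then have "c3 * V 3 $ j = s0 d2 * s0 (s0 (u $ j))" for j
      by (metis vector_smult_component vmap_nth nt_def emb_simps(2))
    then show ?thesis using c3(1) by (simp add: vec_eq_iff nt_def field_simps)
  qed
  define b where "b = t * (V 1 $ a * d2 * (s0 d2 / c3))"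
  have "V i = (if i = 1 then V 1 $ a else if i = 2 then d2 else s0 d2 / c3) *s nt u i" for i
    using exhaust_3[of i] Vu V2 V3 nt_1 by fastforce
  then have "pt t V = pt t (\<lambda>i. (if i = 1 then V 1 $ a else if i = 2 then d2 else s0 d2 / c3) *s nt u i)"
    by (intro pt_cong) auto
  then have eq: "pt t V = pt b (nt u)" unfolding pt_smult by (simp add: b_def)
  have "d2 \<noteq> 0" using V2 V[of 2] by auto
  then have b0: "b \<noteq> 0" using t a c3(1) by (simp add: b_def gal_eq_0_iff[OF s0])
  have u0: "u \<noteq> 0" using Vu V[of 1] by auto
  have "b \<in> F"
  proof (rule fixed_field[OF F k_F])
    fix s assume s: "s \<in> abs_Gal k" "\<And>a. a \<in> F \<Longrightarrow> s a = a"
    have "pt (s b) (nt u) = pt b (nt u)"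
      using inv[OF s] tw_pt_nt_fixed[OF s uK] eq by simp
    then show "s b = b" using pt_eq_iff_coeff u0 nt_eq_0_iff by blast
  qed
  then show thesis using that b0 uK a Vu eq by blast
qed

text \<open>The freedom left by descent is the scale of \<open>u\<close>. As \<open>v\<close> has
  entries in \<open>F\<close> and \<open>u\<close> in \<open>K1\<close>, the factor between them
  lies in \<open>K1\<close>, and the coefficients differ by its norm.\<close>

lemma pt_nt_coeff:
  assumes eq: "pt b' (\<lambda>_. v) = pt b (nt u)" and v: "\<And>i. v $ i \<in> F" "v \<noteq> 0" and b': "b' \<noteq> 0"
    and u: "\<And>i. u $ i \<in> K1"
  shows "\<exists>y\<in>K1 - {0}. b' = b * field_norm F K1 y"
proof -
  obtain c where c: "c \<noteq> 0" "u = c *s v"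
    using pt_eq_parallel[OF eq b', of 1] v(2) nt_1 by auto
  obtain a where a: "v $ a \<noteq> 0" using nonzero_vec[OF v(2)] by blast
  have "c = u $ a / v $ a" using c(2) a by simp
  then have cK: "c \<in> K1" using u v(1) F_K1 subfield_divide[OF K1] by blast
  have "pt b' (nt v) = pt (b * field_norm F K1 c) (nt v)"
    using eq unfolding c(2) pt_nt_smult[OF cK] nt_F[OF v(1)] .
  then have "b' = b * field_norm F K1 c" using pt_eq_iff_coeff v(2) nt_eq_0_iff by blast
  then show ?thesis using c(1) cK by blast
qed

end

text \<open>Below, \<open>v, w\<close> is the standard basis in the split case and \<open>(1, -\<alpha>\<^sub>1), (1, -\<alpha>\<^sub>2)\<close> in the
  quadratic case.\<close>

definition base_pt :: "'a::field^2 \<Rightarrow> 'a^2 \<Rightarrow> 'a \<Rightarrow> 'a \<Rightarrow> 'a tensor" where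
  "base_pt v w b1 b2 = pt b1 (\<lambda>_. v) + pt b2 (\<lambda>_. w)"

section \<open>Rational group elements, their orbits, and the points of a fibre\<close>

context cubic_over
begin

text \<open>Elements of \<open>G_k\<close> written with \<open>s0\<close> in place of \<sigma>: the
  maps \<open>emb s0 i\<close> are automorphisms of the whole ambient field, so matrix identities
  can be conjugated for arbitrary entries.\<close>

definition gk :: "'a \<Rightarrow> 'a^2^2 \<Rightarrow> 'a Gpt" where
  "gk t g = (t, \<chi> i. map_matrix (emb s0 i) g)"

lemma Gk_iff: "h \<in> Gk k k1 \<sigma> \<longleftrightarrow>
  (\<exists>t g. h = gk t g \<and> t \<in> k - {0} \<and> (\<forall>i j. g $ i $ j \<in> k1) \<and> det g \<noteq> 0)"
proof -
  have "map_matrix (emb \<sigma> i) g = map_matrix (emb s0 i) g" if "\<forall>i j. g $ i $ j \<in> k1" for g i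
    using that by (simp add: vec_eq_iff emb_s0_k1)
  then show ?thesis unfolding Gk_def gk_def by (auto; metis)
qed

lemma gk_mult: "gk t g \<otimes>\<^bsub>Gsep\<^esub> gk t' g' = gk (t * t') (g ** g')"
  by (simp add: gk_def Gsep_mult vec_eq_iff matrix_matrix_mult_def sum_2 gal_add[OF emb_s0] gal_mult[OF emb_s0])

lemma gk_one: "gk 1 (mat 1) = \<one>\<^bsub>Gsep\<^esub>"
  by (simp add: gk_def Gsep_one vec_eq_iff mat_def gal_1[OF emb_s0] gal_0[OF emb_s0])

lemma Gk_carrier: "h \<in> Gk k k1 \<sigma> \<Longrightarrow> h \<in> carrier Gsep"
  unfolding Gk_iff by (auto simp: gk_def Gsep_carrier gal_det[OF emb_s0] gal_eq_0_iff[OF emb_s0])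

lemma Gk_one: "\<one>\<^bsub>Gsep\<^esub> \<in> Gk k k1 \<sigma>"
  unfolding gk_one[symmetric] Gk_iff
  by (intro exI[of _ 1] exI[of _ "mat 1"]) (auto simp: mat_def subfieldD[OF k] subfieldD[OF k1] det_I[unfolded mat_def])

lemma Gk_mult:
  assumes "h \<in> Gk k k1 \<sigma>" "h' \<in> Gk k k1 \<sigma>"
  shows "h \<otimes>\<^bsub>Gsep\<^esub> h' \<in> Gk k k1 \<sigma>"
proof -
  obtain t g t' g' where h: "h = gk t g" "h' = gk t' g'" "t \<in> k - {0}" "t' \<in> k - {0}"
    "\<forall>i j. g $ i $ j \<in> k1" "\<forall>i j. g' $ i $ j \<in> k1" "det g \<noteq> 0" "det g' \<noteq> 0"
    using assms unfolding Gk_iff by blast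
  have "\<forall>i j. (g ** g') $ i $ j \<in> k1"
    using h(5,6) by (auto simp: matrix_matrix_mult_def intro!: subfield_sum[OF k1] subfield_mult[OF k1])
  then show ?thesis unfolding h(1,2) gk_mult Gk_iff
    using h(3,4,7,8) subfield_mult[OF k] by (intro exI[of _ "t * t'"] exI[of _ "g ** g'"]) (auto simp: det_mul)
qed

lemma Gk_inv:
  assumes "h \<in> Gk k k1 \<sigma>"
  shows "inv\<^bsub>Gsep\<^esub> h \<in> Gk k k1 \<sigma>"
proof -
  obtain t g where h: "h = gk t g" "t \<in> k" "t \<noteq> 0" "\<forall>i j. g $ i $ j \<in> k1" "det g \<noteq> 0"
    using assms unfolding Gk_iff by blast
  \<comment> \<open>The adjugate matrix; it exhibits an inverse with entries in
    \<open>k1\<close>.\<close>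
  define adj where "adj = cols (vector [g $ 2 $ 2, - g $ 2 $ 1]) (vector [- g $ 1 $ 2, g $ 1 $ 1])"
  define g' where "g' = (\<chi> i j. inverse (det g) * adj $ i $ j)"
  have adj: "adj ** g = mat (det g)"
    by (simp add: adj_def cols_def matrix_matrix_mult_def mat_def vec_eq_iff forall_2 sum_2 det_2)
  have "g' ** g = (\<chi> i j. inverse (det g) * (adj ** g) $ i $ j)"
    by (simp add: g'_def matrix_matrix_mult_def vec_eq_iff sum_2 algebra_simps)
  also have "\<dots> = mat 1"
    unfolding adj using h(5) by (simp add: mat_def vec_eq_iff)
  finally have inv: "g' ** g = mat 1" .
  have "det g \<in> k1" unfolding det_2
    by (intro subfield_diff[OF k1] subfield_mult[OF k1]) (simp_all add: h(4))
  then have k1': "\<forall>i j. g' $ i $ j \<in> k1"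
    using h(4) by (auto simp: g'_def adj_def cols_def forall_2
        intro!: subfield_mult[OF k1] subfield_inverse[OF k1] subfield_uminus[OF k1])
  have "det g' \<noteq> 0" using inv det_mul[of g' g] by (auto simp: det_I)
  then have mem: "gk (inverse t) g' \<in> Gk k k1 \<sigma>"
    unfolding Gk_iff using h(3) subfield_inverse[OF k h(2)] k1'
    by (intro exI[of _ "inverse t"] exI[of _ g']) simp
  have "gk (inverse t) g' \<otimes>\<^bsub>Gsep\<^esub> h = \<one>\<^bsub>Gsep\<^esub>"
    unfolding h(1) gk_mult inv using h(3) gk_one by simp
  then show ?thesis
    using Gsep.inv_equality[OF _ Gk_carrier[OF assms] Gk_carrier[OF mem]] mem by simp
qed

lemma orbit_self: "x \<in> orbit k k1 \<sigma> x"
  unfolding orbit_def using Gk_one Gact_one by (metis imageI)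

lemma orbit_subset:
  assumes "y \<in> orbit k k1 \<sigma> x" shows "orbit k k1 \<sigma> y \<subseteq> orbit k k1 \<sigma> x"
proof -
  obtain h where h: "h \<in> Gk k k1 \<sigma>" "y = Gact h x" using assms by (auto simp: orbit_def)
  have "Gact h' y \<in> orbit k k1 \<sigma> x" if "h' \<in> Gk k k1 \<sigma>" for h'
    unfolding orbit_def h(2) Gact_mult[symmetric] using Gk_mult[OF that h(1)] by (rule imageI)
  then show ?thesis by (auto simp: orbit_def)
qed

lemma orbit_eq:
  assumes y: "y \<in> orbit k k1 \<sigma> x" shows "orbit k k1 \<sigma> y = orbit k k1 \<sigma> x"
proof
  obtain h where h: "h \<in> Gk k k1 \<sigma>" "y = Gact h x" using y by (auto simp: orbit_def)
  have "x = Gact (inv\<^bsub>Gsep\<^esub> h) y" using Gact_inv_eq_iff[OF Gk_carrier[OF h(1)], of y x] h(2) by simp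
  then have "x \<in> orbit k k1 \<sigma> y" unfolding orbit_def using Gk_inv[OF h(1)] by blast
  then show "orbit k k1 \<sigma> x \<subseteq> orbit k k1 \<sigma> y" by (rule orbit_subset)
qed (rule orbit_subset[OF y])

lemma orbit_eq_iff: "orbit k k1 \<sigma> y = orbit k k1 \<sigma> x \<longleftrightarrow> y \<in> orbit k k1 \<sigma> x"
  using orbit_eq orbit_self by blast

lemma Gact_gk: "Gact (gk t g) (pt b (nt v)) = pt (t * b) (nt (g *v v))"
proof -
  have "nt (g *v v) = (\<lambda>i. (\<chi> i. map_matrix (emb s0 i) g) $ i *v nt v i)"
    by (rule ext) (simp add: nt_def vmap_mult[OF emb_s0])
  then show ?thesis by (simp add: gk_def Gact_pt)
qed

context
  fixes v w :: "'a^2"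
  assumes v: "\<And>i. v $ i \<in> F" and w: "\<And>i. w $ i \<in> F" and vw: "det (cols v w) \<noteq> 0"
begin

lemma orbit_base_pt:
  assumes b: "b1 \<noteq> 0" "b2 \<noteq> 0" "b1' \<noteq> 0" "b2' \<noteq> 0"
    and mem: "base_pt v w b1' b2' \<in> orbit k k1 \<sigma> (base_pt v w b1 b2)"
  obtains t y y' where "t \<in> k - {0}" "y \<in> K1 - {0}" "y' \<in> K1 - {0}"
    "b1' = t * b1 * field_norm F K1 y \<and> b2' = t * b2 * field_norm F K1 y' \<or>
     b1' = t * b2 * field_norm F K1 y \<and> b2' = t * b1 * field_norm F K1 y'"
proof -
  obtain t g where tg: "t \<in> k - {0}" "\<forall>i j. g $ i $ j \<in> k1" "det g \<noteq> 0"
    "base_pt v w b1' b2' = Gact (gk t g) (base_pt v w b1 b2)"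
  proof -
    obtain h where "h \<in> Gk k k1 \<sigma>" "base_pt v w b1' b2' = Gact h (base_pt v w b1 b2)"
      using mem unfolding orbit_def by blast
    then show thesis using that unfolding Gk_iff by blast
  qed
  have eq: "pt b1' (\<lambda>_. v) + pt b2' (\<lambda>_. w) = pt (t * b1) (nt (g *v v)) + pt (t * b2) (nt (g *v w))"
    using tg(4) unfolding base_pt_def nt_F[OF v, symmetric] nt_F[OF w, symmetric] Gact_add Gact_gk .
  have det: "det (cols (nt (g *v v) i) (nt (g *v w) i)) \<noteq> 0" for i
    using tg(3) vw unfolding det_nt gal_eq_0_iff[OF emb_s0] matrix_mult_cols[symmetric] det_mul by simp
  have K: "(g *v z) $ i \<in> K1" if "\<And>i. z $ i \<in> F" for z i
    unfolding matrix_vector_mult_def vec_lambda_beta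
    by (intro subfield_sum[OF K1] subfield_mult[OF K1]) (use tg(2) that k1_K1 F_K1 in auto)
  have t: "t * b1 \<noteq> 0" "t * b2 \<noteq> 0" using tg(1) b by auto
  note vK = pt_nt_coeff[OF _ v det_cols_nonzero(1)[OF vw]] and wK = pt_nt_coeff[OF _ w det_cols_nonzero(2)[OF vw]]
  from pt_sum_unique[OF t det b(3,4) vw eq[symmetric]]
  show thesis
  proof
    assume "pt b1' (\<lambda>_. v) = pt (t * b1) (nt (g *v v)) \<and> pt b2' (\<lambda>_. w) = pt (t * b2) (nt (g *v w))"
    then show thesis using vK[OF _ b(3)] wK[OF _ b(4)] K v w that[OF tg(1)] by metis
  next
    assume "pt b1' (\<lambda>_. v) = pt (t * b2) (nt (g *v w)) \<and> pt b2' (\<lambda>_. w) = pt (t * b1) (nt (g *v v))"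
    then show thesis using vK[OF _ b(3)] wK[OF _ b(4)] K v w that[OF tg(1)] by metis
  qed
qed

text \<open>Rational group elements commute with the twisted action, so the cocycle can be read off
  at the base point itself. For \<open>F = k\<close> the exchange hypothesis is vacuous.\<close>

lemma base_pt_fibre:
  assumes V: "base_pt v w b1 b2 \<in> Vss k k1 k2 \<sigma>" and b: "b1 \<in> F - {0}" "b2 \<in> F - {0}"
    and swap: "\<And>s. s \<in> abs_Gal k \<Longrightarrow> \<not> (\<forall>a\<in>F. s a = a) \<Longrightarrow> tw s (pt b1 (\<lambda>_. v)) = pt b2 (\<lambda>_. w)"
  shows "orbit k k1 \<sigma> (base_pt v w b1 b2) \<in> alpha_V_fibre k k1 k2 \<sigma> F"
proof -
  have b0: "b1 \<noteq> 0" "b2 \<noteq> 0" using b by auto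
  have V': "base_pt v w b1 b2 \<in> Vsp k k1 k2 \<sigma>" using V by (simp add: Vss_def)
  let ?g0 = "pair_elt b1 b2 (\<lambda>_. v) (\<lambda>_. w)"
  note g0 = pair_elt[OF b0, of "\<lambda>_. v" "\<lambda>_. w", OF vw]
  have g0w: "Gact ?g0 w_pt = base_pt v w b1 b2" by (simp add: g0(4) base_pt_def)
  have neq: "pt b1 (\<lambda>_. v) \<noteq> pt b2 (\<lambda>_. w)"
    unfolding g0(2,3)[symmetric] using e_basis_neq Gact_inv_eq_iff[OF g0(1)] by metis
  have "alpha_V k k1 \<sigma> (orbit k k1 \<sigma> (base_pt v w b1 b2)) = quad_class k F"
  proof (rule alpha_V_eqI[OF V' g0(1)])
    show "Gact ?g0 w_pt \<in> orbit k k1 \<sigma> (base_pt v w b1 b2)" unfolding g0w by (rule orbit_self)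
    fix g s assume g: "g \<in> carrier Gsep" "Gact g w_pt \<in> orbit k k1 \<sigma> (base_pt v w b1 b2)" and s: "s \<in> abs_Gal k"
    obtain h where h: "h \<in> Gk k k1 \<sigma>" "Gact g w_pt = Gact (h \<otimes>\<^bsub>Gsep\<^esub> ?g0) w_pt"
      using g(2) unfolding orbit_def g0w[symmetric] Gact_mult[symmetric] by blast
    have hG: "h \<in> carrier Gsep" by (rule Gk_carrier[OF h(1)])
    have "Gact g (e_basis 1 1 1) = Gact h (pt b1 (\<lambda>_. v)) \<or> Gact g (e_basis 1 1 1) = Gact h (pt b2 (\<lambda>_. w))"
      using Gact_w_unique[OF _ g(1) h(2)[symmetric]] hG g0(1) unfolding Gact_mult g0(2,3) by auto
    then obtain y where y: "Gact g (e_basis 1 1 1) = Gact h y" "y = pt b1 (\<lambda>_. v) \<or> y = pt b2 (\<lambda>_. w)" by blast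
    have "tw s (Gact h y) = Gact h y \<longleftrightarrow> tw s y = y"
      unfolding tw_Gact[OF s] gal_G_Gk[OF s h(1)] using Gact_inv_eq_iff[OF hG] by metis
    moreover have "tw s y = y \<longleftrightarrow> (\<forall>a\<in>F. s a = a)"
    proof (cases "\<forall>a\<in>F. s a = a")
      case True
      then have sF: "s a = a" if "a \<in> F" for a using that by blast
      have "tw s (pt b (\<lambda>_. z)) = pt b (\<lambda>_. z)" if "b \<in> F" "\<And>i. z $ i \<in> F" for b z
        using tw_pt_nt_fixed[OF s sF, of z b] that F_K1 sF nt_F[OF that(2)] by auto
      then show ?thesis using True y(2) b v w by auto
    next
      case False
      \<comment> \<open>The sum is invariant, so moving the first summand to the second forces the
        converse.\<close>
      have 1: "tw s (pt b1 (\<lambda>_. v)) = pt b2 (\<lambda>_. w)" by (rule swap[OF s False])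
      moreover have "tw s (base_pt v w b1 b2) = base_pt v w b1 b2" by (rule tw_Vsp[OF s V'])
      ultimately have "tw s (pt b2 (\<lambda>_. w)) = pt b1 (\<lambda>_. v)"
        by (simp add: base_pt_def tw_add[OF s] algebra_simps)
      then show ?thesis using 1 neq y(2) False by auto
    qed
    ultimately show "tw s (Gact g (e_basis 1 1 1)) = Gact g (e_basis 1 1 1) \<longleftrightarrow> (\<forall>a\<in>F. s a = a)"
      unfolding y(1) by simp
  qed
  then show ?thesis using V by (auto simp: alpha_V_fibre_def orbits_def)
qed

end

text \<open>The fibre condition gives \<open>g\<close> such that the automorphisms fixing
  \<open>g e_111\<close> are those over \<open>F\<close>; \<open>g e_222\<close> is invariant under
  them too, since the sum is. After descent of both summands, the last conclusion records the rest
  of the cocycle: automorphisms moving \<open>F\<close> carry the first summand to the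
  second.\<close>

lemma fibre_point:
  assumes X: "X \<in> alpha_V_fibre k k1 k2 \<sigma> F" and Z: "quad_cocycle k F \<in> Z1 k (sym_group 2) triv_act"
  obtains b1 b2 u1 u2 where "b1 \<in> F - {0}" "b2 \<in> F - {0}" "\<And>i. u1 $ i \<in> K1" "\<And>i. u2 $ i \<in> K1"
    "det (cols u1 u2) \<noteq> 0" "X = orbit k k1 \<sigma> (pt b1 (nt u1) + pt b2 (nt u2))"
    "\<And>s. s \<in> abs_Gal k \<Longrightarrow> \<not> (\<forall>a\<in>F. s a = a) \<Longrightarrow> tw s (pt b1 (nt u1)) = pt b2 (nt u2)"
proof -
  obtain x where x: "x \<in> Vsp k k1 k2 \<sigma>" "X = orbit k k1 \<sigma> x" "alpha_V k k1 \<sigma> (orbit k k1 \<sigma> x) = quad_class k F"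
    using X by (auto simp: alpha_V_fibre_def orbits_def Vss_def)
  obtain g where g: "g \<in> carrier Gsep" "Gact g w_pt \<in> orbit k k1 \<sigma> x"
    "\<And>s. s \<in> abs_Gal k \<Longrightarrow> tw s (Gact g (e_basis 1 1 1)) = Gact g (e_basis 1 1 1) \<longleftrightarrow> (\<forall>a\<in>F. s a = a)"
    using alpha_V_eqD[OF x(1) Z x(3)] by blast
  obtain t G where tG: "g = (t, G)" by (cases g)
  have t: "t \<noteq> 0" and det: "\<And>i. det (G $ i) \<noteq> 0" using g(1) by (auto simp: tG Gsep_carrier)
  have nz: "column 1 (G $ i) \<noteq> 0" "column 2 (G $ i) \<noteq> 0" for i
    using det_cols_nonzero[of "column 1 (G $ i)" "column 2 (G $ i)"] det[of i] cols_column[of "G $ i"] by auto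
  let ?T1 = "pt t (\<lambda>m. column 1 (G $ m))" and ?T2 = "pt t (\<lambda>m. column 2 (G $ m))"
  have T: "Gact g (e_basis 1 1 1) = ?T1" "Gact g (e_basis 2 2 2) = ?T2" by (simp_all add: tG Gact_e_basis)
  have inv: "tw s (?T1 + ?T2) = ?T1 + ?T2" if "s \<in> abs_Gal k" for s
    using tw_orbit[OF that x(1) g(2)] by (simp add: Gact_w_pt T)
  have inv1: "tw s ?T1 = ?T1" if "s \<in> abs_Gal k" "\<And>a. a \<in> F \<Longrightarrow> s a = a" for s
    using g(3)[OF that(1)] that(2) by (simp add: T)
  have inv2: "tw s ?T2 = ?T2" if "s \<in> abs_Gal k" "\<And>a. a \<in> F \<Longrightarrow> s a = a" for s
    using inv[OF that(1)] inv1[OF that] by (simp add: tw_add[OF that(1)])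
  obtain b1 u1 c1 where 1: "b1 \<in> F" "b1 \<noteq> 0" "\<And>i. u1 $ i \<in> K1" "c1 \<noteq> 0" "column 1 (G $ 1) = c1 *s u1" "?T1 = pt b1 (nt u1)"
    using invariant_pt[OF t nz(1) inv1] by metis
  obtain b2 u2 c2 where 2: "b2 \<in> F" "b2 \<noteq> 0" "\<And>i. u2 $ i \<in> K1" "c2 \<noteq> 0" "column 2 (G $ 1) = c2 *s u2" "?T2 = pt b2 (nt u2)"
    using invariant_pt[OF t nz(2) inv2] by metis
  have "det (G $ 1) = c1 * c2 * det (cols u1 u2)"
    using cols_column[of "G $ 1"] 1(5) 2(5) by (simp add: det_cols algebra_simps)
  then have d: "det (cols u1 u2) \<noteq> 0" using det[of 1] by auto
  have "X = orbit k k1 \<sigma> (pt b1 (nt u1) + pt b2 (nt u2))"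
    using orbit_eq[OF g(2)] x(2) unfolding Gact_w_pt T 1(6) 2(6) by simp
  moreover have "tw s (pt b1 (nt u1)) = pt b2 (nt u2)" if s: "s \<in> abs_Gal k" "\<not> (\<forall>a\<in>F. s a = a)" for s
    using Gw_to_S2_cocycle(2)[OF s(1) g(1)] g(3)[OF s(1)] s(2) tw_orbit[OF s(1) x(1) g(2)]
    unfolding T 1(6) 2(6) by blast
  ultimately show thesis using that[of b1 b2 u1 u2] 1 2 d by blast
qed

end

subsection \<open>Quotients\<close>

lemma (in group) rcos_eq_iff:
  assumes "subgroup H G" "a \<in> carrier G" "b \<in> carrier G"
  shows "H #> a = H #> b \<longleftrightarrow> (\<exists>h\<in>H. b = h \<otimes> a)"
proof
  assume "H #> a = H #> b"
  then have "b \<in> H #> a" using rcos_self[OF assms(3,1)] by simp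
  then show "\<exists>h\<in>H. b = h \<otimes> a" by (auto simp: r_coset_def)
next
  assume "\<exists>h\<in>H. b = h \<otimes> a"
  then have "b \<in> H #> a" by (auto simp: r_coset_def)
  then show "H #> a = H #> b" using repr_independence assms by metis
qed

text \<open>On the parameters \<open>P\<close>, the orbit \<open>orb p\<close> and the class of
  \<open>cs p\<close> modulo the involution have the same fibres. Choosing a parameter in each class
  therefore gives a well defined bijection.\<close>

lemma S2_quotient_bij:
  assumes C: "C = cs ` P" and sw: "\<And>p. p \<in> P \<Longrightarrow> sw p \<in> P" "\<And>p. p \<in> P \<Longrightarrow> sw (sw p) = p"
    and \<iota>: "\<And>p. p \<in> P \<Longrightarrow> \<iota> (cs p) = cs (sw p)"
    and eq: "\<And>p q. p \<in> P \<Longrightarrow> q \<in> P \<Longrightarrow> orb p = orb q \<longleftrightarrow> cs p = cs q \<or> cs p = cs (sw q)"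
    and Y: "orb ` P = Y"
  shows "\<exists>\<phi>. bij_betw \<phi> (S2_orbits \<iota> C) Y \<and> (\<forall>p\<in>P. \<phi> (S2_orbit \<iota> (cs p)) = orb p)"
proof -
  have iff: "S2_orbit \<iota> (cs p) = S2_orbit \<iota> (cs q) \<longleftrightarrow> orb p = orb q" if pq: "p \<in> P" "q \<in> P" for p q
  proof
    assume "S2_orbit \<iota> (cs p) = S2_orbit \<iota> (cs q)"
    then show "orb p = orb q" using eq[OF pq] \<iota> pq by (auto simp: S2_orbit_def doubleton_eq_iff)
  next
    assume "orb p = orb q"
    then consider "cs p = cs q" | "cs p = cs (sw q)" using eq[OF pq] by blast
    then show "S2_orbit \<iota> (cs p) = S2_orbit \<iota> (cs q)"
    proof cases
      case 2
      then have "\<iota> (cs p) = cs q" using \<iota>[OF sw(1)[OF pq(2)]] sw(2)[OF pq(2)] by simp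
      then show ?thesis using 2 \<iota>[OF pq(2)] by (auto simp: S2_orbit_def)
    qed simp
  qed
  define \<phi> where "\<phi> Q = orb (SOME p. p \<in> P \<and> S2_orbit \<iota> (cs p) = Q)" for Q
  have \<phi>: "\<phi> (S2_orbit \<iota> (cs p)) = orb p" if "p \<in> P" for p
  proof -
    let ?q = "SOME q. q \<in> P \<and> S2_orbit \<iota> (cs q) = S2_orbit \<iota> (cs p)"
    have "?q \<in> P \<and> S2_orbit \<iota> (cs ?q) = S2_orbit \<iota> (cs p)" by (rule someI[of _ p]) (use that in simp)
    then show ?thesis using iff that by (auto simp: \<phi>_def)
  qed
  have "bij_betw \<phi> (S2_orbits \<iota> C) Y"
    unfolding bij_betw_def S2_orbits_def C
  proof
    show "inj_on \<phi> (S2_orbit \<iota> ` cs ` P)" using \<phi> iff by (auto simp: inj_on_def)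
    show "\<phi> ` S2_orbit \<iota> ` cs ` P = Y" using \<phi> Y by (auto simp: image_iff)
  qed
  then show ?thesis using \<phi> by blast
qed

lemma comm_group_mult_units:
  assumes "is_subfield F" shows "comm_group (mult_units F)"
proof (rule comm_groupI)
  fix x assume "x \<in> carrier (mult_units F)"
  then show "\<exists>y\<in>carrier (mult_units F). y \<otimes>\<^bsub>mult_units F\<^esub> x = \<one>\<^bsub>mult_units F\<^esub>"
    using subfield_inverse[OF assms] by (intro bexI[of _ "inverse x"]) (auto simp: mult_units_def)
qed (use subfieldD[OF assms] in \<open>auto simp: mult_units_def mult_ac\<close>)

section \<open>Norm cosets as equivalence relations on the parameters\<close>

context cubic_over
begin

lemma norm_group_subgroup: "subgroup (norm_group F K1) (mult_units F)"
proof -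
  interpret comm_group "mult_units F" by (rule comm_group_mult_units[OF F])
  have inv_eq: "inv\<^bsub>mult_units F\<^esub> x = inverse x" if "x \<in> F - {0}" for x
    using that subfield_inverse[OF F] by (intro inv_equality) (auto simp: mult_units_def)
  have N: "field_norm F K1 y \<in> F - {0}" if "y \<in> K1 - {0}" for y
    using that field_norm_mem_F field_norm_eq_0_iff by auto
  show ?thesis
  proof (rule subgroupI)
    show "norm_group F K1 \<subseteq> carrier (mult_units F)"
      using N by (auto simp: norm_group_def mult_units_def)
    show "norm_group F K1 \<noteq> {}" using subfield_1[OF K1] by (auto simp: norm_group_def)
    fix a assume "a \<in> norm_group F K1"
    then obtain y where y: "y \<in> K1" "y \<noteq> 0" "a = field_norm F K1 y" by (auto simp: norm_group_def)
    then have "inv\<^bsub>mult_units F\<^esub> a = field_norm F K1 (inverse y)"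
      using inv_eq N[of y] field_norm_inverse by simp
    then show "inv\<^bsub>mult_units F\<^esub> a \<in> norm_group F K1"
      using y subfield_inverse[OF K1] by (auto simp: norm_group_def)
    fix b assume "b \<in> norm_group F K1"
    then obtain z where z: "z \<in> K1" "z \<noteq> 0" "b = field_norm F K1 z" by (auto simp: norm_group_def)
    have "a * b = field_norm F K1 (y * z)" using y z field_norm_mult by simp
    then show "a \<otimes>\<^bsub>mult_units F\<^esub> b \<in> norm_group F K1"
      using y z subfield_mult[OF K1] by (auto simp: norm_group_def mult_units_def)
  qed
qed

end

lemma mult_units_simps [simp]:
  "carrier (mult_units F) = F - {0}" "x \<otimes>\<^bsub>mult_units F\<^esub> y = x * y"
  by (simp_all add: mult_units_def)

context cubic_over
begin

lemma norm_rcos_eq_iff: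
  assumes "a \<in> F - {0}" "b \<in> F - {0}"
  shows "norm_group F K1 #>\<^bsub>mult_units F\<^esub> a = norm_group F K1 #>\<^bsub>mult_units F\<^esub> b \<longleftrightarrow>
    (\<exists>y\<in>K1 - {0}. b = field_norm F K1 y * a)"
proof -
  interpret comm_group "mult_units F" by (rule comm_group_mult_units[OF F])
  show ?thesis using rcos_eq_iff[OF norm_group_subgroup, of a b] assms
    by (auto simp: mult_units_def norm_group_def)
qed

abbreviation ncos :: "'a \<Rightarrow> 'a set" where
  "ncos b \<equiv> norm_group F K1 #>\<^bsub>mult_units F\<^esub> b"

lemma ncos_normal: "norm_group F K1 \<lhd> mult_units F"
  using comm_group.normal_iff_subgroup[OF comm_group_mult_units[OF F]] norm_group_subgroup by blast

lemma ncos_mult: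
  assumes "a \<in> F - {0}" "b \<in> F - {0}"
  shows "ncos a <#>\<^bsub>mult_units F\<^esub> ncos b = ncos (a * b)"
  using normal.rcos_sum[OF ncos_normal, of a b] assms by (simp add: mult_units_def)

lemma group_norm_pairs: "group (norm_pairs F K1)"
  unfolding norm_pairs_def
  using normal.factorgroup_is_group[OF ncos_normal] by (intro DirProd_group)

lemma norm_pairs_carrier: "carrier (norm_pairs F K1) = {(ncos a, ncos b) | a b. a \<in> F - {0} \<and> b \<in> F - {0}}"
  by (auto simp: norm_pairs_def FactGroup_def RCOSETS_def mult_units_def)

lemma norm_pairs_mult: "(A, B) \<otimes>\<^bsub>norm_pairs F K1\<^esub> (C, D) = (A <#>\<^bsub>mult_units F\<^esub> C, B <#>\<^bsub>mult_units F\<^esub> D)"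
  by (simp add: norm_pairs_def FactGroup_def)

lemma diag_pairs_subgroup: "subgroup (diag_pairs F K1) (norm_pairs F K1)"
proof -
  interpret U: comm_group "mult_units F" by (rule comm_group_mult_units[OF F])
  have "group_hom (mult_units F) (norm_pairs F K1) (\<lambda>t. (ncos t, ncos t))"
    using group_norm_pairs U.group_axioms
    by (auto simp: group_hom_def group_hom_axioms_def hom_def norm_pairs_mult norm_pairs_carrier
        ncos_mult)
  from group_hom.img_is_subgroup[OF this] show ?thesis
    by (simp add: diag_pairs_def mult_units_def)
qed

lemma split_coset_eq_iff:
  assumes b: "b1 \<in> F - {0}" "b2 \<in> F - {0}" "b1' \<in> F - {0}" "b2' \<in> F - {0}"
  shows "split_coset F K1 b1 b2 = split_coset F K1 b1' b2' \<longleftrightarrow>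
    (\<exists>t\<in>F - {0}. \<exists>y\<in>K1 - {0}. \<exists>y'\<in>K1 - {0}.
       b1' = t * b1 * field_norm F K1 y \<and> b2' = t * b2 * field_norm F K1 y')"
proof -
  have "split_coset F K1 b1 b2 = split_coset F K1 b1' b2' \<longleftrightarrow>
    (\<exists>t\<in>F - {0}. (ncos b1', ncos b2') = (ncos t, ncos t) \<otimes>\<^bsub>norm_pairs F K1\<^esub> (ncos b1, ncos b2))"
    unfolding split_coset_def
    using group.rcos_eq_iff[OF group_norm_pairs diag_pairs_subgroup, of "(ncos b1, ncos b2)" "(ncos b1', ncos b2')"] b
    by (auto simp: norm_pairs_carrier diag_pairs_def)
  also have "\<dots> \<longleftrightarrow> (\<exists>t\<in>F - {0}. ncos (t * b1) = ncos b1' \<and> ncos (t * b2) = ncos b2')"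
    using b by (auto simp: norm_pairs_mult ncos_mult)
  also have "\<dots> \<longleftrightarrow> (\<exists>t\<in>F - {0}. (\<exists>y\<in>K1 - {0}. b1' = t * b1 * field_norm F K1 y) \<and> (\<exists>y'\<in>K1 - {0}. b2' = t * b2 * field_norm F K1 y'))"
  proof (rule bex_cong[OF refl])
    fix t assume t: "t \<in> F - {0}"
    have "t * b1 \<in> F - {0}" "t * b2 \<in> F - {0}" using t b subfield_mult[OF F] by auto
    then show "(ncos (t * b1) = ncos b1' \<and> ncos (t * b2) = ncos b2') \<longleftrightarrow>
      ((\<exists>y\<in>K1 - {0}. b1' = t * b1 * field_norm F K1 y) \<and> (\<exists>y'\<in>K1 - {0}. b2' = t * b2 * field_norm F K1 y'))"
      using b by (simp add: norm_rcos_eq_iff mult.commute)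
  qed
  finally show ?thesis by blast
qed

lemma split_quot_carrier:
  "carrier (split_quot F K1) = (\<lambda>(b1, b2). split_coset F K1 b1 b2) ` ((F - {0}) \<times> (F - {0}))"
  unfolding split_quot_def FactGroup_def RCOSETS_def norm_pairs_carrier split_coset_def by auto

lemma split_coset_swap: "prod.swap ` split_coset F K1 b1 b2 = split_coset F K1 b2 b1"
  by (auto simp: split_coset_def r_coset_def diag_pairs_def norm_pairs_mult image_iff)

lemma base_norm_group_subgroup: "subgroup (base_norm_group k F K1) (mult_units F)"
proof -
  interpret comm_group "mult_units F" by (rule comm_group_mult_units[OF F])
  have "subgroup (k - {0}) (mult_units F)"
  proof (rule subgroupI)
    fix a assume a: "a \<in> k - {0}"
    then have "inv\<^bsub>mult_units F\<^esub> a = inverse a"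
      using k_F subfield_inverse[OF F] by (intro inv_equality) (auto simp: mult_units_def)
    then show "inv\<^bsub>mult_units F\<^esub> a \<in> k - {0}" using a subfield_inverse[OF k] by simp
  qed (use k_F subfieldD[OF k] in \<open>auto simp: mult_units_def\<close>)
  then show ?thesis unfolding base_norm_group_def using norm_group_subgroup by (rule mult_subgroups)
qed

lemma base_norm_group_eq:
  "base_norm_group k F K1 = {t * field_norm F K1 y | t y. t \<in> k - {0} \<and> y \<in> K1 - {0}}"
  unfolding base_norm_group_def set_mult_def norm_group_def by (auto simp: mult_units_def)

lemma field_coset_eq_iff:
  assumes "b \<in> F - {0}" "b' \<in> F - {0}"
  shows "field_coset k F K1 b = field_coset k F K1 b' \<longleftrightarrow>
    (\<exists>t\<in>k - {0}. \<exists>y\<in>K1 - {0}. b' = t * b * field_norm F K1 y)"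
proof -
  interpret comm_group "mult_units F" by (rule comm_group_mult_units[OF F])
  have "field_coset k F K1 b = field_coset k F K1 b' \<longleftrightarrow> (\<exists>h\<in>base_norm_group k F K1. b' = h * b)"
    unfolding field_coset_def using rcos_eq_iff[OF base_norm_group_subgroup, of b b'] assms
    by (simp add: mult_units_def)
  also have "\<dots> \<longleftrightarrow> (\<exists>t\<in>k - {0}. \<exists>y\<in>K1 - {0}. b' = t * b * field_norm F K1 y)"
  proof -
    have "t * field_norm F K1 y * b = t * b * field_norm F K1 y" for t y by (simp add: mult_ac)
    then show ?thesis unfolding base_norm_group_eq by fastforce
  qed
  finally show ?thesis .
qed

lemma field_quot_carrier: "carrier (field_quot k F K1) = field_coset k F K1 ` (F - {0})"
  by (auto simp: field_quot_def FactGroup_def RCOSETS_def field_coset_def mult_units_def)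

lemma orbit_gkI:
  assumes "t \<in> k - {0}" "\<And>i j. g $ i $ j \<in> k1" "det g \<noteq> 0" "y = Gact (gk t g) x"
  shows "y \<in> orbit k k1 \<sigma> x"
  unfolding orbit_def assms(4) using Gk_iff assms(1-3) by (intro imageI) blast

end

context cubic_setting
begin

text \<open>The fourth power of an extension of \<open>\<sigma>\<close> still restricts to \<open>\<sigma>\<close> on \<open>k\<^sub>1\<close>, and it fixes \<open>F\<close> because
  it is a square; this covers the case \<open>F \<subseteq> k\<^sub>2\<close> as well.\<close>

lemma cubic_over_ex:
  assumes "is_subfield F" "k \<subseteq> F" and ord: "\<And>s a. s \<in> abs_Gal k \<Longrightarrow> a \<in> F \<Longrightarrow> s (s a) = a"
  shows "\<exists>s0. cubic_over k k1 k2 \<sigma> F s0"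
proof -
  have hom: "field_hom_on k k2 \<sigma>" "bij_betw \<sigma> k2 k2" using \<sigma> by (auto simp: Gal_def)
  have k_k2: "k \<subseteq> k2" using k_k1 k1_k2 by blast
  obtain s where s: "s \<in> abs_Gal k" "\<And>x. x \<in> k2 \<Longrightarrow> s x = \<sigma> x"
    using field_hom_extends[OF k2_subfield k_k2 hom(1)] by blast
  have k2': "\<sigma> x \<in> k2" if "x \<in> k2" for x using hom(2) that by (auto simp: bij_betw_def)
  define s0 where "s0 = s \<circ> s \<circ> (s \<circ> s)"
  have s0: "s0 x = \<sigma> (\<sigma> (\<sigma> (\<sigma> x)))" if "x \<in> k2" for x
    using that by (simp add: s0_def s(2) k2')
  have "cubic_over k k1 k2 \<sigma> F s0"
  proof unfold_locales
    show "s0 \<in> abs_Gal k" unfolding s0_def by (intro gal_comp s(1))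
    show "s0 a = a" if "a \<in> F" for a using ord[OF s(1) that] by (simp add: s0_def)
    show "s0 x = \<sigma> x" "s0 (s0 x) = \<sigma> (\<sigma> x)" if "x \<in> k1" for x
      using that three_cycle k1_k2 by (auto simp: s0 k2' subset_iff)
  qed (use assms in auto)
  then show ?thesis by blast
qed

section \<open>The fibre over the split algebra\<close>

lemma split_case:
  "\<exists>\<phi>. bij_betw \<phi> (S2_orbits ((`) prod.swap) (carrier (split_quot k k1))) (alpha_V_fibre k k1 k2 \<sigma> k) \<and>
     (\<forall>\<beta>1\<in>k - {0}. \<forall>\<beta>2\<in>k - {0}.
        \<phi> (S2_orbit ((`) prod.swap) (split_coset k k1 \<beta>1 \<beta>2)) =
          orbit k k1 \<sigma> (tscale \<beta>1 (e_basis 1 1 1) + tscale \<beta>2 (e_basis 2 2 2)))"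
proof -
  have "\<exists>s0. cubic_over k k1 k2 \<sigma> k s0"
    by (rule cubic_over_ex[OF k order.refl]) (simp add: gal_base)
  then obtain s0 where "cubic_over k k1 k2 \<sigma> k s0" ..
  then interpret cubic_over k k1 k2 \<sigma> k s0 .
  have K1k1: "K1 = k1"
    using field_gen_least[OF k1, of "k1 \<union> k"] k1_K1 k_k1 by (auto simp: K1_def)
  let ?v = "axis 1 1 :: 'a^2" and ?w = "axis 2 1 :: 'a^2"
  have v: "?v $ i \<in> k" and w: "?w $ i \<in> k" for i
    using subfieldD[OF k] by (auto simp: axis_def)
  have vw: "det (cols ?v ?w) \<noteq> 0" by (simp add: det_cols axis_def)
  have pt_eq: "tscale b1 (e_basis 1 1 1) + tscale b2 (e_basis 2 2 2) = base_pt ?v ?w b1 b2" for b1 b2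
    by (simp add: base_pt_def e_basis_pt tscale_pt)
  have act: "Gact (gk t g) (base_pt ?v ?w b1 b2) = pt (t * b1) (nt (column 1 g)) + pt (t * b2) (nt (column 2 g))" for t g b1 b2
    unfolding base_pt_def nt_F[OF v, symmetric] nt_F[OF w, symmetric] Gact_add Gact_gk mult_axis ..
  have Vss: "base_pt ?v ?w b1 b2 \<in> Vss k k1 k2 \<sigma>" if "b1 \<in> k - {0}" "b2 \<in> k - {0}" for b1 b2
  proof -
    have "0 \<in> k" "0 \<in> k1" "b1 \<in> k2" "b2 \<in> k2" "0 \<in> k2"
      using that subfield_0[OF k] k_k1 k1_k2 by auto
    moreover have "\<sigma> 0 = 0" using emb_base[of 0 2] subfield_0[OF k] by simp
    moreover have "rel_inv (base_pt ?v ?w b1 b2) = (b1 * b2)\<^sup>2"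
      by (simp add: rel_inv_def base_pt_def pt_def axis_def det_2)
    ultimately show ?thesis using that
      by (auto simp: Vss_def Vsp_def base_pt_def pt_def axis_def)
  qed
  have move: "base_pt ?v ?w b1' b2' \<in> orbit k k1 \<sigma> (base_pt ?v ?w b1 b2)"
    if "t \<in> k - {0}" "y \<in> k1 - {0}" "y' \<in> k1 - {0}"
      "b1' = t * b1 * field_norm k K1 y" "b2' = t * b2 * field_norm k K1 y'" for b1 b2 b1' b2' t y y'
  \<comment> \<open>The matrix is diagonal with entries \<open>y\<close>, \<open>y'\<close>; each
    rescales one basis vector and contributes its norm to one coefficient.\<close>
  proof (rule orbit_gkI[of t "cols (y *s ?v) (y' *s ?w)"])
    show "base_pt ?v ?w b1' b2' = Gact (gk t (cols (y *s ?v) (y' *s ?w))) (base_pt ?v ?w b1 b2)"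
      unfolding act using that pt_nt_smult[of _ _ ?v] pt_nt_smult[of _ _ ?w]
      by (simp add: K1k1 base_pt_def nt_F[OF v] nt_F[OF w] cols_mult_axis mult_axis[symmetric])
  qed (use that subfield_0[OF k1] in \<open>auto simp: det_2 cols_def axis_def\<close>)
  have swap: "base_pt ?v ?w b2 b1 \<in> orbit k k1 \<sigma> (base_pt ?v ?w b1 b2)" for b1 b2
  \<comment> \<open>The permutation matrix exchanging the basis vectors.\<close>
  proof (rule orbit_gkI[of 1 "cols ?w ?v"])
    show "base_pt ?v ?w b2 b1 = Gact (gk 1 (cols ?w ?v)) (base_pt ?v ?w b1 b2)"
      unfolding act by (simp add: base_pt_def nt_F[OF v] nt_F[OF w] cols_mult_axis mult_axis[symmetric])
  qed (use subfieldD[OF k1] subfield_1[OF k] in \<open>auto simp: det_2 cols_def axis_def\<close>)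
  let ?P = "(k - {0}) \<times> (k - {0})"
  let ?cs = "\<lambda>(b1, b2). split_coset k K1 b1 b2" and ?orb = "\<lambda>(b1, b2). orbit k k1 \<sigma> (base_pt ?v ?w b1 b2)"
  have "\<exists>\<phi>. bij_betw \<phi> (S2_orbits ((`) prod.swap) (carrier (split_quot k K1))) (alpha_V_fibre k k1 k2 \<sigma> k) \<and>
     (\<forall>p\<in>?P. \<phi> (S2_orbit ((`) prod.swap) (?cs p)) = ?orb p)"
  proof (rule S2_quotient_bij[where sw = prod.swap])
    show "carrier (split_quot k K1) = ?cs ` ?P" by (rule split_quot_carrier)
    show "prod.swap p \<in> ?P" if "p \<in> ?P" for p using that by auto
    show "prod.swap (prod.swap p) = p" for p :: "'a \<times> 'a" by simp
    show "prod.swap ` ?cs p = ?cs (prod.swap p)" for p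
      by (cases p) (simp add: split_coset_swap)
    show "?orb p = ?orb q \<longleftrightarrow> ?cs p = ?cs q \<or> ?cs p = ?cs (prod.swap q)" if "p \<in> ?P" "q \<in> ?P" for p q
    proof -
      obtain b1 b2 c1 c2 where pq: "p = (b1, b2)" "q = (c1, c2)" by (cases p; cases q)
      have b: "b1 \<in> k - {0}" "b2 \<in> k - {0}" "c1 \<in> k - {0}" "c2 \<in> k - {0}" using that pq by auto
      have "?cs q = ?cs p \<or> ?cs (prod.swap q) = ?cs p" if mem: "base_pt ?v ?w b1 b2 \<in> orbit k k1 \<sigma> (base_pt ?v ?w c1 c2)"
      proof -
        have nz: "c1 \<noteq> 0" "c2 \<noteq> 0" "b1 \<noteq> 0" "b2 \<noteq> 0" using b by auto
        obtain t y y' where "t \<in> k - {0}" "y \<in> K1 - {0}" "y' \<in> K1 - {0}"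
          "b1 = t * c1 * field_norm k K1 y \<and> b2 = t * c2 * field_norm k K1 y' \<or>
           b1 = t * c2 * field_norm k K1 y \<and> b2 = t * c1 * field_norm k K1 y'"
          using orbit_base_pt[OF v w vw nz mem] by metis
        then show ?thesis unfolding pq prod.case prod.swap_def fst_conv snd_conv
          using split_coset_eq_iff[OF b(3,4,1,2)] split_coset_eq_iff[OF b(4,3,1,2)] by blast
      qed
      moreover have "?orb p = ?orb q" if "?cs q = ?cs p"
        using that split_coset_eq_iff[OF b(3,4,1,2)] move unfolding pq prod.case orbit_eq_iff K1k1 by blast
      moreover have "?orb p = ?orb q" if "?cs (prod.swap q) = ?cs p"
      proof -
        have "?orb p = ?orb (prod.swap q)"
          using that split_coset_eq_iff[OF b(4,3,1,2)] move
          unfolding pq prod.case orbit_eq_iff K1k1 prod.swap_def fst_conv snd_conv by blast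
        also have "\<dots> = ?orb q" unfolding pq using orbit_eq[OF swap] by simp
        finally show ?thesis .
      qed
      ultimately show ?thesis unfolding pq prod.case orbit_eq_iff by metis
    qed
    show "?orb ` ?P = alpha_V_fibre k k1 k2 \<sigma> k"
    proof (intro equalityI subsetI)
      fix X assume "X \<in> ?orb ` ?P"
      then obtain b1 b2 where b: "b1 \<in> k - {0}" "b2 \<in> k - {0}" "X = orbit k k1 \<sigma> (base_pt ?v ?w b1 b2)" by auto
      show "X \<in> alpha_V_fibre k k1 k2 \<sigma> k"
        unfolding b(3) by (rule base_pt_fibre[OF v w vw Vss[OF b(1,2)] b(1,2)]) (use gal_base in blast)
    next
      fix X assume X: "X \<in> alpha_V_fibre k k1 k2 \<sigma> k"
      have "quad_cocycle k k = (\<lambda>s\<in>abs_Gal k. id)"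
        unfolding quad_cocycle_def by (rule restrict_ext) (simp add: gal_base)
      then have "quad_cocycle k k \<in> Z1 k (sym_group 2) triv_act"
        using id_in_sym_group[of 2] by (auto simp: Z1_def triv_act_def sym_group_mult gal_comp)
      from fibre_point[OF X this] obtain b1 b2 u1 u2 where u: "b1 \<in> k - {0}" "b2 \<in> k - {0}" "\<And>i. u1 $ i \<in> K1"
        "\<And>i. u2 $ i \<in> K1" "det (cols u1 u2) \<noteq> 0" "X = orbit k k1 \<sigma> (pt b1 (nt u1) + pt b2 (nt u2))" by metis
      have "pt b1 (nt u1) + pt b2 (nt u2) \<in> orbit k k1 \<sigma> (base_pt ?v ?w b1 b2)"
      \<comment> \<open>As \<open>K1 = k1\<close>, the descended vectors are themselves the columns
        of a rational group element.\<close>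
      proof (rule orbit_gkI[of 1 "cols u1 u2"])
        show "pt b1 (nt u1) + pt b2 (nt u2) = Gact (gk 1 (cols u1 u2)) (base_pt ?v ?w b1 b2)"
          unfolding act by (simp add: cols_mult_axis mult_axis[symmetric])
      qed (use u subfield_1[OF k] in \<open>auto simp: cols_def K1k1\<close>)
      then have "X = ?orb (b1, b2)" unfolding u(6) by (simp add: orbit_eq)
      then show "X \<in> ?orb ` ?P" using u(1,2) by blast
    qed
  qed
  then show ?thesis unfolding pt_eq K1k1 by (simp add: split_beta)
qed

end

subsection \<open>The quadratic case\<close>

lemma gal_quadratic:
  assumes "separable_ambient k" "a1 \<in> k" "a2 \<in> k" "\<alpha>1 + \<alpha>2 = - a1" "\<alpha>1 * \<alpha>2 = a2" and s: "s \<in> abs_Gal k"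
  shows "s \<alpha>1 = \<alpha>1 \<and> s \<alpha>2 = \<alpha>2 \<or> s \<alpha>1 = \<alpha>2 \<and> s \<alpha>2 = \<alpha>1"
proof -
  interpret separable_ambient k by fact
  have sum: "s \<alpha>1 + s \<alpha>2 = \<alpha>1 + \<alpha>2"
    using gal_base[OF s assms(2)] by (simp flip: gal_add[OF s] add: assms(4) gal_uminus[OF s])
  have prod: "s \<alpha>1 * s \<alpha>2 = \<alpha>1 * \<alpha>2"
    using gal_base[OF s assms(3)] by (simp flip: gal_mult[OF s] add: assms(5))
  have "(s \<alpha>1 - \<alpha>1) * (s \<alpha>1 - \<alpha>2) = s \<alpha>1 * s \<alpha>1 - s \<alpha>1 * (\<alpha>1 + \<alpha>2) + \<alpha>1 * \<alpha>2"
    by (simp add: algebra_simps)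
  also have "\<dots> = 0" unfolding sum[symmetric] prod[symmetric] by (simp add: algebra_simps)
  finally have "s \<alpha>1 = \<alpha>1 \<or> s \<alpha>1 = \<alpha>2" by (simp only: mult_eq_0_iff right_minus_eq)
  then show ?thesis using sum by (metis add.commute add_left_cancel)
qed

text \<open>\<open>s1\<close> takes the role of \<nu> on the whole ambient field, so that it also
  applies to conjugates lying outside \<open>K1\<close>.\<close>

locale quadratic_over = cubic_over k k1 k2 \<sigma> F s0
  for k k1 k2 :: "'a::field set" and \<sigma> F s0 +
  fixes a1 a2 \<alpha>1 \<alpha>2 :: 'a and s1 :: "'a \<Rightarrow> 'a"
  assumes a: "a1 \<in> k" "a2 \<in> k" "\<alpha>1 + \<alpha>2 = - a1" "\<alpha>1 * \<alpha>2 = a2"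
    and F_def: "F = field_gen (k \<union> {\<alpha>1, \<alpha>2})"
    and s1: "s1 \<in> abs_Gal k" "\<And>x. x \<in> k1 \<Longrightarrow> s1 x = x" "s1 \<alpha>1 \<noteq> \<alpha>1"
begin

lemma gal_\<alpha>: "s \<in> abs_Gal k \<Longrightarrow> s \<alpha>1 = \<alpha>1 \<and> s \<alpha>2 = \<alpha>2 \<or> s \<alpha>1 = \<alpha>2 \<and> s \<alpha>2 = \<alpha>1"
  by (rule gal_quadratic[OF separable_ambient_axioms a])

lemma s1_\<alpha>: "s1 \<alpha>1 = \<alpha>2" "s1 \<alpha>2 = \<alpha>1" and \<alpha>_neq: "\<alpha>1 \<noteq> \<alpha>2"
  using gal_\<alpha>[OF s1(1)] s1(3) by auto

lemma \<alpha>_F: "\<alpha>1 \<in> F" "\<alpha>2 \<in> F"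
  using field_gen_superset[of "k \<union> {\<alpha>1, \<alpha>2}"] by (auto simp: F_def)

lemma agree_F:
  assumes "s \<in> abs_Gal k" "t \<in> abs_Gal k" "s \<alpha>1 = t \<alpha>1" "x \<in> F"
  shows "s x = t x"
proof (rule agree_field_gen[OF assms(1,2) _ assms(4)[unfolded F_def]])
  fix y assume "y \<in> k \<union> {\<alpha>1, \<alpha>2}"
  then show "s y = t y"
    using assms(3) gal_\<alpha>[OF assms(1)] gal_\<alpha>[OF assms(2)] gal_base[OF assms(1)] gal_base[OF assms(2)] by auto
qed

lemma agree_K1:
  assumes "s \<in> abs_Gal k" "t \<in> abs_Gal k" "s \<alpha>1 = t \<alpha>1" "\<And>x. x \<in> k1 \<Longrightarrow> s x = t x" "x \<in> K1"
  shows "s x = t x"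
  using agree_field_gen[OF assms(1,2) _ assms(5)[unfolded K1_def]] agree_F[OF assms(1-3)] assms(4) by blast

lemma fixes_F_iff: "s \<in> abs_Gal k \<Longrightarrow> (\<forall>a\<in>F. s a = a) \<longleftrightarrow> s \<alpha>1 = \<alpha>1"
  using agree_F[OF _ gal_id] \<alpha>_F(1) by auto

lemma not_fixes_F: "s \<in> abs_Gal k \<Longrightarrow> \<not> (\<forall>a\<in>F. s a = a) \<Longrightarrow> s \<alpha>1 = \<alpha>2"
  using gal_\<alpha> fixes_F_iff by blast

lemma s1_F: assumes "x \<in> F" shows "s1 x \<in> F"
proof -
  have "is_subfield {x. s1 x \<in> F}"
    using subfieldD[OF F] gal_0[OF s1(1)] gal_1[OF s1(1)]
    by (simp add: is_subfield_def gal_add[OF s1(1)] gal_mult[OF s1(1)] gal_uminus[OF s1(1)] gal_inverse[OF s1(1)])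
  moreover have "k \<union> {\<alpha>1, \<alpha>2} \<subseteq> {x. s1 x \<in> F}"
    using k_F \<alpha>_F gal_base[OF s1(1)] by (auto simp: s1_\<alpha>)
  ultimately show ?thesis using field_gen_least assms F_def by blast
qed

lemma s1_s1: "x \<in> K1 \<Longrightarrow> s1 (s1 x) = x"
  using agree_K1[OF gal_comp[OF s1(1) s1(1)] gal_id] by (simp add: s1_\<alpha> s1(2))

lemma s1_K1: assumes "x \<in> K1" shows "s1 x \<in> K1"
proof -
  have "is_subfield {x. s1 x \<in> K1}"
    using subfieldD[OF K1] gal_0[OF s1(1)] gal_1[OF s1(1)]
    by (simp add: is_subfield_def gal_add[OF s1(1)] gal_mult[OF s1(1)] gal_uminus[OF s1(1)] gal_inverse[OF s1(1)])
  moreover have "k1 \<union> F \<subseteq> {x. s1 x \<in> K1}" using k1_K1 F_K1 s1_F s1(2) by auto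
  ultimately show ?thesis using field_gen_least assms K1_def by blast
qed

text \<open>On \<open>F\<close> every automorphism over \<open>k\<close> is either trivial or equal
  to \<open>s1\<close>.\<close>

lemma s1_fixed_F:
  assumes "x \<in> F" "s1 x = x" shows "x \<in> k"
proof (rule fixed_field[OF k order.refl])
  fix s assume s: "s \<in> abs_Gal k"
  show "s x = x"
    using gal_\<alpha>[OF s] agree_F[OF s gal_id _ assms(1)] agree_F[OF s s1(1) _ assms(1)] assms(2) s1_\<alpha> by auto
qed

lemma field_norm_s1:
  assumes "y \<in> K1" shows "field_norm F K1 (s1 y) = s1 (field_norm F K1 y)"
proof -
  have "s1 (field_norm F K1 y) = (\<Prod>i\<in>UNIV. s1 (emb s0 i y))"
    by (simp add: field_norm_eq[OF assms] gal_prod[OF s1(1)])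
  also have "\<dots> = (\<Prod>j\<in>UNIV. s1 (emb s0 (prm s1 j) y))"
    using prod.reindex_bij_betw[OF bij_prm[OF s1(1)], of "\<lambda>i. s1 (emb s0 i y)"] by simp
  also have "\<dots> = field_norm F K1 (s1 y)"
    using emb_s0_prm[OF s1(1) s1(1,2) refl s1_F assms] by (simp add: field_norm_eq[OF s1_K1[OF assms]])
  finally show ?thesis by simp
qed

text \<open>Solving \<open>y = p + q \<alpha>1\<close>, \<open>s1 y = p + q \<alpha>2\<close>
  determines \<open>q\<close> and \<open>p\<close>. An automorphism over \<open>k1\<close> either
  fixes both equations or exchanges them, so \<open>p\<close> and \<open>q\<close> are invariant and
  lie in \<open>k1\<close>.\<close>

lemma K1_decomp:
  assumes y: "y \<in> K1"
  obtains p q where "p \<in> k1" "q \<in> k1" "y = p + q * \<alpha>1" "s1 y = p + q * \<alpha>2"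
proof -
  define q where "q = (y - s1 y) / (\<alpha>1 - \<alpha>2)"
  define p where "p = y - q * \<alpha>1"
  have d: "\<alpha>1 - \<alpha>2 \<noteq> 0" using \<alpha>_neq by simp
  have s1y: "s1 y = y - q * (\<alpha>1 - \<alpha>2)" using d by (simp add: q_def)
  have "s q = q \<and> s p = p" if s: "s \<in> abs_Gal k" "\<And>x. x \<in> k1 \<Longrightarrow> s x = x" for s
  proof (cases "s \<alpha>1 = \<alpha>1")
    case True
    have "s x = x" if "x \<in> K1" for x using agree_K1[OF s(1) gal_id _ _ that] True s(2) by simp
    then have "s y = y" "s (s1 y) = s1 y" "s \<alpha>2 = \<alpha>2" using y s1_K1 \<alpha>_F F_K1 by blast+
    then have "s q = q" by (simp add: q_def True gal_divide[OF s(1)] gal_diff[OF s(1)])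
    then show ?thesis by (simp add: p_def True \<open>s y = y\<close> gal_diff[OF s(1)] gal_mult[OF s(1)])
  next
    case False
    then have sa: "s \<alpha>1 = \<alpha>2" "s \<alpha>2 = \<alpha>1" using gal_\<alpha>[OF s(1)] by auto
    have "s x = s1 x" if "x \<in> K1" for x using agree_K1[OF s(1) s1(1) _ _ that] sa s1_\<alpha> s(2) s1(2) by simp
    then have sy: "s y = s1 y" "s (s1 y) = y" using y s1_K1 s1_s1 by auto
    have "s q = (s1 y - y) / (\<alpha>2 - \<alpha>1)" by (simp add: q_def sa sy gal_divide[OF s(1)] gal_diff[OF s(1)])
    also have "\<dots> = q" unfolding q_def by (metis minus_diff_eq minus_divide_divide)
    finally have "s q = q" .
    then show ?thesis using s1y by (simp add: p_def sa sy gal_diff[OF s(1)] gal_mult[OF s(1)] algebra_simps)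
  qed
  then have "p \<in> k1" "q \<in> k1" using fixed_field[OF k1 k_k1] by blast+
  moreover have "y = p + q * \<alpha>1" "s1 y = p + q * \<alpha>2" using s1y by (simp_all add: p_def algebra_simps)
  ultimately show thesis using that by blast
qed

definition v1 :: "'a^2" where "v1 = vector [1, - \<alpha>1]"
definition v2 :: "'a^2" where "v2 = vector [1, - \<alpha>2]"

lemma v12_nth [simp]: "v1 $ 1 = 1" "v1 $ 2 = - \<alpha>1" "v2 $ 1 = 1" "v2 $ 2 = - \<alpha>2"
  by (simp_all add: v1_def v2_def)

lemma v1_F: "v1 $ i \<in> F" and v2_F: "v2 $ i \<in> F"
  using exhaust_2[of i]
  by (elim disjE; simp add: subfield_1[OF F] subfield_uminus[OF F] \<alpha>_F)+

lemma det_v12: "det (cols v1 v2) \<noteq> 0"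
  using \<alpha>_neq by (simp add: det_cols)

abbreviation qpt :: "'a \<Rightarrow> 'a tensor" where "qpt b \<equiv> base_pt v1 v2 b (s1 b)"

lemma vmap_v12:
  assumes "s \<in> abs_Gal k" "s \<alpha>1 = \<alpha>2"
  shows "vmap s v1 = v2"
  by (simp add: vec_eq_iff forall_2 gal_1[OF assms(1)] gal_uminus[OF assms(1)] assms(2))

text \<open>\<open>s1\<close> exchanges the summands, so all coordinates lie in \<open>k\<close>.
  The tensor is also symmetric in its three factors, and for such tensors the conjugacy conditions
  of \<open>V\<close> hold trivially.\<close>

lemma qpt_Vss:
  assumes b: "b \<in> F - {0}"
  shows "qpt b \<in> Vss k k1 k2 \<sigma>"
proof -
  have kk: "qpt b $ i $ j $ l \<in> k" for i j l
  proof (rule s1_fixed_F)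
    have v: "v1 $ i \<in> F" "v2 $ i \<in> F" for i using v1_F v2_F .
    show "qpt b $ i $ j $ l \<in> F"
      using b s1_F v subfield_add[OF F] subfield_mult[OF F] by (simp add: base_pt_def pt_def)
    have "s1 (v1 $ i) = v2 $ i" "s1 (v2 $ i) = v1 $ i" for i
      using exhaust_2[of i]
      by (elim disjE; simp add: gal_1[OF s1(1)] gal_uminus[OF s1(1)] s1_\<alpha>)+
    moreover have "s1 (s1 b) = b" using b F_K1 s1_s1 by blast
    ultimately show "s1 (qpt b $ i $ j $ l) = qpt b $ i $ j $ l"
      by (simp add: base_pt_def pt_def gal_add[OF s1(1)] gal_mult[OF s1(1)])
  qed
  have \<sigma>k: "\<sigma> (qpt b $ i $ j $ l) = qpt b $ i $ j $ l" for i j l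
    using emb_base[OF kk, of 2] by simp
  have sym: "qpt b $ 2 $ 1 $ 2 = qpt b $ 1 $ 2 $ 2" "qpt b $ 2 $ 2 $ 1 = qpt b $ 1 $ 2 $ 2"
    "qpt b $ 1 $ 2 $ 1 = qpt b $ 2 $ 1 $ 1" "qpt b $ 1 $ 1 $ 2 = qpt b $ 2 $ 1 $ 1"
    by (simp_all add: base_pt_def pt_def)
  have "qpt b \<in> Vsp k k1 k2 \<sigma>"
    unfolding Vsp_def using kk k_k1 k1_k2 \<sigma>k sym by (auto simp: subset_iff)
  \<comment> \<open>The hyperdeterminant of \<open>b e_111 + c e_222\<close> is
    \<open>(b c)^2\<close>, and a change of basis in a factor multiplies it by the squared
    determinant, here \<open>(\<alpha>1 - \<alpha>2)^2\<close> for each of the three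
    factors.\<close>
  moreover have "rel_inv (qpt b) = (b * s1 b)\<^sup>2 * (\<alpha>1 - \<alpha>2) ^ 6"
    by (simp add: rel_inv_def base_pt_def pt_def det_2 Let_def) algebra
  moreover have "s1 b \<noteq> 0" using b gal_eq_0_iff[OF s1(1)] by auto
  ultimately show ?thesis using b \<alpha>_neq by (simp add: Vss_def)
qed

lemma Gact_qpt: "Gact (gk t g) (base_pt v1 v2 b c) = pt (t * b) (nt (g *v v1)) + pt (t * c) (nt (g *v v2))"
  unfolding base_pt_def nt_F[OF v1_F, symmetric] nt_F[OF v2_F, symmetric] Gact_add Gact_gk ..

text \<open>Multiplication by \<open>y\<close> has a matrix over \<open>k1\<close> with eigenvectors
  \<open>v1\<close>, \<open>v2\<close> and eigenvalues \<open>y\<close>, \<open>s1 y\<close>. It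
  multiplies the two coefficients by the norm of \<open>y\<close> and by its conjugate, which keeps
  the shape of \<open>qpt\<close>.\<close>

lemma qpt_norm_orbit:
  assumes t: "t \<in> k - {0}" and y: "y \<in> K1 - {0}"
  shows "qpt (t * b * field_norm F K1 y) \<in> orbit k k1 \<sigma> (qpt b)"
proof -
  obtain p q where pq: "p \<in> k1" "q \<in> k1" "y = p + q * \<alpha>1" "s1 y = p + q * \<alpha>2"
    using y K1_decomp[of y] by blast
  have ak: "a1 \<in> k1" "a2 \<in> k1" using a k_k1 by auto
  have a1: "a1 = - \<alpha>1 - \<alpha>2" using a(3) by (simp add: algebra_simps eq_neg_iff_add_eq_0)
  \<comment> \<open>multiplication by \<open>y = p + q \<alpha>\<^sub>1\<close> in the basis \<open>1, -\<alpha>\<^sub>1\<close>\<close>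
  let ?g = "cols (vector [p, a2 * q]) (vector [- q, p - a1 * q]) :: 'a^2^2"
  have g1: "?g *v v1 = y *s v1"
    by (simp add: vec_eq_iff forall_2 cols_def matrix_vector_mult_def sum_2 pq(3) a1 a(4)[symmetric] algebra_simps)
  have g2: "?g *v v2 = s1 y *s v2"
    by (simp add: vec_eq_iff forall_2 cols_def matrix_vector_mult_def sum_2 pq(4) a1 a(4)[symmetric] algebra_simps)
  have "det ?g * det (cols v1 v2) = y * s1 y * det (cols v1 v2)"
    unfolding det_mul[symmetric] matrix_mult_cols g1 g2 by (simp add: det_cols algebra_simps)
  then have det: "det ?g \<noteq> 0" using det_v12 y gal_eq_0_iff[OF s1(1)] by auto
  have yK: "y \<in> K1" "s1 y \<in> K1" using y s1_K1 by auto
  have st: "s1 t = t" using t gal_base[OF s1(1)] by auto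
  show ?thesis
  proof (rule orbit_gkI[OF t _ det])
    show "?g $ i $ j \<in> k1" for i j
      using exhaust_2[of i] exhaust_2[of j] pq ak subfield_mult[OF k1] subfield_diff[OF k1] subfield_uminus[OF k1]
      by (auto simp: cols_def)
    show "qpt (t * b * field_norm F K1 y) = Gact (gk t ?g) (qpt b)"
      unfolding Gact_qpt g1 g2 pt_nt_smult[OF yK(1)] pt_nt_smult[OF yK(2)] nt_F[OF v1_F] nt_F[OF v2_F]
      by (simp add: base_pt_def field_norm_s1[OF yK(1)] gal_mult[OF s1(1)] st)
  qed
qed

lemma qpt_swap_orbit:
  assumes b: "b \<in> F"
  shows "qpt (s1 b) \<in> orbit k k1 \<sigma> (qpt b)"
proof -
  have ak: "a1 \<in> k1" using a k_k1 by auto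
  \<comment> \<open>The reflection of the second coordinate sending \<open>-\<alpha>1\<close> to
    \<open>a1 + \<alpha>1 = -\<alpha>2\<close>, and conversely.\<close>
  let ?g = "cols (vector [1, a1]) (vector [0, - 1]) :: 'a^2^2"
  have a1: "a1 = - \<alpha>1 - \<alpha>2" using a(3) by (simp add: algebra_simps eq_neg_iff_add_eq_0)
  have g: "?g *v v1 = v2" "?g *v v2 = v1"
    by (simp_all add: vec_eq_iff forall_2 cols_def matrix_vector_mult_def sum_2 a1)
  show ?thesis
  proof (rule orbit_gkI[of 1 ?g])
    show "?g $ i $ j \<in> k1" for i j
      using exhaust_2[of i] exhaust_2[of j] ak subfieldD[OF k1] by (auto simp: cols_def)
    show "qpt (s1 b) = Gact (gk 1 ?g) (qpt b)"
      unfolding Gact_qpt g nt_F[OF v1_F] nt_F[OF v2_F]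
      using s1_s1 b F_K1 by (simp add: base_pt_def subset_iff add.commute)
    show "det ?g \<noteq> 0" by (simp add: det_2 cols_def)
  qed (simp add: subfield_1[OF k])
qed

text \<open>The value at \<open>s\<close> is its permutation of the two roots, which is
  multiplicative; it depends on \<open>s \<alpha>1\<close> only, whence continuity.\<close>

lemma quad_cocycle_Z1: "quad_cocycle k F \<in> Z1 k (sym_group 2) triv_act"
proof -
  have c: "quad_cocycle k F s = (if s \<alpha>1 = \<alpha>1 then id else Transposition.transpose 1 2)" if "s \<in> abs_Gal k" for s
    using that fixes_F_iff by (simp add: quad_cocycle_def)
  have "quad_cocycle k F (s \<circ> t) = quad_cocycle k F s \<circ> quad_cocycle k F t" if st: "s \<in> abs_Gal k" "t \<in> abs_Gal k" for s t
    using gal_\<alpha>[OF st(1)] gal_\<alpha>[OF st(2)] \<alpha>_neq by (auto simp: c st gal_comp)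
  moreover have "\<exists>S. finite S \<and> (\<forall>t\<in>abs_Gal k. (\<forall>x\<in>S. t x = s x) \<longrightarrow> quad_cocycle k F t = quad_cocycle k F s)"
    if "s \<in> abs_Gal k" for s
    using that by (intro exI[of _ "{\<alpha>1}"]) (simp add: c)
  moreover have "quad_cocycle k F \<in> abs_Gal k \<rightarrow>\<^sub>E carrier (sym_group 2)"
    using id_in_sym_group[of 2] transpose_in_sym_group by (auto simp: quad_cocycle_def)
  ultimately show ?thesis by (simp add: Z1_def triv_act_def sym_group_mult)
qed

text \<open>\<open>s1\<close> fixes \<open>k\<close> and commutes with the norm, which gives one
  inclusion. The other is the same inclusion for \<open>s1 b\<close>, because \<open>s1\<close> is
  an involution on \<open>K1\<close>.\<close>

lemma field_coset_s1:
  assumes "b \<in> F - {0}"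
  shows "s1 ` field_coset k F K1 b = field_coset k F K1 (s1 b)"
proof -
  have fc: "field_coset k F K1 c = {t * field_norm F K1 y * c | t y. t \<in> k - {0} \<and> y \<in> K1 - {0}}" for c
    unfolding field_coset_def r_coset_def base_norm_group_eq by auto
  have sub: "s1 ` field_coset k F K1 c \<subseteq> field_coset k F K1 (s1 c)" for c
  proof
    fix x assume "x \<in> s1 ` field_coset k F K1 c"
    then obtain t y where ty: "t \<in> k - {0}" "y \<in> K1 - {0}" "x = s1 (t * field_norm F K1 y * c)" unfolding fc by auto
    then have "x = t * field_norm F K1 (s1 y) * s1 c"
      using gal_base[OF s1(1)] by (simp add: gal_mult[OF s1(1)] field_norm_s1)
    moreover have "s1 y \<in> K1 - {0}" using ty s1_K1 gal_eq_0_iff[OF s1(1)] by auto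
    ultimately show "x \<in> field_coset k F K1 (s1 c)" unfolding fc using ty(1) by blast
  qed
  have bF: "s1 (s1 b) = b" using assms F_K1 s1_s1 by auto
  have "x \<in> s1 ` field_coset k F K1 b" if x: "x \<in> field_coset k F K1 (s1 b)" for x
  proof -
    obtain t y where "t \<in> k" "y \<in> K1" "x = t * field_norm F K1 y * s1 b"
      using x unfolding fc by auto
    then have "x \<in> F" using field_norm_mem_F assms s1_F k_F subfield_mult[OF F] by (metis DiffD1 subsetD)
    then have "x \<in> K1" using F_K1 by blast
    then have "x = s1 (s1 x)" using s1_s1 by simp
    moreover have "s1 x \<in> field_coset k F K1 b" using sub[of "s1 b"] x bF by auto
    ultimately show ?thesis by blast
  qed
  then show ?thesis using sub[of b] by blast
qed

lemma quadratic_case: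
  assumes \<nu>: "\<And>x. x \<in> F \<Longrightarrow> \<nu> x = s1 x"
  shows "\<exists>\<phi>. bij_betw \<phi> (S2_orbits ((`) \<nu>) (carrier (field_quot k F K1))) (alpha_V_fibre k k1 k2 \<sigma> F) \<and>
    (\<forall>b\<in>F - {0}. \<phi> (S2_orbit ((`) \<nu>) (field_coset k F K1 b)) = orbit k k1 \<sigma> (qpt b))"
proof (rule S2_quotient_bij[where sw = s1])
  show "carrier (field_quot k F K1) = field_coset k F K1 ` (F - {0})" by (rule field_quot_carrier)
  have sF: "s1 b \<in> F - {0}" if "b \<in> F - {0}" for b using that s1_F gal_eq_0_iff[OF s1(1)] by auto
  then show "s1 b \<in> F - {0}" if "b \<in> F - {0}" for b using that .
  show "s1 (s1 b) = b" if "b \<in> F - {0}" for b using that F_K1 s1_s1 by auto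
  show "\<nu> ` field_coset k F K1 b = field_coset k F K1 (s1 b)" if b: "b \<in> F - {0}" for b
  proof -
    have "field_coset k F K1 b \<subseteq> F"
      unfolding field_coset_def r_coset_def base_norm_group_eq
      using b field_norm_mem_F k_F subfield_mult[OF F] by auto
    then have "\<nu> ` field_coset k F K1 b = s1 ` field_coset k F K1 b"
      using \<nu> by (intro image_cong refl) blast
    then show ?thesis using field_coset_s1[OF b] by simp
  qed
  show "orbit k k1 \<sigma> (qpt b) = orbit k k1 \<sigma> (qpt c) \<longleftrightarrow>
      field_coset k F K1 b = field_coset k F K1 c \<or> field_coset k F K1 b = field_coset k F K1 (s1 c)"
    if bc: "b \<in> F - {0}" "c \<in> F - {0}" for b c
  proof -
    have move: "orbit k k1 \<sigma> (qpt b) = orbit k k1 \<sigma> (qpt d)" if "field_coset k F K1 d = field_coset k F K1 b" "d \<in> F - {0}" for d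
      using that field_coset_eq_iff[OF that(2) bc(1)] qpt_norm_orbit orbit_eq by metis
    have "field_coset k F K1 c = field_coset k F K1 b \<or> field_coset k F K1 (s1 c) = field_coset k F K1 b"
      if mem: "qpt b \<in> orbit k k1 \<sigma> (qpt c)"
    proof -
      have nz: "c \<noteq> 0" "s1 c \<noteq> 0" "b \<noteq> 0" "s1 b \<noteq> 0" using bc sF by auto
      obtain t y y' where "t \<in> k - {0}" "y \<in> K1 - {0}" "y' \<in> K1 - {0}"
        "b = t * c * field_norm F K1 y \<and> s1 b = t * s1 c * field_norm F K1 y' \<or>
         b = t * s1 c * field_norm F K1 y \<and> s1 b = t * c * field_norm F K1 y'"
        using orbit_base_pt[OF v1_F v2_F det_v12 nz mem] by metis
      then show ?thesis
        using field_coset_eq_iff[OF bc(2,1)] field_coset_eq_iff[OF sF[OF bc(2)] bc(1)] by blast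
    qed
    moreover have "orbit k k1 \<sigma> (qpt (s1 c)) = orbit k k1 \<sigma> (qpt c)"
      using orbit_eq[OF qpt_swap_orbit] bc by blast
    ultimately show ?thesis using move[of c] move[of "s1 c"] bc(2) sF[OF bc(2)] orbit_eq_iff by metis
  qed
  show "(\<lambda>b. orbit k k1 \<sigma> (qpt b)) ` (F - {0}) = alpha_V_fibre k k1 k2 \<sigma> F"
  proof (intro equalityI subsetI)
    fix X assume "X \<in> (\<lambda>b. orbit k k1 \<sigma> (qpt b)) ` (F - {0})"
    then obtain b where b: "b \<in> F - {0}" "X = orbit k k1 \<sigma> (qpt b)" by auto
    show "X \<in> alpha_V_fibre k k1 k2 \<sigma> F" unfolding b(2)
    proof (rule base_pt_fibre[OF v1_F v2_F det_v12 qpt_Vss[OF b(1)] b(1) sF[OF b(1)]])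
      fix s assume s: "s \<in> abs_Gal k" "\<not> (\<forall>a\<in>F. s a = a)"
      have sa: "s \<alpha>1 = \<alpha>2" by (rule not_fixes_F[OF s])
      have "s b = s1 b" using agree_F[OF s(1) s1(1)] sa s1_\<alpha> b(1) by auto
      then show "tw s (pt b (\<lambda>_. v1)) = pt (s1 b) (\<lambda>_. v2)"
        by (simp add: tw_pt[OF s(1)] vmap_v12[OF s(1) sa])
    qed
  next
    fix X assume X: "X \<in> alpha_V_fibre k k1 k2 \<sigma> F"
    obtain b1 b2 u1 u2 where u: "b1 \<in> F - {0}" "b2 \<in> F - {0}" "\<And>i. u1 $ i \<in> K1" "\<And>i. u2 $ i \<in> K1"
      "det (cols u1 u2) \<noteq> 0" "X = orbit k k1 \<sigma> (pt b1 (nt u1) + pt b2 (nt u2))"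
      "\<And>s. s \<in> abs_Gal k \<Longrightarrow> \<not> (\<forall>a\<in>F. s a = a) \<Longrightarrow> tw s (pt b1 (nt u1)) = pt b2 (nt u2)"
      using fibre_point[OF X quad_cocycle_Z1] by metis
    \<comment> \<open>\<open>s1\<close> moves \<open>F\<close>, so it takes the first summand to the
      second: \<open>b2\<close>, \<open>u2\<close> may be replaced by the conjugates of
      \<open>b1\<close>, \<open>u1\<close>.\<close>
    have "pt b2 (nt u2) = tw s1 (pt b1 (nt u1))"
      using u(7)[OF s1(1)] fixes_F_iff[OF s1(1)] s1(3) by simp
    also have "\<dots> = pt (s1 b1) (nt (vmap s1 u1))"
      using tw_pt_nt[OF s1(1) s1(1,2) refl s1_F u(3)] .
    finally have eq: "pt b2 (nt u2) = pt (s1 b1) (nt (vmap s1 u1))" .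
    have u2: "u2 \<noteq> 0" using det_cols_nonzero(2)[OF u(5)] .
    obtain c where c: "c \<noteq> 0" "vmap s1 u1 = c *s u2"
      using pt_eq_parallel[OF eq, of 1] u(2) u2 nt_eq_0_iff nt_1 by auto
    have d: "det (cols u1 (vmap s1 u1)) \<noteq> 0"
      using u(5) c by (simp add: det_cols algebra_simps)
    obtain p q where pq: "\<And>i. p i \<in> k1" "\<And>i. q i \<in> k1" "\<And>i. u1 $ i = p i + q i * \<alpha>1" "\<And>i. s1 (u1 $ i) = p i + q i * \<alpha>2"
    proof -
      have "\<exists>p q. p \<in> k1 \<and> q \<in> k1 \<and> u1 $ i = p + q * \<alpha>1 \<and> s1 (u1 $ i) = p + q * \<alpha>2" for i
        using K1_decomp[OF u(3), of i] by metis
      then show thesis using that by metis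
    qed
    \<comment> \<open>Splitting \<open>u1 = p + q \<alpha>1\<close> over \<open>k1\<close> makes
      \<open>u1\<close> the image of \<open>(1, -\<alpha>1)\<close> under the matrix with columns
      \<open>p\<close>, \<open>-q\<close>; conjugation gives the same for \<open>v2\<close>.\<close>
    define g :: "'a^2^2" where "g = cols (\<chi> i. p i) (\<chi> i. - q i)"
    have g: "g *v v1 = u1" "g *v v2 = vmap s1 u1"
      by (simp_all add: vec_eq_iff g_def cols_def matrix_vector_mult_def sum_2 pq(3)[symmetric] pq(4))
    have "det g * det (cols v1 v2) = det (cols u1 (vmap s1 u1))"
      unfolding det_mul[symmetric] matrix_mult_cols g ..
    then have "det g \<noteq> 0" using d by auto
    then have "pt b1 (nt u1) + pt b2 (nt u2) \<in> orbit k k1 \<sigma> (qpt b1)"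
    proof (rule orbit_gkI[of 1 g, rotated 2])
      show "pt b1 (nt u1) + pt b2 (nt u2) = Gact (gk 1 g) (qpt b1)"
        unfolding Gact_qpt g eq by simp
    qed (use pq subfield_1[OF k] subfield_uminus[OF k1] in \<open>auto simp: g_def cols_def\<close>)
    then have "X = orbit k k1 \<sigma> (qpt b1)" unfolding u(6) by (rule orbit_eq)
    then show "X \<in> (\<lambda>b. orbit k k1 \<sigma> (qpt b)) ` (F - {0})" using u(1) by blast
  qed
qed

lemma Gact_g_alpha:
  "Gact (g_alpha \<alpha>1 \<alpha>2) (tscale b (e_basis 1 1 1) + tscale c (e_basis 2 2 2)) = base_pt v1 v2 b c"
proof -
  have "vector [vector [1, 1], vector [- \<alpha>1, - \<alpha>2]] = cols v1 v2"
    by (simp add: vec_eq_iff forall_2 cols_def)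
  then show ?thesis
    by (simp add: g_alpha_def Gact_add e_basis_pt tscale_pt Gact_pt cols_mult_axis base_pt_def)
qed

end

theorem theorem3p13:
  fixes k k1 k2 :: "'a::field set" and \<sigma> :: "'a \<Rightarrow> 'a"
  assumes k: "is_subfield k" and k_inf: "infinite k"
    and sep_closure: "UNIV_separable_closure k"
    and k1: "is_subfield k1" and cubic: "ext_degree k k1 3" and k1_sep: "separable_ext k k1"
    and k2: "is_normal_closure k k1 k2"
    and \<sigma>: "\<sigma> \<in> Gal k k2"
    and embs: "embeddings k k1 k2 = {restrict id k1, restrict \<sigma> k1, restrict (\<sigma> \<circ> \<sigma>) k1}"
    and embs_distinct: "card (embeddings k k1 k2) = 3"
    and three_cycle: "\<forall>x\<in>k1. \<sigma> (\<sigma> (\<sigma> x)) = x"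
  shows
    "(\<exists>\<phi>. bij_betw \<phi> (S2_orbits ((`) prod.swap) (carrier (split_quot k k1)))
              (alpha_V_fibre k k1 k2 \<sigma> k) \<and>
        (\<forall>\<beta>1\<in>k - {0}. \<forall>\<beta>2\<in>k - {0}.
           \<phi> (S2_orbit ((`) prod.swap) (split_coset k k1 \<beta>1 \<beta>2)) =
             orbit k k1 \<sigma> (tscale \<beta>1 (e_basis 1 1 1) + tscale \<beta>2 (e_basis 2 2 2)))) \<and>
     (\<forall>a1 a2 \<alpha>1 \<alpha>2 k\<alpha> k1\<alpha> k2\<alpha> \<nu>.
        a1 \<in> k \<and> a2 \<in> k \<and>
        (\<forall>v1 v2. v1\<^sup>2 + a1 * v1 * v2 + a2 * v2\<^sup>2 = (v1 - \<alpha>1 * v2) * (v1 - \<alpha>2 * v2)) \<and>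
        k\<alpha> = field_gen (k \<union> {\<alpha>1, \<alpha>2}) \<and>
        k1\<alpha> = field_gen (k1 \<union> {\<alpha>1, \<alpha>2}) \<and>
        k2\<alpha> = field_gen (k2 \<union> {\<alpha>1, \<alpha>2}) \<and>
        ext_degree k k\<alpha> 2 \<and> separable_ext k k\<alpha> \<and>
        \<nu> \<in> Gal k k\<alpha> \<and> (\<exists>x\<in>k\<alpha>. \<nu> x \<noteq> x) \<and> \<nu> \<in> Gal k1 k2\<alpha> \<longrightarrow>
        (\<exists>\<phi>. bij_betw \<phi> (S2_orbits ((`) \<nu>) (carrier (field_quot k k\<alpha> k1\<alpha>)))
                (alpha_V_fibre k k1 k2 \<sigma> k\<alpha>) \<and>
          (\<forall>\<beta>\<in>k\<alpha> - {0}.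
             \<phi> (S2_orbit ((`) \<nu>) (field_coset k k\<alpha> k1\<alpha> \<beta>)) =
               orbit k k1 \<sigma> (Gact (g_alpha \<alpha>1 \<alpha>2)
                 (tscale \<beta> (e_basis 1 1 1) + tscale (\<nu> \<beta>) (e_basis 2 2 2))))))"
proof -
  interpret cubic_setting k k1 k2 \<sigma>
    using assms by unfold_locales (auto simp: ext_degree_def)
  have quad: "\<exists>\<phi>. bij_betw \<phi> (S2_orbits ((`) \<nu>) (carrier (field_quot k k\<alpha> k1\<alpha>)))
                (alpha_V_fibre k k1 k2 \<sigma> k\<alpha>) \<and>
          (\<forall>\<beta>\<in>k\<alpha> - {0}.
             \<phi> (S2_orbit ((`) \<nu>) (field_coset k k\<alpha> k1\<alpha> \<beta>)) =
               orbit k k1 \<sigma> (Gact (g_alpha \<alpha>1 \<alpha>2)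
                 (tscale \<beta> (e_basis 1 1 1) + tscale (\<nu> \<beta>) (e_basis 2 2 2))))"
    if a: "a1 \<in> k" "a2 \<in> k"
      and roots: "\<forall>v1 v2. v1\<^sup>2 + a1 * v1 * v2 + a2 * v2\<^sup>2 = (v1 - \<alpha>1 * v2) * (v1 - \<alpha>2 * v2)"
      and k\<alpha>: "k\<alpha> = field_gen (k \<union> {\<alpha>1, \<alpha>2})" and k1\<alpha>: "k1\<alpha> = field_gen (k1 \<union> {\<alpha>1, \<alpha>2})"
      and k2\<alpha>: "k2\<alpha> = field_gen (k2 \<union> {\<alpha>1, \<alpha>2})"
      and \<nu>: "\<exists>x\<in>k\<alpha>. \<nu> x \<noteq> x" "\<nu> \<in> Gal k1 k2\<alpha>"
    for a1 a2 \<alpha>1 \<alpha>2 k\<alpha> k1\<alpha> k2\<alpha> \<nu>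
  proof -
    \<comment> \<open>The coefficients are compared through the values at \<open>(0, 1)\<close> and
      \<open>(1, 1)\<close>.\<close>
    have prod: "\<alpha>1 * \<alpha>2 = a2" using roots[rule_format, of 0 1] by simp
    have "1 + a1 + a2 = (1 - \<alpha>1) * (1 - \<alpha>2)" using roots[rule_format, of 1 1] by simp
    then have sum: "\<alpha>1 + \<alpha>2 = - a1"
      by (simp add: prod[symmetric] algebra_simps eq_neg_iff_add_eq_0)
    note conj = gal_quadratic[OF separable_ambient_axioms a sum prod]
    have k_k\<alpha>: "k \<subseteq> k\<alpha>" using field_gen_superset[of "k \<union> {\<alpha>1, \<alpha>2}"] k\<alpha> by blast
    have k2_k2\<alpha>: "k2 \<union> {\<alpha>1, \<alpha>2} \<subseteq> k2\<alpha>" unfolding k2\<alpha> by (rule field_gen_superset)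
    then have k_k2\<alpha>: "k \<subseteq> k2\<alpha>" "k1 \<subseteq> k2\<alpha>" using k_k1 k1_k2 by blast+
    have sub2: "is_subfield k2\<alpha>" unfolding k2\<alpha> by (rule is_subfield_field_gen)
    have k\<alpha>_k2\<alpha>: "k\<alpha> \<subseteq> k2\<alpha>"
      unfolding k\<alpha> using k_k2\<alpha> k2_k2\<alpha> by (intro field_gen_least[OF sub2]) auto
    have hom: "field_hom_on k1 k2\<alpha> \<nu>" using \<nu>(2) by (simp add: Gal_def)
    then have "field_hom_on k k2\<alpha> \<nu>" using k_k1 unfolding field_hom_on_def by blast
    \<comment> \<open>\<nu> is given on \<open>k2\<alpha>\<close> only; an extension places it in
      the absolute Galois group.\<close>
    then obtain s1 where s1_ext: "s1 \<in> abs_Gal k" "\<And>x. x \<in> k2\<alpha> \<Longrightarrow> s1 x = \<nu> x"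
      using field_hom_extends[OF sub2 k_k2\<alpha>(1)] by blast
    have "\<exists>s0. cubic_over k k1 k2 \<sigma> k\<alpha> s0"
    proof (rule cubic_over_ex)
      show "is_subfield k\<alpha>" unfolding k\<alpha> by (rule is_subfield_field_gen)
      fix s x assume s: "s \<in> abs_Gal k" and x: "x \<in> k\<alpha>"
      \<comment> \<open>\<open>s\<close> fixes or exchanges the two roots, so its square fixes the
        generators of \<open>k\<alpha>\<close>.\<close>
      have "(s \<circ> s) x = id x"
        using conj[OF s] gal_base[OF s]
        by (intro agree_field_gen[OF gal_comp[OF s s] gal_id _ x[unfolded k\<alpha>]]) auto
      then show "s (s x) = x" by simp
    qed (rule k_k\<alpha>)
    then obtain s0 where "cubic_over k k1 k2 \<sigma> k\<alpha> s0" ..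
    then interpret cubic_over k k1 k2 \<sigma> k\<alpha> s0 .
    \<comment> \<open>Fixing \<open>\<alpha>1\<close> would fix \<open>\<alpha>2\<close> as well and
      make \<nu> trivial on \<open>k\<alpha>\<close>.\<close>
    have "s1 \<alpha>1 \<noteq> \<alpha>1"
    proof
      assume "s1 \<alpha>1 = \<alpha>1"
      then have fix\<alpha>: "s1 y = id y" if "y \<in> k \<union> {\<alpha>1, \<alpha>2}" for y
        using conj[OF s1_ext(1)] gal_base[OF s1_ext(1)] that by auto
      have "\<nu> x = x" if "x \<in> k\<alpha>" for x
        using agree_field_gen[OF s1_ext(1) gal_id fix\<alpha> that[unfolded k\<alpha>]] that s1_ext(2) k\<alpha>_k2\<alpha> by auto
      then show False using \<nu>(1) by blast
    qed
    moreover have "s1 x = x" if "x \<in> k1" for x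
      using s1_ext(2) hom that k_k2\<alpha>(2) by (auto simp: field_hom_on_def)
    ultimately interpret quadratic_over k k1 k2 \<sigma> k\<alpha> s0 a1 a2 \<alpha>1 \<alpha>2 s1
      using a sum prod k\<alpha> s1_ext(1) by unfold_locales
    have K1_eq: "K1 = k1\<alpha>"
    proof
      show "K1 \<subseteq> k1\<alpha>"
      proof -
        have sub1: "is_subfield k1\<alpha>" and sup: "k1 \<union> {\<alpha>1, \<alpha>2} \<subseteq> k1\<alpha>"
          unfolding k1\<alpha> by (rule is_subfield_field_gen, rule field_gen_superset)
        then have "k\<alpha> \<subseteq> k1\<alpha>" unfolding k\<alpha> using k_k1 by (intro field_gen_least) auto
        then show ?thesis unfolding K1_def using sub1 sup by (intro field_gen_least) auto
      qed
      show "k1\<alpha> \<subseteq> K1"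
        unfolding k1\<alpha> using k1_K1 F_K1 \<alpha>_F by (intro field_gen_least[OF K1]) auto
    qed
    have \<nu>s1: "\<nu> x = s1 x" if "x \<in> k\<alpha>" for x using s1_ext(2) that k\<alpha>_k2\<alpha> by auto
    have pt_eq: "Gact (g_alpha \<alpha>1 \<alpha>2) (tscale b (e_basis 1 1 1) + tscale (\<nu> b) (e_basis 2 2 2)) = qpt b"
      if "b \<in> k\<alpha> - {0}" for b
      using that \<nu>s1[of b] by (simp add: Gact_g_alpha)
    show ?thesis
      using quadratic_case[OF \<nu>s1] unfolding K1_eq by (simp only: pt_eq cong: ball_cong)
  qed
  show ?thesis by (intro conjI split_case allI impI, elim conjE) (rule quad)
qed

end
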